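(* Consider the linear system $x_{t+1}=Ax_t+B_uu_t+B_ww_t$ with per-step cost $x_t^*Qx_t+u_t^*u_t$, where $Q\succ0$, $(A,B_u)$ is stabilizable, $B_w$ is square with full column rank (hence invertible), and $G(e^{j\omega})$ has full column rank for all $\omega$. With the notation of the context, the optimal competitive ratio is $$\text{Comp-Ratio}=\inf_{\mathcal K\text{ strictly causal}}\ \sup_{\mathbf w}\frac{\mathrm{cost}(\mathcal K,\mathbf w)}{\mathrm{cost}(\mathcal K_0,\mathbf w)}=1+\lambda_{\max}(Z_1\overline\Pi),$$ where $\overline\Pi$ solves $$\overline\Pi=A_K^*\overline\Pi A_K+(P-A_K^*PA_T)(Q^{-1}+T)(P-A_T^*PA_K).$$ Let $\overline Z_\ast$ be the solution $Z_\gamma$ of $Z_\gamma=A_KZ_\gamma A_K^*+\gamma^{-2}B_u(I+B_u^*PB_u)^{-1}B_u^*$ with $\gamma^2=\lambda_{\max}(Z_1\overline\Pi)$. Then an optimal competitive-ratio controller (i.e. a strictly causal controller attaining this value) is $$u_t=-K_{\text{lqr}}x_t+(I+B_u^*PB_u)^{-1}B_u^*\begin{pmatrix}PA_T&-\overline\Pi\end{pmatrix}\begin{pmatrix}\xi^1_t\\ \xi^2_t\end{pmatrix},$$ $$\begin{pmatrix}\xi^1_{t+1}\\ \xi^2_{t+1}\end{pmatrix}=\begin{pmatrix}A_T&0\\ \overline K_\gamma A_T&\overline F_\gamma\end{pmatrix}\begin{pmatrix}\xi^1_t\\ \xi^2_t\end{pmatrix}+\begin{pmatrix}I\\ \overline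 K_\gamma\end{pmatrix}B_ww_t,$$ where $$\overline K_\gamma=(I-A_K\overline Z_\ast A_K^*\overline\Pi)^{-1}A_K\overline Z_\ast(P-A_K^*PA_T),\qquad \overline F_\gamma=A_K-\overline K_\gamma Q^{-1/2}R_TQ^{-1/2}(P-A_T^*PA_K).$$
   Context: Setting. Time runs over all integers. $x_t\in\mathbb R^n$ is the state, $u_t\in\mathbb R^p$ the control, $w_t\in\mathbb R^m$ the disturbance (here $m=n$); $x_{t+1}=Ax_t+B_uu_t+B_ww_t$; ${}^*$ is conjugate transpose; $Q^{1/2}$ is the symmetric square root and $Q^{-1/2}$ its inverse; $\lambda_{\max}(\cdot)$ is the largest eigenvalue. The disturbance $\mathbf w=\{w_t\}$ is in $\ell_2$ (nonzero when it appears in a ratio). Set $F(z)=Q^{1/2}(zI-A)^{-1}B_u$ and $G(z)=Q^{1/2}(zI-A)^{-1}B_w$, and let $\mathcal F,\mathcal G$ be the associated causal time-invariant doubly infinite block Toeplitz operators, with Markov parameters $Q^{1/2}A^{i-1}B_u$ and $Q^{1/2}A^{i-1}B_w$, $i>0$; thus $\{Q^{1/2}x_t\}=\mathcal F\mathbf u+\mathcal G\mathbf w$. A strictly causal (linear) controller is a linear map $\mathbf u=\mathcal K\mathbf w$ such that $u_t$ depends only on $\{w_i\}_{i<t}$. Its cost is $$\mathrm{cost}(\mathcal K,\mathbf w)=\sum_{t\in\mathbb Z}(x_t^*Qx_t+u_t^*u_t)=\mathbf w^*T_{\mathcal K}^*T_{\mathcal K}\mathbf w,\qquad T_{\mathcal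 K}=\begin{bmatrix}\mathcal F\mathcal K+\mathcal G\\ \mathcal K\end{bmatrix}.$$ The optimal non-causal (clairvoyant) controller is $\mathcal K_0=-(I+\mathcal F^*\mathcal F)^{-1}\mathcal F^*\mathcal G$, with $T_{\mathcal K_0}^*T_{\mathcal K_0}=\mathcal G^*(I+\mathcal F\mathcal F^* )^{-1}\mathcal G$. Riccati equations (stabilizing solutions, i.e. those for which $A_K$, $A_T$ below, respectively, have all eigenvalues in the open unit disc). $P=A^*PA+Q-K_{\text{lqr}}^*(I+B_u^*PB_u)K_{\text{lqr}}$, with $K_{\text{lqr}}=(I+B_u^*PB_u)^{-1}B_u^*PA$ and $A_K=A-B_uK_{\text{lqr}}$. $T=ATA^*+B_uB_u^*-ATQ^{1/2}R_T^{-1}Q^{1/2}TA^*$, with $R_T=I+Q^{1/2}TQ^{1/2}$ and $A_T=A-AT(Q^{-1}+T)^{-1}$. $Z_1$ solves $Z_1=A_KZ_1A_K^*+B_u(I+B_u^*PB_u)^{-1}B_u^*$. *)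

theory Defs
  imports "HOL-Analysis.Analysis"
begin

section \<open>Matrices\<close>

definition posdef :: "real^'n^'n \<Rightarrow> bool" where
  "posdef M \<longleftrightarrow> transpose M = M \<and> (\<forall>x. x \<noteq> 0 \<longrightarrow> 0 < x \<bullet> (M *v x))"

definition mat_sqrt :: "real^'n^'n \<Rightarrow> real^'n^'n" where
  "mat_sqrt M = (THE R. transpose R = R \<and> (\<forall>x. 0 \<le> x \<bullet> (R *v x)) \<and> R ** R = M)"

definition eigenvalue :: "'a::field^'n^'n \<Rightarrow> 'a \<Rightarrow> bool" where
  "eigenvalue M c \<longleftrightarrow> (\<exists>v. v \<noteq> 0 \<and> M *v v = c *s v)"

text \<open>Only applied to a product of two positive semidefinite matrices, whose (complex)
  eigenvalues are all real.\<close>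

definition lambda_max :: "real^'n^'n \<Rightarrow> real" where
  "lambda_max M = Max {c. eigenvalue M c}"

abbreviation cmat :: "real^'n^'m \<Rightarrow> complex^'n^'m" where
  "cmat \<equiv> map_matrix complex_of_real"

definition schur_stable :: "real^'n^'n \<Rightarrow> bool" where
  "schur_stable M \<longleftrightarrow> (\<forall>c. eigenvalue (cmat M) c \<longrightarrow> norm c < 1)"

definition stabilizable :: "real^'n^'n \<Rightarrow> real^'p^'n \<Rightarrow> bool" where
  "stabilizable A B \<longleftrightarrow> (\<exists>L. schur_stable (A - B ** L))"

text \<open>The transfer function \<open>C (z I - A)\<^sup>-\<^sup>1 B\<close>, a genuine value only where
  \<open>z I - A\<close> is invertible. For this reason the rank condition below includes that
  the transfer function has no pole on the unit circle.\<close>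

definition transfer ::
    "real^'n^'k \<Rightarrow> real^'n^'n \<Rightarrow> real^'m^'n \<Rightarrow> complex \<Rightarrow> complex^'m^'k" where
  "transfer C A B z = cmat C ** matrix_inv (mat z - cmat A) ** cmat B"

definition full_column_rank_on_circle ::
    "real^'n^'k \<Rightarrow> real^'n^'n \<Rightarrow> real^'m^'n \<Rightarrow> bool" where
  "full_column_rank_on_circle C A B \<longleftrightarrow>
     (\<forall>\<omega>::real. invertible (mat (cis \<omega>) - cmat A) \<and>
                rank (transfer C A B (cis \<omega>)) = CARD('m))"


section \<open>Two-sided signals\<close>

definition l2 :: "(int \<Rightarrow> 'a::real_normed_vector) set" where
  "l2 = {f. (\<lambda>t. (norm (f t))\<^sup>2) summable_on UNIV}"

definition l2_inner :: "(int \<Rightarrow> 'a::real_inner) \<Rightarrow> (int \<Rightarrow> 'a) \<Rightarrow> real" where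
  "l2_inner f g = (\<Sum>\<^sub>\<infinity>t. f t \<bullet> g t)"

definition l2_adjoint ::
    "((int \<Rightarrow> 'a::real_inner) \<Rightarrow> int \<Rightarrow> 'b::real_inner) \<Rightarrow> (int \<Rightarrow> 'b) \<Rightarrow> int \<Rightarrow> 'a" where
  "l2_adjoint S g = (THE h. h \<in> l2 \<and> (\<forall>f\<in>l2. l2_inner (S f) g = l2_inner f h))"

text \<open>Linear maps on \<open>l2\<close> whose output at time \<open>t\<close> depends only on the input before \<open>t\<close>.
  Outputs are not required to be in \<open>l2\<close>; values outside \<open>l2\<close> are irrelevant.\<close>

definition strictly_causal ::
    "((int \<Rightarrow> 'a::real_normed_vector) \<Rightarrow> int \<Rightarrow> 'b::real_normed_vector) \<Rightarrow> bool" where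
  "strictly_causal K \<longleftrightarrow>
     (\<forall>v\<in>l2. \<forall>w\<in>l2. \<forall>t. K (\<lambda>i. v i + w i) t = K v t + K w t) \<and>
     (\<forall>w\<in>l2. \<forall>c t. K (\<lambda>i. c *\<^sub>R w i) t = c *\<^sub>R K w t) \<and>
     (\<forall>v\<in>l2. \<forall>w\<in>l2. \<forall>t. (\<forall>i<t. v i = w i) \<longrightarrow> K v t = K w t)"


section \<open>Closed loops and cost\<close>

text \<open>\<open>X\<close> is the causal state response of the plant under the controller \<open>K\<close>.
  On disturbances that vanish before some time it is forced to be the response through
  the Markov parameters (lemma \<open>closed_loop_Markov\<close>). For general disturbances in \<open>l2\<close>
  and \<open>A\<close> not Schur stable the corresponding series need not converge even when the
  closed loop is stable, hence the description by the state recursion. Where the cost is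
  finite and \<open>A\<close> has no eigenvalue on the unit circle, \<open>X w\<close> is in \<open>l2\<close> and is
  determined by \<open>K w\<close> and \<open>w\<close>.\<close>

definition closed_loop ::
    "real^'n^'n \<Rightarrow> real^'p^'n \<Rightarrow> real^'m^'n \<Rightarrow>
     ((int \<Rightarrow> real^'m) \<Rightarrow> int \<Rightarrow> real^'p) \<Rightarrow> ((int \<Rightarrow> real^'m) \<Rightarrow> int \<Rightarrow> real^'n) \<Rightarrow> bool" where
  "closed_loop A Bu Bw K X \<longleftrightarrow>
     strictly_causal K \<and> strictly_causal X \<and>
     (\<forall>w\<in>l2. \<forall>t. X w (t + 1) = A *v X w t + Bu *v K w t + Bw *v w t)"

definition cost ::
    "real^'n^'n \<Rightarrow> (int \<Rightarrow> real^'n) \<Rightarrow> (int \<Rightarrow> real^'p) \<Rightarrow> ennreal" where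
  "cost Q x u = (\<Sum>\<^sub>\<infinity>t. ennreal (x t \<bullet> (Q *v x t) + u t \<bullet> u t))"

text \<open>The operator on \<open>l2\<close> with symbol \<open>(z I - A)\<^sup>-\<^sup>1 B\<close> on the unit circle. If \<open>A\<close> is Schur
  stable it is the causal convolution with the Markov parameters \<open>A\<^bsup>i-1\<^esup> B\<close>, \<open>i > 0\<close>; if
  \<open>A\<close> merely has no eigenvalue on the unit circle, it is the closure of that
  convolution restricted to the inputs in \<open>l2\<close> that vanish before some time and
  have a response in \<open>l2\<close>.\<close>

definition l2_state ::
    "real^'n^'n \<Rightarrow> real^'m^'n \<Rightarrow> (int \<Rightarrow> real^'m) \<Rightarrow> int \<Rightarrow> real^'n" where
  "l2_state A B v = (THE x. x \<in> l2 \<and> (\<forall>t. x (t + 1) = A *v x t + B *v v t))"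

text \<open>With \<open>B = B\<^sub>u\<close> and \<open>B = B\<^sub>w\<close> these are the operators F and G from input to \<open>Q\<^bsup>1/2\<^esup> x\<close>.\<close>

definition toeplitz ::
    "real^'n^'n \<Rightarrow> real^'n^'n \<Rightarrow> real^'m^'n \<Rightarrow> (int \<Rightarrow> real^'m) \<Rightarrow> int \<Rightarrow> real^'n" where
  "toeplitz Q A B v = (\<lambda>t. mat_sqrt Q *v l2_state A B v t)"

text \<open>\<open>- (I + F\<^sup>* F)\<^sup>-\<^sup>1 F\<^sup>* G\<close>\<close>

definition clairvoyant ::
    "real^'n^'n \<Rightarrow> real^'p^'n \<Rightarrow> real^'m^'n \<Rightarrow> real^'n^'n \<Rightarrow>
     (int \<Rightarrow> real^'m) \<Rightarrow> int \<Rightarrow> real^'p" where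
  "clairvoyant A Bu Bw Q w =
     (let F = toeplitz Q A Bu; G = toeplitz Q A Bw
      in (\<lambda>t. - inv_into l2 (\<lambda>u t. u t + l2_adjoint F (F u) t) (l2_adjoint F (G w)) t))"

definition clairvoyant_cost ::
    "real^'n^'n \<Rightarrow> real^'p^'n \<Rightarrow> real^'m^'n \<Rightarrow> real^'n^'n \<Rightarrow> (int \<Rightarrow> real^'m) \<Rightarrow> ennreal" where
  "clairvoyant_cost A Bu Bw Q w =
     (let u = clairvoyant A Bu Bw Q w
      in cost Q (\<lambda>t. l2_state A Bu u t + l2_state A Bw w t) u)"

definition worst_ratio ::
    "real^'n^'n \<Rightarrow> real^'p^'n \<Rightarrow> real^'m^'n \<Rightarrow> real^'n^'n \<Rightarrow>
     ((int \<Rightarrow> real^'m) \<Rightarrow> int \<Rightarrow> real^'p) \<Rightarrow> ((int \<Rightarrow> real^'m) \<Rightarrow> int \<Rightarrow> real^'n) \<Rightarrow> ennreal" where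
  "worst_ratio A Bu Bw Q K X =
     (SUP w\<in>l2 - {\<lambda>_. 0}. cost Q (X w) (K w) / clairvoyant_cost A Bu Bw Q w)"

definition comp_ratio ::
    "real^'n^'n \<Rightarrow> real^'p^'n \<Rightarrow> real^'m^'n \<Rightarrow> real^'n^'n \<Rightarrow> ennreal" where
  "comp_ratio A Bu Bw Q =
     (INF (K, X)\<in>{(K, X). closed_loop A Bu Bw K X}. worst_ratio A Bu Bw Q K X)"

lemma l2_zero: "(\<lambda>_. 0) \<in> l2"
  by (simp add: l2_def)

lemma strictly_causal_zero:
  assumes "strictly_causal K" "w \<in> l2" "\<forall>i<t. w i = 0"
  shows "K w t = 0"
proof -
  have "K w t = K (\<lambda>_. 0) t"
  proof -
    have "\<forall>v\<in>l2. \<forall>w\<in>l2. \<forall>t. (\<forall>i<t. v i = w i) \<longrightarrow> K v t = K w t"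
      using assms(1) unfolding strictly_causal_def by (elim conjE)
    from bspec[OF bspec[OF this assms(2)] l2_zero] show ?thesis
      using assms(3) by simp
  qed
  moreover have "K (\<lambda>i. 0 *\<^sub>R w i) t = 0 *\<^sub>R K w t"
  proof -
    have "\<forall>w\<in>l2. \<forall>c t. K (\<lambda>i. c *\<^sub>R w i) t = c *\<^sub>R K w t"
      using assms(1) unfolding strictly_causal_def by (elim conjE)
    from bspec[OF this assms(2)] show ?thesis by blast
  qed
  ultimately show ?thesis by simp
qed

lemma closed_loop_Markov:
  assumes cl: "closed_loop A Bu Bw K X" and w: "w \<in> l2" and s: "\<forall>i<s. w i = 0"
  shows "X w (s + int k) =
    (\<Sum>i=1..k. ((*v) A ^^ (i - 1))
      (Bu *v K w (s + int k - int i) + Bw *v w (s + int k - int i)))"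
proof (induction k)
  case 0
  show ?case
    using strictly_causal_zero[of X w s] cl w s by (simp add: closed_loop_def)
next
  case (Suc k)
  let ?f = "\<lambda>t. Bu *v K w t + Bw *v w t"
  have "X w (s + int (Suc k)) = X w ((s + int k) + 1)"
    by (simp add: algebra_simps)
  also have "\<dots> = A *v X w (s + int k) + ?f (s + int k)"
  proof -
    have "\<forall>w\<in>l2. \<forall>t. X w (t + 1) = A *v X w t + Bu *v K w t + Bw *v w t"
      using cl unfolding closed_loop_def by (elim conjE)
    from spec[OF bspec[OF this w], of "s + int k"] show ?thesis by (simp only: add.assoc)
  qed
  also have "A *v X w (s + int k) =
      (\<Sum>i=1..k. A *v ((*v) A ^^ (i - 1)) (?f (s + int k - int i)))"
    by (simp add: Suc linear_sum[OF matrix_vector_mul_linear])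
  also have "\<dots> = (\<Sum>i=1..k. ((*v) A ^^ i) (?f (s + int k - int i)))"
  proof (rule sum.cong[OF refl])
    fix i assume "i \<in> {1..k}"
    then obtain j where "i = Suc j" by (cases i) auto
    then show "A *v ((*v) A ^^ (i - 1)) (?f (s + int k - int i)) =
        ((*v) A ^^ i) (?f (s + int k - int i))" by simp
  qed
  also have "\<dots> = (\<Sum>i=Suc 1..Suc k. ((*v) A ^^ (i - 1)) (?f (s + int (Suc k) - int i)))"
    unfolding sum.shift_bounds_cl_Suc_ivl by (simp add: add_diff_eq)
  also have "\<dots> + ?f (s + int k) =
      (\<Sum>i=1..Suc k. ((*v) A ^^ (i - 1)) (?f (s + int (Suc k) - int i)))"
    by (subst sum.atLeast_Suc_atMost[of 1 "Suc k"]) (simp_all add: add.commute)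
  finally show ?case .
qed


section \<open>Riccati equations and controller matrices\<close>

definition lqr_S :: "real^'p^'n \<Rightarrow> real^'n^'n \<Rightarrow> real^'p^'p" where
  "lqr_S Bu P = mat 1 + transpose Bu ** P ** Bu"

definition K_lqr :: "real^'n^'n \<Rightarrow> real^'p^'n \<Rightarrow> real^'n^'n \<Rightarrow> real^'n^'p" where
  "K_lqr A Bu P = matrix_inv (lqr_S Bu P) ** transpose Bu ** P ** A"

definition A_K :: "real^'n^'n \<Rightarrow> real^'p^'n \<Rightarrow> real^'n^'n \<Rightarrow> real^'n^'n" where
  "A_K A Bu P = A - Bu ** K_lqr A Bu P"

definition R_T :: "real^'n^'n \<Rightarrow> real^'n^'n \<Rightarrow> real^'n^'n" where
  "R_T Q T = mat 1 + mat_sqrt Q ** T ** mat_sqrt Q"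

definition A_T :: "real^'n^'n \<Rightarrow> real^'n^'n \<Rightarrow> real^'n^'n \<Rightarrow> real^'n^'n" where
  "A_T A Q T = A - A ** T ** matrix_inv (matrix_inv Q + T)"

text \<open>As usual a solution of a Riccati equation is a symmetric matrix for which the
  inverses in the equation exist.\<close>

definition lqr_stabilizing_solution ::
    "real^'n^'n \<Rightarrow> real^'p^'n \<Rightarrow> real^'n^'n \<Rightarrow> real^'n^'n \<Rightarrow> bool" where
  "lqr_stabilizing_solution A Bu Q P \<longleftrightarrow>
     transpose P = P \<and> invertible (lqr_S Bu P) \<and>
     P = transpose A ** P ** A + Q
         - transpose (K_lqr A Bu P) ** lqr_S Bu P ** K_lqr A Bu P \<and>
     schur_stable (A_K A Bu P)"

definition filter_stabilizing_solution ::
    "real^'n^'n \<Rightarrow> real^'p^'n \<Rightarrow> real^'n^'n \<Rightarrow> real^'n^'n \<Rightarrow> bool" where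
  "filter_stabilizing_solution A Bu Q T \<longleftrightarrow>
     transpose T = T \<and> invertible (R_T Q T) \<and> invertible (matrix_inv Q + T) \<and>
     T = A ** T ** transpose A + Bu ** transpose Bu
         - A ** T ** mat_sqrt Q ** matrix_inv (R_T Q T) ** mat_sqrt Q ** T ** transpose A \<and>
     schur_stable (A_T A Q T)"

definition K_bar ::
    "real^'n^'n \<Rightarrow> real^'p^'n \<Rightarrow> real^'n^'n \<Rightarrow> real^'n^'n \<Rightarrow> real^'n^'n \<Rightarrow>
     real^'n^'n \<Rightarrow> real^'n^'n \<Rightarrow> real^'n^'n" where
  "K_bar A Bu Q P T \<Pi>b Z =
     matrix_inv (mat 1 - A_K A Bu P ** Z ** transpose (A_K A Bu P) ** \<Pi>b)
       ** A_K A Bu P ** Z ** (P - transpose (A_K A Bu P) ** P ** A_T A Q T)"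

definition F_bar ::
    "real^'n^'n \<Rightarrow> real^'p^'n \<Rightarrow> real^'n^'n \<Rightarrow> real^'n^'n \<Rightarrow> real^'n^'n \<Rightarrow>
     real^'n^'n \<Rightarrow> real^'n^'n \<Rightarrow> real^'n^'n" where
  "F_bar A Bu Q P T \<Pi>b Z =
     A_K A Bu P - K_bar A Bu Q P T \<Pi>b Z ** matrix_inv (mat_sqrt Q) ** R_T Q T
       ** matrix_inv (mat_sqrt Q) ** (P - transpose (A_T A Q T) ** P ** A_K A Bu P)"

end

theory Submission
  imports Defs "HOL-Computational_Algebra.Fundamental_Theorem_Algebra"
begin

text \<open>
  Write \<open>K\<close>, \<open>S\<close>, \<open>A\<^sub>K\<close> for the gain, the weight \<open>I + B\<^sub>u\<^sup>* P B\<^sub>u\<close> and the closed-loop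
  matrix of the LQR Riccati equation, and let \<open>d = B\<^sub>w w\<close>.

  \<^bold>\<open>Reduction to a Nehari problem.\<close> Completing the square with \<open>P\<close> shows that a finite cost
  exceeds the clairvoyant cost by exactly \<open>\<Sum> v\<^sub>t \<bullet> S\<^sup>-\<^sup>1 v\<^sub>t\<close>, where
  \<open>v\<^sub>t = S (u\<^sub>t + K x\<^sub>t) + B\<^sub>u\<^sup>* g\<^sub>t\<close> and \<open>g\<^sub>t = P d\<^sub>t + A\<^sub>K\<^sup>* g\<^sub>t\<^sub>+\<^sub>1\<close> is the anticausal feedforward signal of
  the clairvoyant controller (\<open>cost_identity\<close>). The dual Riccati equation factors the clairvoyant
  cost causally: it equals \<open>\<Sum> s\<^sub>t \<bullet> (Q\<^sup>-\<^sup>1 + T)\<^sup>-\<^sup>1 s\<^sub>t\<close> for the filter state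
  \<open>s\<^sub>t\<^sub>+\<^sub>1 = A\<^sub>T s\<^sub>t + d\<^sub>t\<close> (\<open>clairvoyant_cost_eq\<close>). As \<open>B\<^sub>w\<close> is invertible, knowing \<open>w\<^sub>i\<close> for
  \<open>i < t\<close> is the same as knowing \<open>s\<^sub>i\<close> for \<open>i \<le> t\<close>. Moreover \<open>g\<^sub>t = h\<^sub>t - P A\<^sub>T s\<^sub>t\<close>, where
  \<open>h\<^sub>t = H\<^sup>* s\<^sub>t\<^sub>+\<^sub>1 + A\<^sub>K\<^sup>* h\<^sub>t\<^sub>+\<^sub>1\<close> with \<open>H = P - A\<^sub>T\<^sup>* P A\<^sub>K\<close> depends on the future of \<open>s\<close> only. So the
  competitive ratio minus one is the squared distance, in the norms above, of the anticausal
  operator from \<open>s\<close> to \<open>B\<^sub>u\<^sup>* h\<close> to the causal ones, which by Nehari's theorem is its squared Hankel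
  norm. Its Gramians are \<open>Z\<^sub>1\<close> and \<open>\<Pi>b\<close>, whence the value \<open>\<lambda>\<^sub>m\<^sub>a\<^sub>x (Z\<^sub>1 \<Pi>b)\<close>.

  \<^bold>\<open>Lower bound\<close> (\<open>worst_ratio_ge\<close>). A top eigenvector of \<open>Z\<^sub>1 \<Pi>b\<close> yields a disturbance that starts
  at time 0 and reaches the corresponding \<open>h\<^sub>0\<close> with the least energy. Up to time 0 every strictly
  causal controller is still at rest, and the excess cost incurred until then is already
  \<open>\<lambda>\<^sub>m\<^sub>a\<^sub>x (Z\<^sub>1 \<Pi>b)\<close> times the clairvoyant cost.

  \<^bold>\<open>Upper bound\<close> (\<open>causal_approximation_bound\<close>). For the controller of the theorem
  \<open>v\<^sub>t = B\<^sub>u\<^sup>* (h\<^sub>t - \<Pi>b \<xi>\<^sub>t)\<close>, where \<open>\<xi>\<close> is its second state. The gains are such that \<open>\<xi>\<close> obeys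
  \<open>\<xi>\<^sub>t\<^sub>+\<^sub>1 = A\<^sub>K (\<xi>\<^sub>t + Z (e\<^sub>t - A\<^sub>K\<^sup>* e\<^sub>t\<^sub>+\<^sub>1))\<close> with \<open>e = h - \<Pi>b \<xi>\<close>, and from this the difference of the
  two energies telescopes to a sum of squares.

  \<^bold>\<open>The optimal level is not degenerate.\<close> The Riccati equations give
  \<open>(Q\<^sup>-\<^sup>1 + T) H = I + T P\<close>, so \<open>H\<close> is invertible and the right-hand side of the Lyapunov equation of
  \<open>\<Pi>b\<close> is positive definite. This keeps \<open>I - A\<^sub>K Z A\<^sub>K\<^sup>* \<Pi>b\<close> invertible and the controller stable even
  though \<open>Z \<Pi>b\<close> has eigenvalue 1 as soon as \<open>Z\<^sub>1 \<noteq> 0\<close> (\<open>controller_inverse\<close>, \<open>schur_Fb\<close>).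

  \<^bold>\<open>Signals on the whole time axis.\<close> All systems are handled through their unique \<open>l2\<close> solutions.
  Existence, uniqueness and causality of these are reduced to scalar recursions by peeling off one
  linear factor after the other of a polynomial that annihilates the matrix
  (\<open>complex_recursion_solution\<close>, \<open>complex_recursion_zero\<close>). Infinite sums then only enter
  through telescoping (\<open>infsum_telescope\<close>).
\<close>

section \<open>Symmetric matrices and their square roots\<close>

declare transpose_matrix_vector [simp del]

lemma mat_vector_mult: "mat c *v x = c *s x" for x :: "'a::comm_semiring_1^'n"
  by (simp add: vec_eq_iff mat_def matrix_vector_mult_def if_distrib if_distribR cong: if_cong)

lemma matrix_vector_mult_minus: "M *v (- x) = - (M *v x)" for M :: "'a::ring_1^'n^'m"
  by (simp add: vec_eq_iff matrix_vector_mult_def sum_negf)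

lemma inner_transpose: "x \<bullet> (M *v y) = (transpose M *v x) \<bullet> y" for M :: "real^'n^'m"
  by (metis dot_lmul_matrix transpose_matrix_vector)

lemma inner_transpose': "(M *v y) \<bullet> x = y \<bullet> (transpose M *v x)" for M :: "real^'n^'m"
  by (metis inner_transpose inner_commute)

lemma inner_symmetric:
  "transpose M = M \<Longrightarrow> (M *v x) \<bullet> y = x \<bullet> (M *v y)" for M :: "real^'n^'n"
  by (metis inner_transpose)

lemma transpose_add: "transpose (M + N) = transpose M + transpose N" for M :: "'a::plus^'n^'m"
  by (simp add: transpose_def vec_eq_iff)
lemma transpose_diff: "transpose (M - N) = transpose M - transpose N" for M :: "'a::minus^'n^'m"
  by (simp add: transpose_def vec_eq_iff)

lemmas mv_simps = matrix_vector_right_distrib matrix_vector_mult_diff_distrib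
  matrix_vector_mult_add_rdistrib matrix_vector_mult_diff_rdistrib
  matrix_vector_mul_assoc[symmetric]

lemma matrix_eq_inner:
  fixes M N :: "real^'n^'m"
  assumes "\<And>x y. x \<bullet> (M *v y) = x \<bullet> (N *v y)"
  shows "M = N"
proof -
  have "M *v y = N *v y" for y
    using assms vector_eq_rdot[of "M *v y" "N *v y"] by (metis inner_commute)
  then show ?thesis by (simp add: matrix_eq)
qed

lemma continuous_on_quadratic_form:
  "continuous_on S (\<lambda>x. x \<bullet> (M *v x))" for M :: "real^'n^'n"
  by (intro continuous_intros linear_continuous_on matrix_vector_mul_bounded_linear)

text \<open>The form would become negative a little way from \<open>v\<close> in the direction \<open>- M v\<close>. Subspaces
  are allowed so that the lemma also serves the deflation step of the spectral theorem.\<close>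

lemma psd_kernel:
  fixes M :: "real^'n^'n"
  assumes "subspace V" and inv: "\<And>x. x \<in> V \<Longrightarrow> M *v x \<in> V"
    and sym: "transpose M = M" and psd: "\<And>x. x \<in> V \<Longrightarrow> 0 \<le> x \<bullet> (M *v x)"
    and "v \<in> V" and v: "v \<bullet> (M *v v) = 0"
  shows "M *v v = 0"
proof (rule ccontr)
  define w where "w = M *v v"
  assume "M *v v \<noteq> 0"
  then have w: "w \<bullet> w > 0" by (simp add: w_def)
  define b where "b = w \<bullet> (M *v w)"
  \<comment> \<open>small enough for the linear term to dominate the quadratic one\<close>
  define r where "r = (w \<bullet> w) / (b + 1)"
  have wV: "w \<in> V" using \<open>v \<in> V\<close> inv by (simp add: w_def)
  have b: "b \<ge> 0" using psd[OF wV] by (simp add: b_def)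
  have r: "r > 0" using w b by (simp add: r_def)
  have "v - r *\<^sub>R w \<in> V" using \<open>subspace V\<close> \<open>v \<in> V\<close> wV
    by (simp add: subspace_diff subspace_scale)
  from psd[OF this] have "0 \<le> (v - r *\<^sub>R w) \<bullet> (M *v (v - r *\<^sub>R w))" .
  also have "\<dots> = v \<bullet> (M *v v) - r * (v \<bullet> (M *v w)) - r * (w \<bullet> (M *v v)) + r * r * b"
    by (simp add: mv_simps matrix_vector_mult_scaleR inner_diff b_def algebra_simps)
  also have "v \<bullet> (M *v w) = w \<bullet> w"
    using inner_symmetric[OF sym, of v w] by (simp add: w_def)
  also have "w \<bullet> (M *v v) = w \<bullet> w" by (simp add: w_def)
  finally have "0 \<le> r * (r * b - 2 * (w \<bullet> w))" using v by (simp add: algebra_simps)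
  then have "r * b \<ge> 2 * (w \<bullet> w)" using r by (simp add: zero_le_mult_iff)
  moreover have "r * b \<le> w \<bullet> w"
    using b w by (simp add: r_def field_simps)
  ultimately show False using w by linarith
qed

text \<open>A maximiser of the Rayleigh quotient: the form \<open>c |x|\<^sup>2 - x \<bullet> M x\<close> is nonnegative and
  vanishes there, so \<open>psd_kernel\<close> turns maximality into the eigenvalue equation.\<close>

lemma symmetric_eigenvector_subspace:
  fixes M :: "real^'n^'n"
  assumes V: "subspace V" "V \<noteq> {0}" and inv: "\<And>x. x \<in> V \<Longrightarrow> M *v x \<in> V"
    and sym: "transpose M = M"
  obtains v c where "v \<in> V" "norm v = 1" "M *v v = c *\<^sub>R v"
    "\<And>x. x \<in> V \<Longrightarrow> x \<bullet> (M *v x) \<le> c * (x \<bullet> x)"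
proof -
  let ?K = "sphere 0 1 \<inter> V"
  have "compact ?K" by (intro compact_Int_closed compact_sphere closed_subspace V)
  moreover have "?K \<noteq> {}"
  proof -
    obtain x where "x \<in> V" "x \<noteq> 0" using V subspace_0 by blast
    then have "(1 / norm x) *\<^sub>R x \<in> ?K" using V by (simp add: subspace_scale)
    then show ?thesis by blast
  qed
  ultimately obtain v where v: "v \<in> ?K" and max: "\<And>x. x \<in> ?K \<Longrightarrow> x \<bullet> (M *v x) \<le> v \<bullet> (M *v v)"
    using continuous_attains_sup[OF _ _ continuous_on_quadratic_form] by metis
  define c where "c = v \<bullet> (M *v v)"
  have le: "x \<bullet> (M *v x) \<le> c * (x \<bullet> x)" if "x \<in> V" for x
  proof (cases "x = 0")
    case False
    then have "(1 / norm x) *\<^sub>R x \<in> ?K" using V that by (simp add: subspace_scale)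
    from max[OF this] show ?thesis using False
      by (simp add: matrix_vector_mult_scaleR c_def dot_square_norm power2_eq_square field_simps)
  qed simp
  define N where "N = mat c - M"
  have N: "N *v x = c *\<^sub>R x - M *v x" for x
    by (simp add: N_def mv_simps mat_vector_mult scalar_mult_eq_scaleR)
  have "N *v v = 0"
  proof (rule psd_kernel[OF V(1)])
    show "x \<in> V \<Longrightarrow> N *v x \<in> V" for x using V inv by (simp add: N subspace_diff subspace_scale)
    show "transpose N = N" by (simp add: N_def transpose_diff sym transpose_mat)
    show "x \<in> V \<Longrightarrow> 0 \<le> x \<bullet> (N *v x)" for x using le by (simp add: N inner_diff)
    show "v \<in> V" "v \<bullet> (N *v v) = 0" using v by (auto simp: N inner_diff c_def norm_eq_1)
  qed
  then show ?thesis using that[of v c] v le by (simp add: N)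
qed

lemma symmetric_zero_quadratic_form:
  fixes M :: "real^'n^'n"
  assumes "transpose M = M" "\<And>x. x \<bullet> (M *v x) = 0"
  shows "M = 0"
  using psd_kernel[of UNIV M] assms by (simp add: matrix_eq)

text \<open>A largest orthonormal family of eigenvectors spans the space, since otherwise its orthogonal
  complement, which is invariant, would contain a further eigenvector.\<close>

lemma spectral_theorem:
  fixes M :: "real^'n^'n"
  assumes sym: "transpose M = M"
  obtains B c where "finite B" "\<And>b. b \<in> B \<Longrightarrow> norm b = 1" "\<And>b. b \<in> B \<Longrightarrow> M *v b = c b *\<^sub>R b"
    "\<And>x. (\<Sum>b\<in>B. (b \<bullet> x) *\<^sub>R b) = x" "pairwise orthogonal B"
proof -
  define good where "good B \<longleftrightarrow> pairwise orthogonal B \<and> (\<forall>b\<in>B. norm b = 1 \<and> (\<exists>c. M *v b = c *\<^sub>R b))"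
    for B :: "(real^'n) set"
  have card: "finite B \<and> card B \<le> CARD('n)" if "good B" for B
  proof -
    have "independent B" using that by (intro pairwise_orthogonal_independent) (auto simp: good_def)
    from independent_bound[OF this] show ?thesis by simp
  qed
  have "good {}" by (simp add: good_def)
  moreover have "\<forall>B. good B \<longrightarrow> card B < Suc (CARD('n))" using card by (simp add: less_Suc_eq_le)
  ultimately obtain B where B: "good B" and max: "\<And>C. good C \<Longrightarrow> card C \<le> card B"
    using ex_has_greatest_nat[of good "{}" card "Suc (CARD('n))"] by blast
  have finB: "finite B" using card B by blast
  define V where "V = {x. \<forall>b\<in>B. orthogonal b x}"
  have V: "subspace V" unfolding V_def
    by (auto simp: subspace_def orthogonal_clauses)
  have "V = {0}"
  proof (rule ccontr)
    assume "V \<noteq> {0}"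
    have inv: "M *v x \<in> V" if "x \<in> V" for x
    proof -
      have "b \<bullet> (M *v x) = 0" if "b \<in> B" for b
      proof -
        obtain c where "M *v b = c *\<^sub>R b" using B \<open>b \<in> B\<close> by (auto simp: good_def)
        then have "b \<bullet> (M *v x) = c * (b \<bullet> x)" using inner_symmetric[OF sym, of b x] by simp
        then show ?thesis using \<open>x \<in> V\<close> that by (simp add: V_def orthogonal_def)
      qed
      then show ?thesis by (simp add: V_def orthogonal_def)
    qed
    obtain v c where v: "v \<in> V" "norm v = 1" "M *v v = c *\<^sub>R v"
      using symmetric_eigenvector_subspace[OF V \<open>V \<noteq> {0}\<close> inv sym] by metis
    have "v \<notin> B" using v by (auto simp: V_def orthogonal_def norm_eq_1)
    moreover have "good (insert v B)" using B v
      by (auto simp: good_def pairwise_insert V_def orthogonal_commute)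
    ultimately show False using max[of "insert v B"] finB by simp
  qed
  have exp: "(\<Sum>b\<in>B. (b \<bullet> x) *\<^sub>R b) = x" for x
  proof -
    have "b \<bullet> (x - (\<Sum>b\<in>B. (b \<bullet> x) *\<^sub>R b)) = 0" if "b \<in> B" for b
    proof -
      have "b \<bullet> (\<Sum>b\<in>B. (b \<bullet> x) *\<^sub>R b) = (\<Sum>a\<in>B. if a = b then b \<bullet> x else 0)"
        unfolding inner_sum_right
        using B that by (intro sum.cong) (auto simp: good_def pairwise_def orthogonal_def norm_eq_1)
      then show ?thesis using that finB by (simp add: inner_diff)
    qed
    then have "x - (\<Sum>b\<in>B. (b \<bullet> x) *\<^sub>R b) \<in> V" by (simp add: V_def orthogonal_def)
    then show ?thesis using \<open>V = {0}\<close> by simp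
  qed
  obtain c where c: "\<And>b. b \<in> B \<Longrightarrow> M *v b = c b *\<^sub>R b" using B by (metis good_def)
  show ?thesis by (rule that[OF finB _ c exp]) (use B in \<open>auto simp: good_def\<close>)
qed

definition psd_root :: "real^'n^'n \<Rightarrow> real^'n^'n \<Rightarrow> bool" where
  "psd_root M R \<longleftrightarrow> transpose R = R \<and> (\<forall>x. 0 \<le> x \<bullet> (R *v x)) \<and> R ** R = M"

lemma psd_root_exists:
  fixes M :: "real^'n^'n"
  assumes sym: "transpose M = M" and psd: "\<And>x. 0 \<le> x \<bullet> (M *v x)"
  obtains R where "psd_root M R"
proof -
  obtain B c where B: "finite B" "\<And>b. b \<in> B \<Longrightarrow> norm b = 1" "\<And>b. b \<in> B \<Longrightarrow> M *v b = c b *\<^sub>R b"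
    "\<And>x. (\<Sum>b\<in>B. (b \<bullet> x) *\<^sub>R b) = x" "pairwise orthogonal B"
    by (rule spectral_theorem[OF sym]) (rule that)
  have c: "c b \<ge> 0" if "b \<in> B" for b
    using psd[of b] B(2,3)[OF that] by (simp add: norm_eq_1)
  define f where "f x = (\<Sum>b\<in>B. (sqrt (c b) * (b \<bullet> x)) *\<^sub>R b)" for x
  have lin: "linear f" unfolding f_def
    by (rule linearI)
      (simp_all add: inner_add_right distrib_left scaleR_add_left sum.distrib scaleR_sum_right
        mult.left_commute)
  define R where "R = matrix f"
  have R: "R *v x = f x" for x using matrix_works lin by (simp add: R_def)
  have fb: "b \<bullet> f x = sqrt (c b) * (b \<bullet> x)" if "b \<in> B" for b x
  proof -
    have "b \<bullet> f x = (\<Sum>a\<in>B. if a = b then sqrt (c b) * (b \<bullet> x) else 0)"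
      unfolding f_def inner_sum_right
      using B that by (intro sum.cong) (auto simp: pairwise_def orthogonal_def norm_eq_1)
    then show ?thesis using that B(1) by simp
  qed
  have sq: "f (f x) = M *v x" for x
  proof -
    have "f (f x) = (\<Sum>b\<in>B. (c b * (b \<bullet> x)) *\<^sub>R b)"
      unfolding f_def[of "f x"] using c by (intro sum.cong) (simp_all add: fb flip: mult.assoc)
    also have "\<dots> = (\<Sum>b\<in>B. (b \<bullet> x) *\<^sub>R (M *v b))"
      using B(3) by (intro sum.cong) (simp_all add: ac_simps)
    also have "\<dots> = M *v (\<Sum>b\<in>B. (b \<bullet> x) *\<^sub>R b)"
      by (simp add: linear_sum[OF matrix_vector_mul_linear] matrix_vector_mult_scaleR)
    finally show ?thesis by (simp add: B(4))
  qed
  have ff: "y \<bullet> f x = (\<Sum>b\<in>B. sqrt (c b) * (b \<bullet> x) * (b \<bullet> y))" for x y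
    by (simp add: f_def inner_sum_right inner_commute)
  have "psd_root M R" unfolding psd_root_def
  proof (intro conjI allI)
    show "transpose R = R"
    proof (rule matrix_eq_inner)
      fix x y
      have "x \<bullet> (transpose R *v y) = y \<bullet> f x" by (metis R inner_transpose' inner_commute)
      also have "\<dots> = x \<bullet> f y" by (simp add: ff ac_simps)
      finally show "x \<bullet> (transpose R *v y) = x \<bullet> (R *v y)" by (simp add: R)
    qed
    show "0 \<le> x \<bullet> (R *v x)" for x unfolding R ff
      using c by (intro sum_nonneg) (simp add: mult.assoc)
    show "R ** R = M" by (simp add: matrix_eq R sq flip: matrix_vector_mul_assoc)
  qed
  then show ?thesis by (rule that)
qed

text \<open>The difference of two roots need not commute with them. But if \<open>v\<close> is an eigenvector of
  \<open>R - S\<close> with eigenvalue \<open>c\<close>, then \<open>R\<^sup>2 = S\<^sup>2\<close> gives \<open>c (v \<bullet> R v + v \<bullet> S v) = 0\<close>, while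
  \<open>c |v|\<^sup>2 = v \<bullet> R v - v \<bullet> S v\<close>; as both terms are nonnegative, \<open>c = 0\<close>.\<close>

lemma psd_root_unique:
  fixes M :: "real^'n^'n"
  assumes R: "psd_root M R" and S: "psd_root M S"
  shows "R = S"
proof -
  have le: "x \<bullet> ((R' - S') *v x) \<le> 0" if "psd_root M R'" "psd_root M S'" for R' S' x
  proof -
    note R = that(1)[unfolded psd_root_def] and S = that(2)[unfolded psd_root_def]
    have tr: "transpose (R' - S') = R' - S'" using R S by (simp add: transpose_diff)
    have ne: "(UNIV :: (real^'n) set) \<noteq> {0}"
      by (metis UNIV_I axis_eq_0_iff singletonD zero_neq_one)
    obtain v c where v: "norm v = 1" "(R' - S') *v v = c *\<^sub>R v"
      and max: "\<And>x. x \<bullet> ((R' - S') *v x) \<le> c * (x \<bullet> x)"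
      using symmetric_eigenvector_subspace[OF subspace_UNIV ne _ tr] by (metis UNIV_I)
    have vv: "v \<bullet> v = 1" using v by (simp add: norm_eq_1)
    have d: "R' *v v = S' *v v + c *\<^sub>R v" using v by (simp add: mv_simps algebra_simps)
    have RR: "R' *v (R' *v v) = M *v v" and SS: "S' *v (S' *v v) = M *v v"
      using R S by (simp_all add: matrix_vector_mul_assoc)
    have "(R' *v v) \<bullet> (R' *v v) = v \<bullet> (M *v v)"
      using inner_symmetric[of R' v] R RR by simp
    also have "\<dots> = (S' *v v) \<bullet> (S' *v v)"
      using inner_symmetric[of S' v] S SS by simp
    finally have "c * (v \<bullet> (R' *v v) + v \<bullet> (S' *v v)) = 0"
      unfolding d by (simp add: inner_add inner_commute algebra_simps)
    moreover have "c = v \<bullet> (R' *v v) - v \<bullet> (S' *v v)" using d vv by (simp add: inner_add)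
    moreover have "v \<bullet> (R' *v v) \<ge> 0" "v \<bullet> (S' *v v) \<ge> 0" using R S by auto
    ultimately have "c = 0" by (auto simp: add_nonneg_eq_0_iff)
    then show ?thesis using max by simp
  qed
  have z: "x \<bullet> ((R - S) *v x) = 0" for x
    using le[OF R S, of x] le[OF S R, of x] by (simp add: mv_simps inner_diff)
  have "R - S = 0"
    by (rule symmetric_zero_quadratic_form[OF _ z])
      (use R S in \<open>simp add: psd_root_def transpose_diff\<close>)
  then show ?thesis by simp
qed

lemma mat_sqrt_root:
  assumes "posdef Q"
  shows "transpose (mat_sqrt Q) = mat_sqrt Q" "mat_sqrt Q ** mat_sqrt Q = Q"
proof -
  have "0 \<le> x \<bullet> (Q *v x)" for x
    using assms by (cases "x = 0") (auto simp: posdef_def less_imp_le)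
  then obtain R where R: "psd_root Q R" using psd_root_exists assms by (metis posdef_def)
  have "mat_sqrt Q = (THE R. psd_root Q R)" by (simp add: mat_sqrt_def psd_root_def)
  also have "\<dots> = R" using R psd_root_unique by blast
  finally show "transpose (mat_sqrt Q) = mat_sqrt Q" "mat_sqrt Q ** mat_sqrt Q = Q"
    using R by (auto simp: psd_root_def)
qed


lemma invertible_if_trivial_kernel:
  fixes M :: "'a::field^'n^'n"
  assumes "\<And>x. M *v x = 0 \<Longrightarrow> x = 0"
  shows "invertible M"
  using assms matrix_left_invertible_ker[of M] invertible_left_inverse by metis

lemma matrix_inv_cancel:
  fixes M :: "'a::field^'n^'n"
  assumes "invertible M"
  shows "matrix_inv M *v (M *v x) = x" "M *v (matrix_inv M *v x) = x"
proof -
  have "M ** matrix_inv M = mat 1 \<and> matrix_inv M ** M = mat 1"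
    using assms unfolding invertible_def matrix_inv_def by (rule someI_ex)
  then show "matrix_inv M *v (M *v x) = x" "M *v (matrix_inv M *v x) = x"
    by (simp_all add: matrix_vector_mul_assoc)
qed

lemma matrix_inv_symmetric:
  fixes M :: "real^'n^'n"
  assumes "invertible M" "transpose M = M"
  shows "transpose (matrix_inv M) = matrix_inv M"
proof (rule matrix_eq_inner)
  fix x y
  have "x \<bullet> (transpose (matrix_inv M) *v y) = (matrix_inv M *v x) \<bullet> (M *v (matrix_inv M *v y))"
    by (simp add: inner_transpose' matrix_inv_cancel[OF assms(1)])
  also have "\<dots> = x \<bullet> (matrix_inv M *v y)"
    by (metis inner_symmetric[OF assms(2)] matrix_inv_cancel(2)[OF assms(1)])
  finally show "x \<bullet> (transpose (matrix_inv M) *v y) = x \<bullet> (matrix_inv M *v y)" .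
qed

lemma posdef_invertible: "posdef M \<Longrightarrow> invertible M"
  by (rule invertible_if_trivial_kernel) (fastforce simp: posdef_def)

lemma posdef_nonneg: "posdef M \<Longrightarrow> 0 \<le> x \<bullet> (M *v x)"
  by (cases "x = 0") (auto simp: posdef_def less_imp_le)

lemma posdef_inv: assumes "posdef M" shows "posdef (matrix_inv M)"
proof -
  note inv = posdef_invertible[OF assms]
  have "0 < x \<bullet> (matrix_inv M *v x)" if "x \<noteq> 0" for x
  proof -
    define y where "y = matrix_inv M *v x"
    have x: "x = M *v y" by (simp add: y_def matrix_inv_cancel[OF inv])
    then have "y \<noteq> 0" using that by auto
    then have "0 < y \<bullet> (M *v y)" using assms by (simp add: posdef_def)
    then show ?thesis using x by (metis inner_commute y_def)
  qed
  then show ?thesis using assms matrix_inv_symmetric[OF inv] by (simp add: posdef_def)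
qed

text \<open>Conjugation with \<open>R = G\<^sup>1\<^sup>/\<^sup>2\<close> turns \<open>Z G\<close> into the symmetric matrix \<open>R Z R\<close> with the same
  eigenvalues. Hence there are finitely many of them, the maximum in \<open>lambda_max\<close> is attained, and
  it is the maximum of a Rayleigh quotient.\<close>

lemma lambda_max_product:
  fixes Z G :: "real^'n^'n"
  assumes Z: "transpose Z = Z" "\<And>x. 0 \<le> x \<bullet> (Z *v x)" and G: "posdef G"
  shows "eigenvalue (Z ** G) (lambda_max (Z ** G))"
    and "(G *v x) \<bullet> (Z *v (G *v x)) \<le> lambda_max (Z ** G) * (x \<bullet> (G *v x))"
    and "0 \<le> lambda_max (Z ** G)"
proof -
  define R where "R = mat_sqrt G"
  have R: "transpose R = R" "R *v (R *v x) = G *v x" for x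
    using mat_sqrt_root[OF G] by (simp_all add: R_def matrix_vector_mul_assoc)
  have inj: "x = 0" if "R *v x = 0" for x
  proof -
    have "G *v x = 0" using R(2)[of x] that by simp
    then show ?thesis using G by (fastforce simp: posdef_def)
  qed
  have inv: "invertible R" by (rule invertible_if_trivial_kernel) (rule inj)
  define N where "N = R ** Z ** R"
  have N: "N *v x = R *v (Z *v (R *v x))" for x by (simp add: N_def matrix_vector_mul_assoc matrix_mul_assoc)
  have symN: "transpose N = N" by (simp add: N_def matrix_transpose_mul R Z matrix_mul_assoc)
  have eig: "eigenvalue (Z ** G) d \<longleftrightarrow> (\<exists>v. v \<noteq> 0 \<and> N *v v = d *\<^sub>R v)" for d
  proof
    assume "eigenvalue (Z ** G) d"
    then obtain v where v: "v \<noteq> 0" "Z *v (G *v v) = d *\<^sub>R v"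
      by (auto simp: eigenvalue_def scalar_mult_eq_scaleR matrix_vector_mul_assoc)
    then have "N *v (R *v v) = d *\<^sub>R (R *v v)" by (simp add: N R matrix_vector_mult_scaleR)
    moreover have "R *v v \<noteq> 0" using inj v by blast
    ultimately show "\<exists>v. v \<noteq> 0 \<and> N *v v = d *\<^sub>R v" by blast
  next
    assume "\<exists>v. v \<noteq> 0 \<and> N *v v = d *\<^sub>R v"
    then obtain v where v: "v \<noteq> 0" "N *v v = d *\<^sub>R v" by blast
    define y where "y = matrix_inv R *v v"
    have Ry: "R *v y = v" by (simp add: y_def matrix_inv_cancel[OF inv])
    have "R *v (Z *v (G *v y) - d *\<^sub>R y) = 0"
      using v by (simp add: R(2)[symmetric] Ry N matrix_vector_mult_diff_distrib matrix_vector_mult_scaleR)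
    then have "Z *v (G *v y) = d *\<^sub>R y" using inj by force
    moreover have "y \<noteq> 0" using Ry v by auto
    ultimately show "eigenvalue (Z ** G) d"
      by (auto simp: eigenvalue_def scalar_mult_eq_scaleR simp flip: matrix_vector_mul_assoc)
  qed
  have ne: "(UNIV :: (real^'n) set) \<noteq> {0}"
    by (metis UNIV_I axis_eq_0_iff singletonD zero_neq_one)
  obtain v c where v: "norm v = 1" "N *v v = c *\<^sub>R v"
      and max: "\<And>x. x \<bullet> (N *v x) \<le> c * (x \<bullet> x)"
    using symmetric_eigenvector_subspace[OF subspace_UNIV ne _ symN] by (metis UNIV_I)
  have c: "eigenvalue (Z ** G) c" using v by (auto simp: eig intro!: exI[of _ v])
  have finE: "finite {d. eigenvalue (Z ** G) d}"
  proof -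
    obtain B \<mu> where B: "finite B" "\<And>b. b \<in> B \<Longrightarrow> norm b = 1" "\<And>b. b \<in> B \<Longrightarrow> N *v b = \<mu> b *\<^sub>R b"
      "\<And>x. (\<Sum>b\<in>B. (b \<bullet> x) *\<^sub>R b) = x" "pairwise orthogonal B"
      by (rule spectral_theorem[OF symN]) (rule that)
    have "d \<in> \<mu> ` B" if d: "eigenvalue (Z ** G) d" for d
    proof -
      obtain u where u: "u \<noteq> 0" "N *v u = d *\<^sub>R u" using d[unfolded eig] by blast
      have "\<exists>b\<in>B. b \<bullet> u \<noteq> 0"
      proof (rule ccontr)
        assume "\<not> ?thesis"
        then have "(\<Sum>b\<in>B. (b \<bullet> u) *\<^sub>R b) = 0" by simp
        then show False using B(4)[of u] u by simp
      qed
      then obtain b where b: "b \<in> B" "b \<bullet> u \<noteq> 0" by blast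
      have "d * (b \<bullet> u) = \<mu> b * (b \<bullet> u)"
        using inner_symmetric[OF symN, of b u] B(3)[OF b(1)] u by auto
      then show ?thesis using b by auto
    qed
    then have "{d. eigenvalue (Z ** G) d} \<subseteq> \<mu> ` B" by blast
    then show ?thesis by (rule finite_subset) (simp add: B(1))
  qed
  have "lambda_max (Z ** G) = c" unfolding lambda_max_def
  proof (rule Max_eqI[OF finE])
    fix d assume "d \<in> {d. eigenvalue (Z ** G) d}"
    then obtain u where u: "u \<noteq> 0" "N *v u = d *\<^sub>R u" unfolding mem_Collect_eq eig by blast
    then show "d \<le> c" using max[of u] by simp
  qed (use c in simp)
  moreover have "(G *v x) \<bullet> (Z *v (G *v x)) \<le> c * (x \<bullet> (G *v x))"
  proof -
    have "(G *v x) \<bullet> (Z *v (G *v x)) = (R *v x) \<bullet> (N *v (R *v x))"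
      by (simp add: N flip: R(2) inner_symmetric[OF R(1)])
    also have "\<dots> \<le> c * ((R *v x) \<bullet> (R *v x))" by (rule max)
    also have "(R *v x) \<bullet> (R *v x) = x \<bullet> (G *v x)" using inner_symmetric[OF R(1)] by (simp add: R(2))
    finally show ?thesis .
  qed
  moreover have "0 \<le> c"
  proof -
    have "0 \<le> (R *v v) \<bullet> (Z *v (R *v v))" by (rule Z)
    also have "\<dots> = c" using v inner_symmetric[OF R(1), of v "Z *v (R *v v)"] by (simp add: N norm_eq_1)
    finally show ?thesis .
  qed
  ultimately show "eigenvalue (Z ** G) (lambda_max (Z ** G))"
    and "(G *v x) \<bullet> (Z *v (G *v x)) \<le> lambda_max (Z ** G) * (x \<bullet> (G *v x))"
    and "0 \<le> lambda_max (Z ** G)"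
    using c by auto
qed

section \<open>Square-summable signals\<close>

lemma l2_dominated:
  assumes "g \<in> l2" "\<And>t. norm (f t) \<le> C * norm (g t)"
  shows "f \<in> l2"
proof -
  have "(\<lambda>t. C\<^sup>2 * (norm (g t))\<^sup>2) summable_on UNIV"
    using assms(1) by (intro summable_on_cmult_right) (simp add: l2_def)
  then have "(\<lambda>t. (norm (f t))\<^sup>2) summable_on UNIV"
    by (rule summable_on_comparison_test)
      (use power_mono[OF assms(2) norm_ge_zero, where n = 2] in \<open>simp_all add: power_mult_distrib\<close>)
  then show ?thesis by (simp add: l2_def)
qed

lemma l2_add:
  assumes "f \<in> l2" "g \<in> l2"
  shows "(\<lambda>t. f t + g t) \<in> l2"
proof -
  have "(\<lambda>t. 2 * (norm (f t))\<^sup>2 + 2 * (norm (g t))\<^sup>2) summable_on UNIV"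
    using assms by (intro summable_on_add summable_on_cmult_right) (simp_all add: l2_def)
  moreover have "(norm (f t + g t))\<^sup>2 \<le> 2 * (norm (f t))\<^sup>2 + 2 * (norm (g t))\<^sup>2" for t
  proof -
    have "(norm (f t + g t))\<^sup>2 \<le> (norm (f t) + norm (g t))\<^sup>2"
      by (rule power_mono[OF norm_triangle_ineq norm_ge_zero])
    also have "\<dots> \<le> 2 * (norm (f t))\<^sup>2 + 2 * (norm (g t))\<^sup>2"
      using zero_le_power2[of "norm (f t) - norm (g t)"] by (simp add: power2_sum power2_diff)
    finally show ?thesis .
  qed
  ultimately have "(\<lambda>t. (norm (f t + g t))\<^sup>2) summable_on UNIV"
    by (rule summable_on_comparison_test) simp
  then show ?thesis by (simp add: l2_def)
qed

lemma l2_bounded_linear: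
  assumes "bounded_linear h" "f \<in> l2"
  shows "(\<lambda>t. h (f t)) \<in> l2"
proof -
  obtain K where "\<And>x. norm (h x) \<le> norm x * K"
    using bounded_linear.bounded[OF assms(1)] by blast
  then show ?thesis by (intro l2_dominated[OF assms(2), of _ K]) (simp add: mult.commute)
qed

lemma l2_minus: "f \<in> l2 \<Longrightarrow> (\<lambda>t. - f t) \<in> l2"
  by (rule l2_bounded_linear[OF bounded_linear_minus[OF bounded_linear_ident]])

lemma l2_diff: "f \<in> l2 \<Longrightarrow> g \<in> l2 \<Longrightarrow> (\<lambda>t. f t - g t) \<in> l2"
  using l2_add[OF _ l2_minus] by fastforce

lemma l2_scaleR: "f \<in> l2 \<Longrightarrow> (\<lambda>t. c *\<^sub>R f t) \<in> l2"
  by (rule l2_bounded_linear[OF bounded_linear_scaleR_right])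

lemma l2_matrix: "f \<in> l2 \<Longrightarrow> (\<lambda>t. M *v f t) \<in> l2" for M :: "'a::{euclidean_space,real_algebra_1}^'n^'m"
  by (rule l2_bounded_linear[OF matrix_vector_mul_bounded_linear])

lemma l2_reindex:
  assumes "bij h" "f \<in> l2"
  shows "(\<lambda>t. f (h t)) \<in> l2"
  using assms summable_on_reindex_bij_betw[of h UNIV UNIV "\<lambda>t. (norm (f t))\<^sup>2"]
  by (simp add: l2_def)

lemma bij_int_shift: "bij (\<lambda>t. t + k)" for k :: int
  by (rule bij_betw_byWitness[where f' = "\<lambda>t. t - k"]) auto

lemma bij_int_reflect: "bij (\<lambda>t. k - t)" for k :: int
  by (rule bij_betw_byWitness[where f' = "\<lambda>t. k - t"]) auto

lemma l2_shift: "f \<in> l2 \<Longrightarrow> (\<lambda>t. f (t + k)) \<in> l2"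
  by (rule l2_reindex[OF bij_int_shift])

lemma l2_reflect: "f \<in> l2 \<Longrightarrow> (\<lambda>t. f (k - t)) \<in> l2"
  by (rule l2_reindex[OF bij_int_reflect])

lemmas l2_intros = l2_zero l2_add l2_diff l2_minus l2_scaleR l2_matrix l2_shift

lemma summable_inner:
  assumes "f \<in> l2" "g \<in> l2"
  shows "(\<lambda>t. f t \<bullet> g t) summable_on UNIV"
proof -
  have sq: "(\<lambda>t. h t \<bullet> h t) summable_on UNIV" if "h \<in> l2" for h :: "int \<Rightarrow> 'a"
    using that by (simp add: l2_def dot_square_norm)
  have "f t \<bullet> g t = 1/2 * ((f t + g t) \<bullet> (f t + g t)) + (-1/2) * (f t \<bullet> f t) + (-1/2) * (g t \<bullet> g t)" for t
    by (simp add: inner_add inner_commute algebra_simps)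
  moreover have "(\<lambda>t. 1/2 * ((f t + g t) \<bullet> (f t + g t)) + (-1/2) * (f t \<bullet> f t) + (-1/2) * (g t \<bullet> g t))
      summable_on UNIV"
    using sq[OF l2_add[OF assms]] sq[OF assms(1)] sq[OF assms(2)]
    by (intro summable_on_add summable_on_cmult_right)
  ultimately show ?thesis by simp
qed

lemma infsum_shift: "infsum (\<lambda>t. f (t + k)) UNIV = infsum f (UNIV :: int set)"
  by (rule infsum_reindex_bij_betw[OF bij_int_shift])

lemma summable_shift: "f summable_on (UNIV :: int set) \<Longrightarrow> (\<lambda>t. f (t + k)) summable_on UNIV"
  by (simp add: summable_on_reindex_bij_betw[OF bij_int_shift])

text \<open>The form in which energy balances are used: \<open>\<phi>\<close> is a stored quantity, and what is stored
  returns to zero at both ends of the time axis.\<close>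

lemma infsum_telescope:
  fixes f g \<phi> :: "int \<Rightarrow> real"
  assumes eq: "\<And>t. f t = g t + (\<phi> (t + 1) - \<phi> t)"
    and g: "g summable_on UNIV" and \<phi>: "\<phi> summable_on UNIV"
  shows "infsum f UNIV = infsum g UNIV"
proof -
  have m: "(\<lambda>t. - \<phi> t) summable_on UNIV" using \<phi> by (simp add: summable_on_uminus)
  have s: "(\<lambda>t. \<phi> (t + 1) + - \<phi> t) summable_on UNIV"
    by (rule summable_on_add[OF summable_shift[OF \<phi>] m])
  have "infsum (\<lambda>t. \<phi> (t + 1) + - \<phi> t) UNIV = 0"
    by (subst infsum_add[OF summable_shift[OF \<phi>] m]) (simp add: infsum_uminus infsum_shift)
  moreover have "f = (\<lambda>t. g t + (\<phi> (t + 1) + - \<phi> t))" using eq by (simp add: fun_eq_iff)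
  ultimately show ?thesis by (simp only: infsum_add[OF g s] add_0_right)
qed

lemma l2_eq_0_iff:
  fixes f :: "int \<Rightarrow> 'a::real_inner"
  assumes "f \<in> l2"
  shows "infsum (\<lambda>t. f t \<bullet> f t) UNIV = 0 \<longleftrightarrow> f = (\<lambda>_. 0)"
proof
  assume "infsum (\<lambda>t. f t \<bullet> f t) UNIV = 0"
  then have "f t \<bullet> f t = 0" for t
    using nonneg_infsum_le_0D[of "\<lambda>t. f t \<bullet> f t" UNIV t] summable_inner[OF assms assms] by simp
  then show "f = (\<lambda>_. 0)" by (simp add: fun_eq_iff)
qed simp

lemma l2_bounded:
  assumes "f \<in> l2"
  obtains B where "B \<ge> 0" "\<And>t. norm (f t) \<le> B"
proof -
  let ?s = "infsum (\<lambda>t. (norm (f t))\<^sup>2) UNIV"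
  have "norm (f t) \<le> sqrt ?s" for t
  proof (rule real_le_rsqrt)
    have "(\<Sum>t\<in>{t}. (norm (f t))\<^sup>2) \<le> ?s"
      using assms by (intro finite_sum_le_infsum) (auto simp: l2_def)
    then show "(norm (f t))\<^sup>2 \<le> ?s" by simp
  qed
  then show ?thesis by (rule that[rotated]) (simp add: infsum_nonneg)
qed

text \<open>By convexity \<open>(r a + b)\<^sup>2 \<le> r a\<^sup>2 + b\<^sup>2 / (1 - r)\<close>. Summed over a window of times, the left
  side absorbs the energy of \<open>x\<close> on the right up to one boundary term, which is bounded. This
  replaces Young's inequality for the convolution with a geometric sequence.\<close>

lemma l2_if_contractive:
  assumes x: "\<And>t. norm (x (t + 1)) \<le> r * norm (x t) + norm (f t)" and r: "0 \<le> r" "r < 1"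
    and f: "f \<in> l2" and bd: "\<And>t. norm (x t) \<le> B"
  shows "x \<in> l2"
proof -
  define s where "s = infsum (\<lambda>t. (norm (f t))\<^sup>2) UNIV"
  have fs: "(\<lambda>t. (norm (f t))\<^sup>2) summable_on UNIV" using f by (simp add: l2_def)
  have step: "(norm (x (t + 1)))\<^sup>2 \<le> r * (norm (x t))\<^sup>2 + (norm (f t))\<^sup>2 / (1 - r)" for t
  proof -
    let ?a = "norm (x t)" and ?b = "norm (f t)"
    have "(norm (x (t + 1)))\<^sup>2 \<le> (r * ?a + ?b)\<^sup>2" by (rule power_mono[OF x norm_ge_zero])
    also have "\<dots> \<le> r * ?a\<^sup>2 + ?b\<^sup>2 / (1 - r)"
    proof -
      have "r * ?a\<^sup>2 + ?b\<^sup>2 / (1 - r) - (r * ?a + ?b)\<^sup>2 = r * ((1 - r) * ?a - ?b)\<^sup>2 / (1 - r)"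
        using r by (simp add: field_simps power2_eq_square)
      moreover have "\<dots> \<ge> 0" using r by simp
      ultimately show ?thesis by linarith
    qed
    finally show ?thesis .
  qed
  have win: "(1 - r) * (\<Sum>i<k. (norm (x (a + int i)))\<^sup>2) \<le> B\<^sup>2 + s / (1 - r)" for a k
  proof -
    have "(1 - r) * (\<Sum>i<k. (norm (x (a + int i)))\<^sup>2) + (norm (x (a + int k)))\<^sup>2
        \<le> (norm (x a))\<^sup>2 + (\<Sum>i<k. (norm (f (a + int i)))\<^sup>2) / (1 - r)"
    proof (induction k)
      case (Suc k)
      have "(norm (x (a + int (Suc k))))\<^sup>2
          \<le> r * (norm (x (a + int k)))\<^sup>2 + (norm (f (a + int k)))\<^sup>2 / (1 - r)"
        using step[of "a + int k"] by (simp add: ac_simps)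
      with Suc show ?case by (simp add: algebra_simps add_divide_distrib)
    qed simp
    moreover have "(\<Sum>i<k. (norm (f (a + int i)))\<^sup>2) \<le> s"
    proof -
      have "(\<Sum>i<k. (norm (f (a + int i)))\<^sup>2) = (\<Sum>t\<in>(\<lambda>i. a + int i) ` {..<k}. (norm (f t))\<^sup>2)"
        by (subst sum.reindex) (auto simp: inj_on_def)
      also have "\<dots> \<le> s" unfolding s_def by (rule finite_sum_le_infsum[OF fs]) auto
      finally show ?thesis .
    qed
    moreover have "(norm (x a))\<^sup>2 \<le> B\<^sup>2" by (rule power_mono[OF bd norm_ge_zero])
    ultimately show ?thesis using r
      by (smt (verit, best) divide_right_mono zero_le_power2)
  qed
  have "(\<lambda>t. (norm (x t))\<^sup>2) summable_on UNIV"
  proof (rule nonneg_bdd_above_summable_on)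
    show "bdd_above (sum (\<lambda>t. (norm (x t))\<^sup>2) ` {F. F \<subseteq> UNIV \<and> finite F})"
    proof (rule bdd_aboveI2)
      fix F :: "int set" assume "F \<in> {F. F \<subseteq> UNIV \<and> finite F}"
      then have F: "finite F" by simp
      obtain N where N: "\<And>t. t \<in> F \<Longrightarrow> \<bar>t\<bar> \<le> N"
        using F by (metis finite_imageI image_eqI bdd_above.unfold bdd_above_finite)
      have "F \<subseteq> (\<lambda>i. - N + int i) ` {..<nat (2 * N + 1)}"
      proof
        fix t assume "t \<in> F"
        then have "t = - N + int (nat (t + N))" "nat (t + N) < nat (2 * N + 1)"
          using N[of t] by auto
        then show "t \<in> (\<lambda>i. - N + int i) ` {..<nat (2 * N + 1)}" by blast
      qed
      then have "(\<Sum>t\<in>F. (norm (x t))\<^sup>2) \<le> (\<Sum>t\<in>(\<lambda>i. - N + int i) ` {..<nat (2 * N + 1)}. (norm (x t))\<^sup>2)"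
        by (intro sum_mono2) auto
      also have "\<dots> = (\<Sum>i<nat (2 * N + 1). (norm (x (- N + int i)))\<^sup>2)"
        by (subst sum.reindex) (auto simp: inj_on_def)
      also have "\<dots> \<le> (B\<^sup>2 + s / (1 - r)) / (1 - r)"
        using win[of "- N" "nat (2 * N + 1)"] r by (simp only: pos_le_divide_eq mult.commute diff_gt_0_iff_gt)
      finally show "(\<Sum>t\<in>F. (norm (x t))\<^sup>2) \<le> (B\<^sup>2 + s / (1 - r)) / (1 - r)" .
    qed
  qed simp
  then show ?thesis by (simp add: l2_def)
qed

lemma norm_vector_smult: "norm (c *s v) = cmod c * norm v" for v :: "complex^'n"
  by (simp add: norm_vec_def L2_set_def norm_mult power_mult_distrib sum_distrib_left[symmetric]
      real_sqrt_mult)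

lemma vector_smult_bounded_linear: "bounded_linear (\<lambda>v :: complex^'n. c *s v)"
  by (rule bounded_linear_intro[of _ "cmod c"])
    (simp_all add: norm_vector_smult vec_eq_iff algebra_simps)

lemma scalar_recursion_solution_contractive:
  fixes f :: "int \<Rightarrow> complex^'n"
  assumes c: "cmod c < 1" and f: "f \<in> l2"
  obtains x where "x \<in> l2" "\<And>t. x (t + 1) = c *s x t + f t"
proof -
  obtain B where B: "B \<ge> 0" "\<And>t. norm (f t) \<le> B" using l2_bounded[OF f] by blast
  define x where "x t = (\<Sum>j. c ^ j *s f (t - 1 - int j))" for t
  have gs: "summable (\<lambda>j. B * cmod c ^ j)" using c by (intro summable_mult summable_geometric) simp
  have le: "norm (c ^ j *s f (t - 1 - int j)) \<le> B * cmod c ^ j" for t j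
    using mult_left_mono[OF B(2)[of "t - 1 - int j"], of "cmod c ^ j"] by (simp add: norm_vector_smult norm_power mult.commute)
  have sums: "summable (\<lambda>j. c ^ j *s f (t - 1 - int j))" for t
    by (rule summable_comparison_test'[OF gs le])
  have rec: "x (t + 1) = c *s x t + f t" for t
  proof -
    have "x (t + 1) = (\<Sum>j. c ^ Suc j *s f (t + 1 - 1 - int (Suc j))) + c ^ 0 *s f (t + 1 - 1 - int 0)"
      unfolding x_def using suminf_split_head[OF sums[of "t + 1"]] by simp
    also have "(\<Sum>j. c ^ Suc j *s f (t + 1 - 1 - int (Suc j))) = (\<Sum>j. c *s (c ^ j *s f (t - 1 - int j)))"
      by (simp add: vector_smult_assoc algebra_simps)
    also have "\<dots> = c *s x t" unfolding x_def
      by (rule bounded_linear.suminf[OF vector_smult_bounded_linear sums, symmetric])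
    finally show ?thesis by simp
  qed
  have bd: "norm (x t) \<le> (\<Sum>j. B * cmod c ^ j)" for t
    unfolding x_def by (rule norm_suminf_le[OF le gs])
  have "x \<in> l2"
  proof (rule l2_if_contractive[OF _ _ c f bd])
    show "norm (x (t + 1)) \<le> cmod c * norm (x t) + norm (f t)" for t
      unfolding rec using norm_triangle_ineq[of "c *s x t" "f t"] by (simp add: norm_vector_smult)
  qed simp
  then show ?thesis using that rec by blast
qed

text \<open>If \<open>|c| > 1\<close>, the recursion is a contraction with factor \<open>1 / c\<close> in reversed time.\<close>

lemma scalar_recursion_solution:
  fixes f :: "int \<Rightarrow> complex^'n"
  assumes c: "cmod c \<noteq> 1" and f: "f \<in> l2"
  obtains x where "x \<in> l2" "\<And>t. x (t + 1) = c *s x t + f t"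
proof (cases "cmod c < 1")
  case True
  then show ?thesis using scalar_recursion_solution_contractive[OF _ f] that by metis
next
  case False
  then have "cmod c > 1" using c by simp
  then have c1: "cmod (1 / c) < 1" "c \<noteq> 0" by (auto simp: norm_divide divide_less_eq)
  have "(\<lambda>t. (- 1 / c) *s f (- 1 - t)) \<in> l2"
    by (rule l2_bounded_linear[OF vector_smult_bounded_linear l2_reflect[OF f]])
  then obtain y where y: "y \<in> l2" "\<And>t. y (t + 1) = (1 / c) *s y t + (- 1 / c) *s f (- 1 - t)"
    using scalar_recursion_solution_contractive[OF c1(1)] by metis
  have "y (0 - (t + 1)) = c *s y (0 - t) + f t" for t
  proof -
    have "y (0 - t) = (1 / c) *s y (0 - (t + 1)) + (- 1 / c) *s f t" using y(2)[of "- t - 1"] by simp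
    then have "c *s y (0 - t) = y (0 - (t + 1)) - f t"
      using c1 by (simp add: vector_add_ldistrib vector_smult_assoc)
    then show ?thesis by simp
  qed
  then show ?thesis using that[OF l2_reflect[OF y(1), of 0]] by blast
qed

text \<open>A nonzero value at time \<open>t\<close> would force geometric growth towards the past. Only the past is
  used, and this is what makes the \<open>l2\<close> solutions of stable systems causal.\<close>

lemma scalar_recursion_half_line_zero:
  fixes z :: "int \<Rightarrow> complex^'n"
  assumes c: "cmod c < 1" and z: "z \<in> l2" and rec: "\<And>t. t < T \<Longrightarrow> z (t + 1) = c *s z t"
    and t: "t \<le> T"
  shows "z t = 0"
proof -
  obtain B where B: "B \<ge> 0" "\<And>t. norm (z t) \<le> B" using l2_bounded[OF z] by blast
  have n: "norm (z t) = cmod c ^ k * norm (z (t - int k))" for k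
  proof (induction k)
    case (Suc k)
    have "z (t - int k) = c *s z (t - int (Suc k))" using rec[of "t - int (Suc k)"] t by simp
    then show ?case using Suc by (simp add: norm_vector_smult)
  qed simp
  have "norm (z t) \<le> B * cmod c ^ k" for k
    using mult_left_mono[OF B(2)[of "t - int k"], of "cmod c ^ k"] n[of k] by (simp add: mult.commute)
  moreover have "(\<lambda>k. B * cmod c ^ k) \<longlonglongrightarrow> B * 0"
    using c by (intro tendsto_mult tendsto_const LIMSEQ_realpow_zero) auto
  ultimately have "norm (z t) \<le> 0" by (metis LIMSEQ_le_const mult_zero_right)
  then show ?thesis by simp
qed

lemma scalar_recursion_zero:
  fixes z :: "int \<Rightarrow> complex^'n"
  assumes c: "cmod c \<noteq> 1" and z: "z \<in> l2" and rec: "\<And>t. z (t + 1) = c *s z t"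
  shows "z t = 0"
proof (cases "cmod c < 1")
  case True
  then show ?thesis using scalar_recursion_half_line_zero[OF True z rec, of t t] by simp
next
  case False
  then have "cmod c > 1" using c by simp
  then have c1: "cmod (1 / c) < 1" "c \<noteq> 0" by (auto simp: norm_divide divide_less_eq)
  have "z (0 - (s + 1)) = (1 / c) *s z (0 - s)" for s
    using rec[of "- s - 1"] c1 by (simp add: vector_smult_assoc)
  then have "z (0 - (- t)) = 0"
    using scalar_recursion_half_line_zero[OF c1(1) l2_reflect[OF z, of 0], of "- t" "- t"] by blast
  then show ?thesis by simp
qed

section \<open>Linear recursions without spectrum on the unit circle\<close>

text \<open>The product of the factors \<open>M - c I\<close> applied to \<open>v\<close>. Keeping the factors in a list makes
  it possible to reduce a matrix recursion to scalar ones by induction.\<close>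

primrec annihilate :: "complex^'n^'n \<Rightarrow> complex list \<Rightarrow> complex^'n \<Rightarrow> complex^'n" where
  "annihilate M [] v = v"
| "annihilate M (c # cs) v = annihilate M cs (M *v v - c *s v)"

lemma matrix_vector_smult: "M *v (c *s v) = c *s (M *v v)" for M :: "'a::comm_semiring_1^'n^'m"
  by (simp add: matrix_vector_mult_def vec_eq_iff sum_distrib_left ac_simps)

lemma annihilate_add: "annihilate M cs (v + w) = annihilate M cs v + annihilate M cs w"
  by (induction cs arbitrary: v w)
    (simp_all add: matrix_vector_right_distrib vector_add_ldistrib add_diff_add)

lemma annihilate_smult: "annihilate M cs (a *s v) = a *s annihilate M cs v"
proof (induction cs arbitrary: v)
  case (Cons c cs)
  have "M *v (a *s v) - c *s (a *s v) = a *s (M *v v - c *s v)"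
    by (simp add: matrix_vector_smult vector_ssub_ldistrib vector_smult_assoc mult.commute)
  then show ?case by (simp only: annihilate.simps Cons)
qed simp

lemma annihilate_diff: "annihilate M cs (v - w) = annihilate M cs v - annihilate M cs w"
  using annihilate_add[of M cs "v - w" w] by (simp add: algebra_simps)

lemma annihilate_commute: "annihilate M cs (M *v v) = M *v annihilate M cs v"
proof (induction cs arbitrary: v)
  case (Cons c cs)
  have "M *v (M *v v) - c *s (M *v v) = M *v (M *v v - c *s v)"
    by (simp add: matrix_vector_mult_diff_distrib matrix_vector_smult)
  then show ?case using Cons by simp
qed simp

lemma annihilate_l2: "f \<in> l2 \<Longrightarrow> (\<lambda>t. annihilate M cs (f t)) \<in> l2"
  by (induction cs arbitrary: f)
    (simp_all add: l2_diff l2_matrix l2_bounded_linear[OF vector_smult_bounded_linear])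

definition poly_matrix :: "complex^'n^'n \<Rightarrow> complex poly \<Rightarrow> complex^'n \<Rightarrow> complex^'n" where
  "poly_matrix M p v = fold_coeffs (\<lambda>a w. a *s v + M *v w) p 0"

lemma poly_matrix_0: "poly_matrix M 0 v = 0"
  by (simp add: poly_matrix_def)

lemma poly_matrix_pCons: "poly_matrix M (pCons a p) v = a *s v + M *v poly_matrix M p v"
  by (cases "p = 0 \<and> a = 0") (auto simp: poly_matrix_def)

lemma poly_matrix_add: "poly_matrix M (p + q) v = poly_matrix M p v + poly_matrix M q v"
  by (induction p q rule: poly_induct2)
    (simp_all add: poly_matrix_0 poly_matrix_pCons matrix_vector_right_distrib vector_sadd_rdistrib)

lemma poly_matrix_smult: "poly_matrix M (smult a p) v = a *s poly_matrix M p v"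
  by (induction p)
    (simp_all add: poly_matrix_0 poly_matrix_pCons matrix_vector_smult vector_add_ldistrib
      vector_smult_assoc)

lemma poly_matrix_linear:
  "poly_matrix M p (v + w) = poly_matrix M p v + poly_matrix M p w"
  "poly_matrix M p (c *s v) = c *s poly_matrix M p v"
  "poly_matrix M p (M *v v) = M *v poly_matrix M p v"
  by (induction p)
    (simp_all add: poly_matrix_0 poly_matrix_pCons matrix_vector_right_distrib vector_add_ldistrib
      matrix_vector_smult vector_smult_assoc mult.commute)

lemma poly_matrix_diff_arg: "poly_matrix M p (v - w) = poly_matrix M p v - poly_matrix M p w"
  using poly_matrix_linear(1)[of M p "v - w" w] by (simp add: algebra_simps)

lemma poly_matrix_root_factor:
  "poly_matrix M ([:- c, 1:] * q) v = M *v poly_matrix M q v - c *s poly_matrix M q v"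
  "poly_matrix M ([:- c, 1:] * q) v = poly_matrix M q (M *v v - c *s v)"
proof -
  have "poly_matrix M ([:- c, 1:] * q) v = (- c) *s poly_matrix M q v + M *v poly_matrix M q v"
  proof -
    have "[:- c, 1:] * q = smult (- c) q + pCons 0 q" by simp
    then show ?thesis by (simp only: poly_matrix_add poly_matrix_smult poly_matrix_pCons) simp
  qed
  then show "poly_matrix M ([:- c, 1:] * q) v = M *v poly_matrix M q v - c *s poly_matrix M q v"
    by (simp add: vec_eq_iff)
  then show "poly_matrix M ([:- c, 1:] * q) v = poly_matrix M q (M *v v - c *s v)"
    by (simp add: poly_matrix_diff_arg poly_matrix_linear)
qed

lemma poly_matrix_sum:
  "poly_matrix M (\<Sum>i\<in>I. p i) v = (\<Sum>i\<in>I. poly_matrix M (p i) v)"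
  by (induction I rule: infinite_finite_induct) (simp_all add: poly_matrix_0 poly_matrix_add)

fun matrix_power :: "'a::semiring_1^'n^'n \<Rightarrow> nat \<Rightarrow> 'a^'n^'n" where
  "matrix_power M 0 = mat 1"
| "matrix_power M (Suc k) = M ** matrix_power M k"

lemma poly_matrix_monom: "poly_matrix M (monom a k) v = a *s (matrix_power M k *v v)"
  by (induction k)
    (simp_all add: monom_0 monom_Suc poly_matrix_pCons poly_matrix_0 matrix_vector_smult
      matrix_vector_mul_assoc)

text \<open>The powers of \<open>M\<close> lie in a space of finite dimension. If two of them coincide, their
  difference gives the polynomial; otherwise a linear dependence between them does.\<close>

lemma annihilating_polynomial:
  fixes M :: "complex^'n^'n"
  obtains p where "p \<noteq> 0" "\<And>v. poly_matrix M p v = 0"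
proof (cases "inj (matrix_power M)")
  case False
  then obtain i j where ij: "i \<noteq> j" "matrix_power M i = matrix_power M j" by (auto simp: inj_on_def)
  define p where "p = monom 1 i + monom (- 1 :: complex) j"
  have "coeff p i = 1" using ij by (simp add: p_def)
  then have "p \<noteq> 0" by auto
  moreover have "poly_matrix M p v = 0" for v
    by (simp add: p_def poly_matrix_add poly_matrix_monom ij vec_eq_iff)
  ultimately show ?thesis by (rule that)
next
  case True
  let ?I = "{..DIM(complex^'n^'n)}"
  let ?S = "matrix_power M ` ?I"
  have "card ?S = Suc (DIM(complex^'n^'n))"
    using True by (subst card_image) (auto intro: inj_on_subset)
  then have "dependent ?S" using independent_bound[of ?S] by linarith
  then obtain u where u: "\<exists>A\<in>?S. u A \<noteq> 0" "(\<Sum>A\<in>?S. u A *\<^sub>R A) = 0"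
    using dependent_finite[of ?S] by auto
  define p where "p = (\<Sum>i\<in>?I. monom (complex_of_real (u (matrix_power M i))) i)"
  obtain i where i: "i \<in> ?I" "u (matrix_power M i) \<noteq> 0" using u(1) by blast
  have "coeff p i = of_real (u (matrix_power M i))"
    using i by (simp add: p_def coeff_sum if_distrib cong: if_cong)
  then have "p \<noteq> 0" using i by auto
  moreover have "poly_matrix M p v = 0" for v
  proof -
    have "poly_matrix M p v = (\<Sum>i\<in>?I. (u (matrix_power M i) *\<^sub>R matrix_power M i) *v v)"
      unfolding p_def poly_matrix_sum poly_matrix_monom
      by (intro sum.cong refl)
        (simp add: vec_eq_iff matrix_vector_mult_def scaleR_conv_of_real[where 'a=complex] sum_distrib_left mult.assoc)
    also have "\<dots> = (\<Sum>i\<in>?I. u (matrix_power M i) *\<^sub>R matrix_power M i) *v v"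
      by (induction rule: infinite_finite_induct) (simp_all add: matrix_vector_mult_add_rdistrib)
    also have "(\<Sum>i\<in>?I. u (matrix_power M i) *\<^sub>R matrix_power M i) = 0"
      using u(2) True by (subst (asm) sum.reindex) (auto intro: inj_on_subset)
    finally show ?thesis by simp
  qed
  ultimately show ?thesis by (rule that)
qed

text \<open>Split an annihilating polynomial over the complex numbers and drop the roots that are not
  eigenvalues, for which the factor \<open>M - c I\<close> is injective.\<close>

lemma annihilate_eigenvalues:
  fixes M :: "complex^'n^'n"
  obtains cs where "\<And>c. c \<in> set cs \<Longrightarrow> eigenvalue M c" "\<And>v. annihilate M cs v = 0"
proof -
  have "\<exists>cs. (\<forall>c\<in>set cs. eigenvalue M c) \<and> (\<forall>v. poly_matrix M p v = 0 \<longrightarrow> annihilate M cs v = 0)"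
    if "p \<noteq> 0" for p
    using that
  proof (induction "degree p" arbitrary: p)
    case 0
    then obtain a where a: "p = [:a:]" "a \<noteq> 0" by (metis degree_0_id pCons_0_0 degree_eq_zeroE)
    have "v = 0" if "poly_matrix M p v = 0" for v
      using that a by (simp add: poly_matrix_pCons poly_matrix_0)
    then show ?case by (intro exI[of _ "[]"]) simp
  next
    case (Suc d)
    then have "\<not> constant (poly p)" by (simp add: constant_degree)
    then obtain c where "poly p c = 0" using fundamental_theorem_of_algebra by blast
    then obtain q where q: "p = [:- c, 1:] * q" by (auto simp: poly_eq_0_iff_dvd)
    then have "q \<noteq> 0" using Suc.prems by auto
    moreover have "d = degree q" using Suc(2) q \<open>q \<noteq> 0\<close> by (simp add: degree_mult_eq del: mult_pCons_left)
    ultimately obtain cs where cs: "\<forall>c\<in>set cs. eigenvalue M c"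
      "\<And>v. poly_matrix M q v = 0 \<Longrightarrow> annihilate M cs v = 0" using Suc(1) by metis
    show ?case
    proof (cases "eigenvalue M c")
      case True
      then show ?thesis using cs q
        by (intro exI[of _ "c # cs"]) (auto simp: poly_matrix_root_factor(2) simp del: mult_pCons_left)
    next
      case False
      have "poly_matrix M q v = 0" if "poly_matrix M p v = 0" for v
        using that False unfolding q poly_matrix_root_factor(1)
        by (auto simp: eigenvalue_def)
      then show ?thesis using cs by (intro exI[of _ cs]) auto
    qed
  qed
  moreover obtain p where "p \<noteq> 0" "\<And>v. poly_matrix M p v = 0" using annihilating_polynomial by metis
  ultimately show ?thesis using that by metis
qed

text \<open>For the list \<open>c # cs\<close>, solve first \<open>y\<^sub>t\<^sub>+\<^sub>1 = c y\<^sub>t + f\<^sub>t\<close>. The error \<open>(M - c) y\<close> that this leaves is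
  annihilated by the shorter list \<open>cs\<close>, because by uniqueness of scalar recursions \<open>y\<close> inherits
  from \<open>f\<close> that it is annihilated by \<open>c # cs\<close>.\<close>

lemma complex_recursion_solution:
  fixes M :: "complex^'n^'n"
  assumes hyp: "\<And>c. eigenvalue M c \<Longrightarrow> cmod c \<noteq> 1" and f: "f \<in> l2"
  obtains x where "x \<in> l2" "\<And>t. x (t + 1) = M *v x t + f t"
proof -
  have ex: "\<exists>x\<in>l2. \<forall>t. x (t + 1) = M *v x t + f t"
    if "\<forall>c\<in>set cs. eigenvalue M c" "f \<in> l2" "\<And>t. annihilate M cs (f t) = 0" for cs f
    using that
  proof (induction cs arbitrary: f)
    case Nil
    then show ?case by (intro bexI[of _ "\<lambda>_. 0"]) (simp_all add: l2_zero)
  next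
    case (Cons c cs)
    have c: "cmod c \<noteq> 1" using Cons.prems(1) hyp by auto
    obtain y where y: "y \<in> l2" "\<And>t. y (t + 1) = c *s y t + f t"
      using scalar_recursion_solution[OF c Cons.prems(2)] by blast
    have "annihilate M (c # cs) (y (t + 1)) = c *s annihilate M (c # cs) (y t)" for t
      unfolding y(2) annihilate_add Cons.prems(3) annihilate_smult by simp
    from scalar_recursion_zero[OF c annihilate_l2[OF y(1)] this]
    have ann: "annihilate M (c # cs) (y t) = 0" for t .
    have l2: "(\<lambda>t. M *v y t - c *s y t) \<in> l2"
      by (intro l2_diff l2_matrix l2_bounded_linear[OF vector_smult_bounded_linear] y)
    obtain z where z: "z \<in> l2" "\<And>t. z (t + 1) = M *v z t + (M *v y t - c *s y t)"
      using Cons.IH[OF _ l2] Cons.prems(1) ann by auto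
    show ?case
      by (rule bexI[of _ "\<lambda>t. y t + z t"])
        (simp_all add: l2_add y z matrix_vector_right_distrib)
  qed
  obtain cs where "\<And>c. c \<in> set cs \<Longrightarrow> eigenvalue M c" "\<And>v. annihilate M cs v = 0"
    by (rule annihilate_eigenvalues) (rule that)
  then show ?thesis using ex[of cs f] f that by blast
qed

text \<open>The set \<open>S\<close> of times is \<open>UNIV\<close> for uniqueness without spectrum on the circle, and a half
  line for causality of stable systems.\<close>

lemma complex_recursion_zero:
  fixes M :: "complex^'n^'n"
  assumes scalar: "\<And>c (z :: int \<Rightarrow> complex^'n) t. eigenvalue M c \<Longrightarrow> z \<in> l2 \<Longrightarrow>
      (\<And>t. t \<in> S \<Longrightarrow> z (t + 1) = c *s z t) \<Longrightarrow> t \<in> S \<Longrightarrow> z t = 0"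
    and x: "x \<in> l2" and rec: "\<And>t. t \<in> S \<Longrightarrow> x (t + 1) = M *v x t" and t: "t \<in> S"
  shows "x t = 0"
proof -
  have *: "\<forall>t\<in>S. x t = 0"
    if "\<forall>c\<in>set cs. eigenvalue M c" "\<forall>t\<in>S. annihilate M cs (x t) = 0" for cs
    using that
  proof (induction cs)
    case (Cons c cs)
    let ?z = "\<lambda>t. annihilate M cs (x t)"
    have "?z t = 0" if "t \<in> S" for t
    proof (rule scalar[OF _ annihilate_l2[OF x] _ that])
      show "eigenvalue M c" using Cons.prems(1) by simp
      fix t assume "t \<in> S"
      then have "M *v ?z t - c *s ?z t = 0"
        using Cons.prems(2) by (simp add: annihilate_diff annihilate_smult annihilate_commute)
      then show "?z (t + 1) = c *s ?z t"
        using rec[OF \<open>t \<in> S\<close>] by (simp add: annihilate_commute)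
    qed
    then show ?case using Cons.IH Cons.prems(1) by simp
  qed simp
  obtain cs where "\<And>c. c \<in> set cs \<Longrightarrow> eigenvalue M c" "\<And>v. annihilate M cs v = 0"
    by (rule annihilate_eigenvalues) (rule that)
  then show ?thesis using *[of cs] t by blast
qed

definition cvec :: "real^'n \<Rightarrow> complex^'n" where
  "cvec v = (\<chi> i. complex_of_real (v $ i))"

definition revec :: "complex^'n \<Rightarrow> real^'n" where
  "revec v = (\<chi> i. Re (v $ i))"

lemma cvec_mult: "cmat M *v cvec v = cvec (M *v v)"
  by (simp add: cvec_def vec_eq_iff matrix_vector_mult_def map_matrix_def)

lemma revec_mult: "revec (cmat M *v v) = M *v revec v"
  by (simp add: revec_def vec_eq_iff matrix_vector_mult_def map_matrix_def)

lemma norm_cvec: "norm (cvec v) = norm v"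
  by (simp add: cvec_def norm_vec_def)

lemma norm_revec: "norm (revec v) \<le> norm v"
  unfolding revec_def norm_vec_def by (rule L2_set_mono) (simp_all add: abs_Re_le_cmod)

definition hyperbolic :: "real^'n^'n \<Rightarrow> bool" where
  "hyperbolic M \<longleftrightarrow> (\<forall>c. eigenvalue (cmat M) c \<longrightarrow> cmod c \<noteq> 1)"

lemma schur_hyperbolic: "schur_stable M \<Longrightarrow> hyperbolic M"
  by (auto simp: schur_stable_def hyperbolic_def)

lemma eigenvalue_iff_singular: "eigenvalue M c \<longleftrightarrow> det (M - mat c) = 0" for M :: "'a::field^'n^'n"
proof -
  have "eigenvalue M c \<longleftrightarrow> \<not> (\<forall>x. (M - mat c) *v x = 0 \<longrightarrow> x = 0)"
    by (auto simp: eigenvalue_def matrix_vector_mult_diff_rdistrib mat_vector_mult)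
  also have "\<dots> \<longleftrightarrow> \<not> invertible (M - mat c)"
    by (metis matrix_left_invertible_ker invertible_left_inverse)
  finally show ?thesis by (simp add: invertible_det_nz)
qed

lemma eigenvalue_transpose: "eigenvalue (cmat (transpose M)) c \<longleftrightarrow> eigenvalue (cmat M) c"
proof -
  have "cmat (transpose M) - mat c = transpose (cmat M - mat c)"
    by (simp add: vec_eq_iff transpose_def map_matrix_def mat_def)
  then show ?thesis by (simp only: eigenvalue_iff_singular det_transpose)
qed

lemma hyperbolic_transpose: "hyperbolic M \<Longrightarrow> hyperbolic (transpose M)"
  by (simp add: hyperbolic_def eigenvalue_transpose)

lemma schur_transpose: "schur_stable M \<Longrightarrow> schur_stable (transpose M)"
  by (simp add: schur_stable_def eigenvalue_transpose)

lemma forward_solution: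
  assumes M: "hyperbolic M" and f: "f \<in> l2"
  obtains x where "x \<in> l2" "\<And>t. x (t + 1) = M *v x t + f t"
proof -
  have "(\<lambda>t. cvec (f t)) \<in> l2" by (rule l2_dominated[OF f, of _ 1]) (simp add: norm_cvec)
  then obtain x where x: "x \<in> l2" "\<And>t. x (t + 1) = cmat M *v x t + cvec (f t)"
    using complex_recursion_solution[of "cmat M"] M by (metis hyperbolic_def)
  have "(\<lambda>t. revec (x t)) \<in> l2" by (rule l2_dominated[OF x(1), of _ 1]) (simp add: norm_revec)
  moreover have "revec (x (t + 1)) = M *v revec (x t) + f t" for t
    by (simp add: x(2) flip: revec_mult) (simp add: revec_def cvec_def vec_eq_iff)
  ultimately show ?thesis by (rule that)
qed

lemma forward_zero:
  assumes M: "hyperbolic M" and x: "x \<in> l2" and rec: "\<And>t. x (t + 1) = M *v x t"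
  shows "x t = 0"
proof -
  have "cvec (x t) = 0"
  proof (rule complex_recursion_zero[where M = "cmat M" and S = UNIV and x = "\<lambda>t. cvec (x t)"])
    show "(\<lambda>t. cvec (x t)) \<in> l2" by (rule l2_dominated[OF x, of _ 1]) (simp add: norm_cvec)
    show "cvec (x (t + 1)) = cmat M *v cvec (x t)" for t by (simp add: rec cvec_mult)
    fix c and z :: "int \<Rightarrow> complex^'a" and t
    assume "eigenvalue (cmat M) c" "z \<in> l2" "\<And>t. t \<in> UNIV \<Longrightarrow> z (t + 1) = c *s z t"
    then show "z t = 0" using scalar_recursion_zero M by (metis UNIV_I hyperbolic_def)
  qed simp
  then show ?thesis by (metis norm_cvec norm_eq_zero)
qed

text \<open>Causality of stable systems: if two inputs agree before time \<open>T\<close>, the difference of the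
  corresponding \<open>l2\<close> states satisfies these hypotheses.\<close>

lemma forward_half_line_zero:
  assumes M: "schur_stable M" and x: "x \<in> l2" and rec: "\<And>t. t < T \<Longrightarrow> x (t + 1) = M *v x t"
    and t: "t \<le> T"
  shows "x t = 0"
proof -
  have lt: "x t = 0" if "t < T" for t
  proof -
    have "cvec (x t) = 0"
    proof (rule complex_recursion_zero[where M = "cmat M" and S = "{..<T}" and x = "\<lambda>t. cvec (x t)"])
      show "(\<lambda>t. cvec (x t)) \<in> l2" by (rule l2_dominated[OF x, of _ 1]) (simp add: norm_cvec)
      show "t \<in> {..<T} \<Longrightarrow> cvec (x (t + 1)) = cmat M *v cvec (x t)" for t by (simp add: rec cvec_mult)
      fix c and z :: "int \<Rightarrow> complex^'a" and t
      assume *: "eigenvalue (cmat M) c" "z \<in> l2" "\<And>t. t \<in> {..<T} \<Longrightarrow> z (t + 1) = c *s z t" "t \<in> {..<T}"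
      have "cmod c < 1" using M *(1) by (auto simp: schur_stable_def)
      from scalar_recursion_half_line_zero[OF this *(2), of T t] * show "z t = 0" by auto
    qed (use that in simp)
    then show ?thesis by (metis norm_cvec norm_eq_zero)
  qed
  show ?thesis
  proof (cases "t = T")
    case True
    then show ?thesis using rec[of "T - 1"] lt[of "T - 1"] by simp
  qed (use lt t in simp)
qed

lemma backward_solution:
  assumes M: "hyperbolic M" and f: "f \<in> l2"
  obtains x where "x \<in> l2" "\<And>t. x t = M *v x (t + 1) + f t"
proof -
  have "(\<lambda>t. f (- 1 - t)) \<in> l2" by (rule l2_reflect[OF f])
  then obtain y where y: "y \<in> l2" "\<And>t. y (t + 1) = M *v y t + f (- 1 - t)"
    using forward_solution[OF M] by metis
  have "y (0 - t) = M *v y (0 - (t + 1)) + f t" for t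
  proof -
    have "y (- t) = M *v y (- t - 1) + f t" using y(2)[of "- t - 1"] by simp
    moreover have "0 - (t + 1) = - t - 1" by simp
    ultimately show ?thesis by (simp only: diff_0)
  qed
  then show ?thesis using that[OF l2_reflect[OF y(1), of 0]] by blast
qed

lemma backward_half_line_zero:
  assumes M: "schur_stable M" and x: "x \<in> l2" and rec: "\<And>t. T \<le> t \<Longrightarrow> x t = M *v x (t + 1)"
    and t: "T \<le> t"
  shows "x t = 0"
proof -
  have "x (0 - (- t)) = 0"
  proof (rule forward_half_line_zero[OF M l2_reflect[OF x, of 0], of "- T" "- t"])
    fix s :: int assume "s < - T"
    then show "x (0 - (s + 1)) = M *v x (0 - s)" using rec[of "- s - 1"] by simp
  qed (use t in simp)
  then show ?thesis by simp
qed

lemma l2_state_unique: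
  assumes A: "hyperbolic A" and x: "x \<in> l2" "\<And>t. x (t + 1) = A *v x t + B *v v t"
  shows "l2_state A B v = x"
  unfolding l2_state_def
proof (rule the_equality)
  fix y assume y: "y \<in> l2 \<and> (\<forall>t. y (t + 1) = A *v y t + B *v v t)"
  have "y t - x t = 0" for t
    by (rule forward_zero[OF A l2_diff]) (use x y in \<open>simp_all add: matrix_vector_mult_diff_distrib\<close>)
  then show "y = x" by (simp add: fun_eq_iff)
qed (use x in simp)

lemma l2_state:
  assumes A: "hyperbolic A" and v: "v \<in> l2"
  shows "l2_state A B v \<in> l2" "l2_state A B v (t + 1) = A *v l2_state A B v t + B *v v t"
proof -
  obtain x where x: "x \<in> l2" "\<And>t. x (t + 1) = A *v x t + B *v v t"
    using forward_solution[OF A l2_matrix[OF v]] by metis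
  from l2_state_unique[OF A x] show "l2_state A B v \<in> l2"
    "l2_state A B v (t + 1) = A *v l2_state A B v t + B *v v t" using x by simp_all
qed

lemma l2_state_add:
  assumes A: "hyperbolic A" and v: "v \<in> l2" "w \<in> l2"
  shows "l2_state A B (\<lambda>i. v i + w i) t = l2_state A B v t + l2_state A B w t"
  by (subst l2_state_unique[OF A, of "\<lambda>t. l2_state A B v t + l2_state A B w t"])
    (simp_all add: l2_add l2_state[OF A v(1)] l2_state[OF A v(2)] matrix_vector_right_distrib)

lemma l2_state_scaleR:
  assumes A: "hyperbolic A" and v: "v \<in> l2"
  shows "l2_state A B (\<lambda>i. c *\<^sub>R v i) t = c *\<^sub>R l2_state A B v t"
  by (subst l2_state_unique[OF A, of "\<lambda>t. c *\<^sub>R l2_state A B v t"])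
    (simp_all add: l2_scaleR l2_state[OF A v] matrix_vector_mult_scaleR scaleR_add_right)

lemma l2_state_causal:
  assumes A: "schur_stable A" and v: "v \<in> l2" "w \<in> l2" and eq: "\<And>i. i < t \<Longrightarrow> v i = w i"
  shows "l2_state A B v t = l2_state A B w t"
proof -
  note h = schur_hyperbolic[OF A]
  have "l2_state A B v t - l2_state A B w t = 0"
    by (rule forward_half_line_zero[OF A l2_diff, of _ _ t])
      (simp_all add: eq l2_state[OF h v(1)] l2_state[OF h v(2)] matrix_vector_mult_diff_distrib)
  then show ?thesis by simp
qed

section \<open>Lyapunov equations\<close>

lemma infsum_at: "infsum (\<lambda>t. if t = a then b else 0) UNIV = (b::real)"
proof -
  have "infsum (\<lambda>t. if t = a then b else 0) UNIV = infsum (\<lambda>t. b) {a}"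
    by (rule infsum_cong_neutral) auto
  then show ?thesis by simp
qed

lemma summable_at: "(\<lambda>t. if t = a then b else (0::real)) summable_on UNIV"
proof -
  have "(\<lambda>t. b) summable_on {a}" by simp
  moreover have "(\<lambda>t. b) summable_on {a} \<longleftrightarrow> (\<lambda>t. if t = a then b else (0::real)) summable_on UNIV"
    by (rule summable_on_cong_neutral) auto
  ultimately show ?thesis by blast
qed

text \<open>The response at times \<open>1, 2, 3, \<dots>\<close> is \<open>x, M x, M\<^sup>2 x, \<dots>\<close>. Being in \<open>l2\<close>, it plays the role of
  the decay of the powers of \<open>M\<close>.\<close>

lemma impulse_response:
  assumes M: "schur_stable M"
  obtains p where "p \<in> l2" "\<And>t. t \<le> 0 \<Longrightarrow> p t = 0" "p 1 = x"
    "\<And>t. t \<noteq> 0 \<Longrightarrow> p (t + 1) = M *v p t"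
proof -
  define f where "f t = (if t = (0::int) then x else 0)" for t
  have f: "f \<in> l2"
  proof -
    have "(\<lambda>t. (norm (f t))\<^sup>2) = (\<lambda>t. if t = 0 then (norm x)\<^sup>2 else 0)" by (simp add: fun_eq_iff f_def)
    then show ?thesis using summable_at[of "0::int" "(norm x)\<^sup>2"] by (simp add: l2_def)
  qed
  obtain p where p: "p \<in> l2" "\<And>t. p (t + 1) = M *v p t + f t"
    using forward_solution[OF schur_hyperbolic[OF M] f] by metis
  have z: "p t = 0" if "t \<le> 0" for t
    by (rule forward_half_line_zero[OF M p(1), of 0]) (use that in \<open>simp_all add: p(2) f_def\<close>)
  show ?thesis
  proof (rule that[OF p(1) z])
    show "p 1 = x" using p(2)[of 0] z[of 0] by (simp add: f_def)
    show "t \<noteq> 0 \<Longrightarrow> p (t + 1) = M *v p t" for t by (simp add: p(2) f_def)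
  qed simp
qed

text \<open>Along the impulse response of \<open>x\<close> the form decreases from \<open>x \<bullet> X x\<close> to 0.\<close>

lemma lyapunov_nonneg:
  assumes M: "schur_stable M" and le: "\<And>x. (M *v x) \<bullet> (X *v (M *v x)) \<le> x \<bullet> (X *v x)"
  shows "0 \<le> x \<bullet> (X *v x)"
proof -
  obtain p where p: "p \<in> l2" "\<And>t. t \<le> 0 \<Longrightarrow> p t = 0" "p 1 = x"
    "\<And>t. t \<noteq> 0 \<Longrightarrow> p (t + 1) = M *v p t" using impulse_response[OF M, of x] by blast
  define \<phi> where "\<phi> t = p t \<bullet> (X *v p t)" for t
  have s: "\<phi> summable_on UNIV" unfolding \<phi>_def by (intro summable_inner l2_matrix p)
  have "0 = infsum (\<lambda>t. \<phi> (t + 1) - \<phi> t) UNIV"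
    using infsum_telescope[of "\<lambda>t. \<phi> (t + 1) - \<phi> t" "\<lambda>_. 0" \<phi>] s by simp
  also have "\<dots> \<le> infsum (\<lambda>t::int. if t = 0 then x \<bullet> (X *v x) else 0) UNIV"
  proof (rule infsum_mono)
    show "(\<lambda>t. \<phi> (t + 1) - \<phi> t) summable_on UNIV"
      using summable_on_add[OF summable_shift[OF s, of 1] summable_on_uminus[THEN iffD2, OF s]] by simp
    show "\<phi> (t + 1) - \<phi> t \<le> (if t = 0 then x \<bullet> (X *v x) else 0)" for t
      using p(2)[of 0] p(3) le[of "p t"] by (cases "t = 0") (simp_all add: \<phi>_def p(4))
  qed (rule summable_at)
  finally show ?thesis by (simp add: infsum_at)
qed

text \<open>Two solutions of the same Lyapunov equation differ by such an \<open>X\<close>; evaluated along two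
  impulse responses, it is constant in time and tends to 0.\<close>

lemma lyapunov_unique:
  assumes M: "schur_stable M" and eq: "\<And>x y. x \<bullet> (X *v y) = (M *v x) \<bullet> (X *v (M *v y))"
  shows "X = 0"
proof (rule matrix_eq_inner)
  fix x y
  obtain p where p: "p \<in> l2" "\<And>t. t \<le> 0 \<Longrightarrow> p t = 0" "p 1 = x"
    "\<And>t. t \<noteq> 0 \<Longrightarrow> p (t + 1) = M *v p t" using impulse_response[OF M, of x] by blast
  obtain q where q: "q \<in> l2" "\<And>t. t \<le> 0 \<Longrightarrow> q t = 0" "q 1 = y"
    "\<And>t. t \<noteq> 0 \<Longrightarrow> q (t + 1) = M *v q t" using impulse_response[OF M, of y] by blast
  define \<phi> where "\<phi> t = p t \<bullet> (X *v q t)" for t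
  have s: "\<phi> summable_on UNIV" unfolding \<phi>_def by (intro summable_inner l2_matrix p q)
  have "0 = infsum (\<lambda>t. \<phi> (t + 1) - \<phi> t) UNIV"
    using infsum_telescope[of "\<lambda>t. \<phi> (t + 1) - \<phi> t" "\<lambda>_. 0" \<phi>] s by simp
  also have "(\<lambda>t. \<phi> (t + 1) - \<phi> t) = (\<lambda>t::int. if t = 0 then x \<bullet> (X *v y) else 0)"
    using p(2)[of 0] p(3) q(3) by (auto simp: fun_eq_iff \<phi>_def p(4) q(4) eq[symmetric])
  finally show "x \<bullet> (X *v y) = x \<bullet> (0 *v y)" by (simp add: infsum_at)
qed

lemma lyapunov_symmetric:
  assumes M: "schur_stable M" and W: "transpose W = W"
    and eq: "X = transpose M ** X ** M + W"
  shows "transpose X = X"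
proof -
  have X: "x \<bullet> (X *v y) = (M *v x) \<bullet> (X *v (M *v y)) + x \<bullet> (W *v y)" for x y
    by (subst eq) (simp add: mv_simps inner_add_right inner_transpose)
  have "X - transpose X = 0"
  proof (rule lyapunov_unique[OF M])
    fix x y
    have "y \<bullet> (W *v x) = x \<bullet> (W *v y)" by (metis W inner_commute inner_symmetric)
    moreover have "a \<bullet> (transpose X *v b) = b \<bullet> (X *v a)" for a b
      by (metis inner_transpose inner_commute transpose_transpose)
    ultimately show "x \<bullet> ((X - transpose X) *v y) = (M *v x) \<bullet> ((X - transpose X) *v (M *v y))"
      using X[of x y] X[of y x]
      by (simp add: mv_simps inner_diff_right)
  qed
  then show ?thesis by simp
qed

section \<open>Costs\<close>

lemma ennreal_infsum:
  fixes f :: "'a \<Rightarrow> real"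
  assumes "f summable_on UNIV" "\<And>t. 0 \<le> f t"
  shows "(\<Sum>\<^sub>\<infinity>t. ennreal (f t)) = ennreal (infsum f UNIV)"
  using infsum_nonneg_is_SUPREMUM_ennreal[of f UNIV] assms
  by (simp add: nonneg_infsum_complete)

lemma summable_if_ennreal_infsum_finite:
  fixes f :: "'a \<Rightarrow> real"
  assumes fin: "(\<Sum>\<^sub>\<infinity>t. ennreal (f t)) \<noteq> top" and f: "\<And>t. 0 \<le> f t"
  shows "f summable_on UNIV"
proof (rule nonneg_bdd_above_summable_on[OF f])
  obtain c where c: "(\<Sum>\<^sub>\<infinity>t. ennreal (f t)) = ennreal c" "0 \<le> c" using fin by (cases "\<Sum>\<^sub>\<infinity>t. ennreal (f t)") auto
  show "bdd_above (sum f ` {F. F \<subseteq> UNIV \<and> finite F})"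
  proof (rule bdd_aboveI2)
    fix F :: "'a set" assume F: "F \<in> {F. F \<subseteq> UNIV \<and> finite F}"
    have "ennreal (sum f F) = (\<Sum>t\<in>F. ennreal (f t))" using f by (simp add: sum_ennreal)
    also have "\<dots> \<le> (\<Sum>\<^sub>\<infinity>t. ennreal (f t))"
      using F by (subst nonneg_infsum_complete) (auto intro!: SUP_upper)
    finally show "sum f F \<le> c" using c by simp
  qed
qed

lemma cost_l2:
  assumes Q: "posdef Q" and "x \<in> l2" "u \<in> l2"
  shows "cost Q x u = ennreal (infsum (\<lambda>t. x t \<bullet> (Q *v x t) + u t \<bullet> u t) UNIV)"
  unfolding cost_def
  by (rule ennreal_infsum)
    (use assms in \<open>auto intro!: summable_on_add summable_inner l2_matrix add_nonneg_nonneg posdef_nonneg\<close>)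

lemma mat_sqrt_invertible:
  assumes Q: "posdef Q"
  shows "invertible (mat_sqrt Q)"
proof (rule invertible_if_trivial_kernel)
  fix x assume "mat_sqrt Q *v x = 0"
  then have "Q *v x = 0"
    by (subst mat_sqrt_root(2)[OF Q, symmetric]) (simp flip: matrix_vector_mul_assoc)
  then show "x = 0" using Q by (fastforce simp: posdef_def)
qed

lemma mat_sqrt_square: "posdef Q \<Longrightarrow> mat_sqrt Q *v (mat_sqrt Q *v x) = Q *v x"
  by (simp add: matrix_vector_mul_assoc mat_sqrt_root)

text \<open>Outputs of a strictly causal map may be arbitrary signals; a finite cost puts them into \<open>l2\<close>
  because \<open>Q\<close> is positive definite.\<close>

lemma cost_finite_l2:
  assumes Q: "posdef Q" and fin: "cost Q x u \<noteq> top"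
  shows "x \<in> l2" "u \<in> l2"
proof -
  have nn: "0 \<le> x t \<bullet> (Q *v x t)" "0 \<le> u t \<bullet> u t" for t using posdef_nonneg[OF Q] by auto
  have s: "(\<lambda>t. x t \<bullet> (Q *v x t) + u t \<bullet> u t) summable_on UNIV"
    using fin nn unfolding cost_def by (intro summable_if_ennreal_infsum_finite) auto
  have "(\<lambda>t. u t \<bullet> u t) summable_on UNIV"
    by (rule summable_on_comparison_test[OF s]) (use nn in auto)
  then show "u \<in> l2" by (simp add: l2_def dot_square_norm)
  have "(\<lambda>t. x t \<bullet> (Q *v x t)) summable_on UNIV"
    by (rule summable_on_comparison_test[OF s]) (use nn in auto)
  also have "(\<lambda>t. x t \<bullet> (Q *v x t)) = (\<lambda>t. (norm (mat_sqrt Q *v x t))\<^sup>2)"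
    by (simp add: fun_eq_iff inner_symmetric[OF mat_sqrt_root(1)[OF Q]] mat_sqrt_square[OF Q]
        flip: dot_square_norm)
  finally have "(\<lambda>t. mat_sqrt Q *v x t) \<in> l2" by (simp add: l2_def)
  from l2_matrix[OF this, of "matrix_inv (mat_sqrt Q)"] show "x \<in> l2"
    by (simp add: matrix_inv_cancel[OF mat_sqrt_invertible[OF Q]])
qed

section \<open>The two Riccati equations\<close>

locale lq_system =
  fixes A Q P T :: "real^'n^'n" and Bu :: "real^'p^'n"
  assumes Q: "posdef Q"
    and hyperbolic_A: "hyperbolic A"
    and lqr: "lqr_stabilizing_solution A Bu Q P"
    and filter: "filter_stabilizing_solution A Bu Q T"
begin

abbreviation "S \<equiv> lqr_S Bu P"
abbreviation "K \<equiv> K_lqr A Bu P"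
abbreviation "AK \<equiv> A_K A Bu P"
abbreviation "AT \<equiv> A_T A Q T"
definition "Rf = matrix_inv Q + T"
definition "Ri = matrix_inv Rf"
definition "H = P - transpose AT ** P ** AK"
definition "W = transpose H ** Rf ** H"

lemma sym: "transpose Q = Q" "transpose P = P" "transpose T = T"
  using Q lqr filter by (simp_all add: posdef_def lqr_stabilizing_solution_def filter_stabilizing_solution_def)

lemma schur: "schur_stable AK" "schur_stable AT"
  using lqr filter by (simp_all add: lqr_stabilizing_solution_def filter_stabilizing_solution_def)

lemmas hyperbolic_AK = schur_hyperbolic[OF schur(1)]
lemmas hyperbolic_AT = schur_hyperbolic[OF schur(2)]

lemma S_mult: "S *v u = u + transpose Bu *v (P *v (Bu *v u))"
  by (simp add: lqr_S_def mv_simps)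

lemma S_inv: "S *v (matrix_inv S *v u) = u"
  using lqr by (simp add: lqr_stabilizing_solution_def matrix_inv_cancel)

lemma S_sym: "transpose S = S"
  by (simp add: lqr_S_def transpose_add matrix_transpose_mul sym matrix_mul_assoc)

lemma SK_mult: "S *v (K *v x) = transpose Bu *v (P *v (A *v x))"
  by (simp add: K_lqr_def S_inv flip: matrix_vector_mul_assoc)

lemma AK_mult: "AK *v x = A *v x - Bu *v (K *v x)"
  by (simp add: A_K_def mv_simps)

lemma transpose_K_mult: "transpose K *v (S *v u) = transpose A *v (P *v (Bu *v u))"
proof -
  have "z \<bullet> (transpose K *v (S *v u)) = z \<bullet> (transpose A *v (P *v (Bu *v u)))" for z
  proof -
    have "z \<bullet> (transpose K *v (S *v u)) = (S *v (K *v z)) \<bullet> u"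
      by (metis inner_transpose inner_symmetric[OF S_sym] transpose_transpose)
    also have "\<dots> = z \<bullet> (transpose A *v (P *v (Bu *v u)))"
      by (simp add: SK_mult inner_transpose' sym)
    finally show ?thesis .
  qed
  then show ?thesis using vector_eq_rdot by (metis inner_commute)
qed

lemma riccati_P: "P *v x = transpose A *v (P *v (AK *v x)) + Q *v x"
proof -
  have "P = transpose A ** P ** A + Q - transpose K ** S ** K"
    using lqr by (simp add: lqr_stabilizing_solution_def)
  then have "P *v x = (transpose A ** P ** A + Q - transpose K ** S ** K) *v x" by simp
  then show ?thesis by (simp add: mv_simps transpose_K_mult AK_mult)
qed

text \<open>Orthogonality of the optimal closed loop to the control directions; the cross terms in the
  completed squares come from it.\<close>

lemma BPAK: "transpose Bu *v (P *v (AK *v x)) = K *v x"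
  using SK_mult[of x] S_mult[of "K *v x"] by (simp add: AK_mult mv_simps algebra_simps)

lemma P_pos: "x \<bullet> (P *v x) = (AK *v x) \<bullet> (P *v (AK *v x)) + (K *v x) \<bullet> (K *v x) + x \<bullet> (Q *v x)"
proof -
  have "x \<bullet> (P *v x) = (A *v x) \<bullet> (P *v (AK *v x)) + x \<bullet> (Q *v x)"
    using arg_cong[OF riccati_P[of x], of "(\<bullet>) x"]
    by (simp only: inner_add_right inner_transpose[of x "transpose A"] transpose_transpose)
  also have "A *v x = AK *v x + Bu *v (K *v x)" by (simp add: AK_mult)
  also have "(AK *v x + Bu *v (K *v x)) \<bullet> (P *v (AK *v x))
      = (AK *v x) \<bullet> (P *v (AK *v x)) + (K *v x) \<bullet> (transpose Bu *v (P *v (AK *v x)))"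
    by (simp add: inner_add_left inner_transpose')
  finally show ?thesis by (simp add: BPAK)
qed

lemma posdef_P: "posdef P"
proof -
  have nn: "0 \<le> x \<bullet> (P *v x)" for x
  proof (rule lyapunov_nonneg[OF schur(1)])
    show "(AK *v x) \<bullet> (P *v (AK *v x)) \<le> x \<bullet> (P *v x)" for x
      using P_pos[of x] posdef_nonneg[OF Q, of x] inner_ge_zero[of "K *v x"] by linarith
  qed
  have "0 < x \<bullet> (P *v x)" if "x \<noteq> 0" for x
  proof -
    have "0 < x \<bullet> (Q *v x)" using Q that by (simp add: posdef_def)
    then show ?thesis using P_pos[of x] nn[of "AK *v x"] inner_ge_zero[of "K *v x"] by linarith
  qed
  then show ?thesis by (simp add: posdef_def sym)
qed

lemma Rf_sym: "transpose Rf = Rf"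
  using matrix_inv_symmetric[OF posdef_invertible[OF Q] sym(1)] by (simp add: Rf_def transpose_add sym)

lemma Rf_invertible: "invertible Rf"
  using filter by (simp add: filter_stabilizing_solution_def Rf_def)

lemma Rf_Ri: "Rf *v (Ri *v x) = x" "Ri *v (Rf *v x) = x"
  by (simp_all add: Ri_def matrix_inv_cancel[OF Rf_invertible])

lemma Ri_sym: "transpose Ri = Ri"
  unfolding Ri_def by (rule matrix_inv_symmetric[OF Rf_invertible Rf_sym])

lemma Q_Qinv: "Q *v (matrix_inv Q *v x) = x" "matrix_inv Q *v (Q *v x) = x"
  by (simp_all add: matrix_inv_cancel[OF posdef_invertible[OF Q]])

lemma Rf_mult: "Rf *v x = matrix_inv Q *v x + T *v x"
  by (simp add: Rf_def mv_simps)

lemma AT_mult: "AT *v x = A *v x - A *v (T *v (Ri *v x))"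
  by (simp add: A_T_def mv_simps Ri_def Rf_def)

lemma transpose_AT_mult: "transpose AT *v x = transpose A *v x - Ri *v (T *v (transpose A *v x))"
proof -
  have "transpose AT = transpose A - Ri ** T ** transpose A"
    using Ri_sym by (simp add: A_T_def transpose_diff matrix_transpose_mul sym Ri_def Rf_def matrix_mul_assoc)
  then show ?thesis by (simp add: mv_simps)
qed

text \<open>The filter Riccati equation and the gain \<open>F_bar\<close> are written with square roots of \<open>Q\<close>. Since
  \<open>R_T = Q\<^sup>1\<^sup>/\<^sup>2 (Q\<^sup>-\<^sup>1 + T) Q\<^sup>1\<^sup>/\<^sup>2\<close>, this lemma and the next one remove them.\<close>

lemma sqrt_RT_inv: "mat_sqrt Q *v (matrix_inv (R_T Q T) *v (mat_sqrt Q *v y)) = Ri *v y"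
proof -
  let ?R = "mat_sqrt Q"
  define z where "z = matrix_inv (R_T Q T) *v (?R *v y)"
  have "R_T Q T *v z = ?R *v y"
    using filter by (simp add: z_def filter_stabilizing_solution_def matrix_inv_cancel)
  then have "z + ?R *v (T *v (?R *v z)) = ?R *v y" by (simp add: R_T_def mv_simps)
  then have "?R *v (z + ?R *v (T *v (?R *v z))) = Q *v y" by (simp add: mat_sqrt_square[OF Q])
  then have "?R *v z + Q *v (T *v (?R *v z)) = Q *v y"
    by (simp add: matrix_vector_right_distrib mat_sqrt_square[OF Q])
  then have "matrix_inv Q *v (?R *v z + Q *v (T *v (?R *v z))) = y" by (simp add: Q_Qinv)
  then have "Rf *v (?R *v z) = y" by (simp add: Rf_mult matrix_vector_right_distrib Q_Qinv)
  then show ?thesis using Rf_Ri(2)[of "?R *v z"] by (simp add: z_def)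
qed

lemma inv_sqrt_RT:
  "matrix_inv (mat_sqrt Q) *v (R_T Q T *v (matrix_inv (mat_sqrt Q) *v y)) = Rf *v y"
proof -
  let ?R = "mat_sqrt Q"
  note R = matrix_inv_cancel[OF mat_sqrt_invertible[OF Q]]
  define z where "z = matrix_inv ?R *v y"
  have y: "y = ?R *v z" by (simp add: z_def R)
  have "matrix_inv ?R *v z = matrix_inv Q *v y"
  proof -
    have "z = ?R *v (matrix_inv ?R *v z)" by (simp add: R)
    then have "y = Q *v (matrix_inv ?R *v z)" unfolding y using mat_sqrt_square[OF Q] by metis
    then show ?thesis by (metis Q_Qinv(2))
  qed
  then show ?thesis
    by (simp add: R_T_def mv_simps R Rf_mult flip: z_def) (simp add: y)
qed

lemma riccati_T: "T *v x = A *v (T *v (transpose AT *v x)) + Bu *v (transpose Bu *v x)"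
proof -
  have "T = A ** T ** transpose A + Bu ** transpose Bu
         - A ** T ** mat_sqrt Q ** matrix_inv (R_T Q T) ** mat_sqrt Q ** T ** transpose A"
    using filter by (simp add: filter_stabilizing_solution_def)
  then have "T *v x = (A ** T ** transpose A + Bu ** transpose Bu
         - A ** T ** mat_sqrt Q ** matrix_inv (R_T Q T) ** mat_sqrt Q ** T ** transpose A) *v x" by simp
  then show ?thesis by (simp add: mv_simps sqrt_RT_inv transpose_AT_mult)
qed

text \<open>Dual to positivity of \<open>P\<close>: with \<open>y = A\<^sub>T\<^sup>* x\<close>, the Riccati equation writes \<open>x \<bullet> T x\<close> as
  \<open>y \<bullet> T y\<close> plus a term in \<open>Q\<^sup>-\<^sup>1\<close> plus a term in \<open>B\<^sub>u\<close>.\<close>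

lemma T_nonneg: "0 \<le> x \<bullet> (T *v x)"
proof (rule lyapunov_nonneg[OF schur_transpose[OF schur(2)]])
  fix x
  define y where "y = transpose AT *v x"
  define m where "m = Ri *v (T *v (transpose A *v x))"
  have yA: "transpose A *v x = y + m" by (simp add: y_def m_def transpose_AT_mult)
  have "Rf *v m = T *v (transpose A *v x)" by (simp add: m_def Rf_Ri)
  then have "Rf *v m = T *v (y + m)" unfolding yA .
  then have Ty: "T *v y = matrix_inv Q *v m" by (simp add: Rf_mult mv_simps)
  have "x \<bullet> (T *v x) = (transpose A *v x) \<bullet> (T *v y) + (transpose Bu *v x) \<bullet> (transpose Bu *v x)"
    using arg_cong[OF riccati_T[of x], of "(\<bullet>) x"]
    by (simp only: inner_add_right y_def inner_transpose[of x A] inner_transpose[of x Bu])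
  also have "(transpose A *v x) \<bullet> (T *v y) = y \<bullet> (T *v y) + m \<bullet> (matrix_inv Q *v m)"
    by (simp add: yA inner_add_left) (simp add: Ty)
  finally show "(transpose AT *v x) \<bullet> (T *v (transpose AT *v x)) \<le> x \<bullet> (T *v x)"
    using posdef_nonneg[OF posdef_inv[OF Q], of m] by (simp add: y_def)
qed

lemma posdef_Rf: "posdef Rf"
  using posdef_inv[OF Q] T_nonneg by (auto simp: posdef_def Rf_sym Rf_mult inner_add_right intro: add_pos_nonneg)

lemma posdef_Ri: "posdef Ri"
  unfolding Ri_def by (rule posdef_inv[OF posdef_Rf])

lemma H_mult: "H *v x = P *v x - transpose AT *v (P *v (AK *v x))"
  by (simp add: H_def mv_simps)

lemma transpose_H: "transpose H = P - transpose AK ** P ** AT"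
  by (simp add: H_def transpose_diff matrix_transpose_mul sym matrix_mul_assoc)

text \<open>Links the two Riccati equations. It shows that \<open>H\<close> is invertible, hence that the Gramian
  \<open>\<Pi>b\<close> below has a positive definite source term \<open>W\<close>.\<close>

lemma Rf_H: "Rf *v (H *v x) = x + T *v (P *v x)"
proof -
  have AP: "transpose A *v (P *v (AK *v x)) = P *v x - Q *v x" by (subst (2) riccati_P) simp
  have "H *v x = Q *v x + Ri *v (T *v (P *v x - Q *v x))"
    unfolding H_mult transpose_AT_mult AP by simp
  then have "Rf *v (H *v x) = Rf *v (Q *v x) + T *v (P *v x - Q *v x)"
    by (simp add: matrix_vector_right_distrib Rf_Ri)
  then show ?thesis by (simp add: Rf_mult Q_Qinv mv_simps)
qed

lemma Rf_H_invertible: "invertible (Rf ** H)"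
proof (rule invertible_if_trivial_kernel)
  fix x assume "(Rf ** H) *v x = 0"
  then have "x + T *v (P *v x) = 0" by (simp add: Rf_H flip: matrix_vector_mul_assoc)
  then have "(P *v x) \<bullet> x + (P *v x) \<bullet> (T *v (P *v x)) = 0" by (metis inner_add_right inner_zero_right)
  then have "x \<bullet> (P *v x) \<le> 0" using T_nonneg[of "P *v x"] by (simp add: inner_commute)
  then show "x = 0" using posdef_P by (auto simp: posdef_def not_less[symmetric])
qed

lemma W_mult: "W *v x = transpose H *v (Rf *v (H *v x))"
  by (simp add: W_def flip: matrix_vector_mul_assoc)

lemma posdef_W: "posdef W"
proof -
  have "0 < x \<bullet> (W *v x)" if "x \<noteq> 0" for x
  proof -
    have "H *v x \<noteq> 0"
      using that matrix_inv_cancel(1)[OF Rf_H_invertible, of x] by (auto simp flip: matrix_vector_mul_assoc)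
    then have "0 < (H *v x) \<bullet> (Rf *v (H *v x))" using posdef_Rf by (simp add: posdef_def)
    then show ?thesis by (simp add: W_mult inner_transpose')
  qed
  moreover have "transpose W = W" by (simp add: W_def matrix_transpose_mul Rf_sym matrix_mul_assoc)
  ultimately show ?thesis by (simp add: posdef_def)
qed

end

section \<open>The clairvoyant controller\<close>

lemma l2_adjoint_eq:
  assumes h: "h \<in> l2" and adj: "\<And>f. f \<in> l2 \<Longrightarrow> l2_inner (S f) g = l2_inner f h"
  shows "l2_adjoint S g = h"
  unfolding l2_adjoint_def
proof (rule the_equality)
  fix k assume k: "k \<in> l2 \<and> (\<forall>f\<in>l2. l2_inner (S f) g = l2_inner f k)"
  define f where "f t = k t - h t" for t
  have f: "f \<in> l2" unfolding f_def using k h by (simp add: l2_diff)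
  then have "l2_inner f k = l2_inner f h" using k adj by simp
  moreover have "(\<lambda>t. f t \<bullet> k t + - (f t \<bullet> h t)) = (\<lambda>t. f t \<bullet> f t)"
    by (simp add: fun_eq_iff f_def inner_diff_right)
  then have "infsum (\<lambda>t. f t \<bullet> f t) UNIV = l2_inner f k - l2_inner f h"
    using infsum_add[of "\<lambda>t. f t \<bullet> k t" UNIV "\<lambda>t. - (f t \<bullet> h t)"] f k h
    by (simp add: l2_inner_def summable_inner summable_on_uminus infsum_uminus)
  ultimately have "f = (\<lambda>_. 0)" using l2_eq_0_iff[OF f] by simp
  then show "k = h" by (auto simp: f_def fun_eq_iff)
qed (use h adj in simp)

context lq_system
begin

lemma toeplitz_l2: "f \<in> l2 \<Longrightarrow> toeplitz Q A B f \<in> l2"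
  unfolding toeplitz_def by (intro l2_matrix l2_state hyperbolic_A)

text \<open>Summation by parts: the adjoint of a state recursion is the costate recursion, which runs
  backwards in time.\<close>

lemma toeplitz_adjoint_inner:
  assumes y: "y \<in> l2" and lam: "lam \<in> l2" "\<And>t. lam t = transpose A *v lam (t + 1) + mat_sqrt Q *v y t"
    and f: "f \<in> l2"
  shows "l2_inner (toeplitz Q A Bu f) y = l2_inner f (\<lambda>t. transpose Bu *v lam (t + 1))"
proof -
  let ?x = "l2_state A Bu f"
  note x = l2_state[OF hyperbolic_A f, of Bu]
  show ?thesis unfolding l2_inner_def
  proof (rule infsum_telescope[where \<phi> = "\<lambda>t. - (?x t \<bullet> lam t)"])
    fix t
    have "toeplitz Q A Bu f t \<bullet> y t = ?x t \<bullet> (mat_sqrt Q *v y t)"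
      by (simp add: toeplitz_def inner_symmetric[OF mat_sqrt_root(1)[OF Q]])
    also have "mat_sqrt Q *v y t = lam t - transpose A *v lam (t + 1)" by (simp add: lam(2)[of t])
    also have "?x t \<bullet> (lam t - transpose A *v lam (t + 1)) = ?x t \<bullet> lam t - (A *v ?x t) \<bullet> lam (t + 1)"
      by (simp add: inner_diff_right inner_transpose')
    also have "A *v ?x t = ?x (t + 1) - Bu *v f t" by (simp add: x(2))
    finally show "toeplitz Q A Bu f t \<bullet> y t = f t \<bullet> (transpose Bu *v lam (t + 1))
        + (- (?x (t + 1) \<bullet> lam (t + 1)) - - (?x t \<bullet> lam t))"
      by (simp add: inner_diff_left inner_transpose')
  qed (intro summable_inner l2_intros f lam, simp add: summable_on_uminus summable_inner lam(1) x(1))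
qed

lemma toeplitz_adjoint:
  assumes y: "y \<in> l2" and lam: "lam \<in> l2" "\<And>t. lam t = transpose A *v lam (t + 1) + mat_sqrt Q *v y t"
  shows "l2_adjoint (toeplitz Q A Bu) y = (\<lambda>t. transpose Bu *v lam (t + 1))"
  by (rule l2_adjoint_eq) (auto intro!: l2_intros toeplitz_adjoint_inner assms)

text \<open>\<open>I + F\<^sup>* F\<close> is positive definite.\<close>

lemma normal_operator_injective:
  "inj_on (\<lambda>u t. u t + l2_adjoint (toeplitz Q A Bu) (toeplitz Q A Bu u) t) l2"
proof (rule inj_onI)
  let ?F = "toeplitz Q A Bu"
  fix u v assume uv: "u \<in> l2" "v \<in> l2"
    and eq: "(\<lambda>t. u t + l2_adjoint ?F (?F u) t) = (\<lambda>t. v t + l2_adjoint ?F (?F v) t)"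
  define e where "e t = u t - v t" for t
  have e: "e \<in> l2" unfolding e_def by (intro l2_diff uv)
  have "?F u t = ?F v t + ?F e t" for t
  proof -
    have "l2_state A Bu u t = l2_state A Bu (\<lambda>i. v i + e i) t" by (simp add: e_def)
    then show ?thesis
      by (simp add: toeplitz_def l2_state_add[OF hyperbolic_A uv(2) e] matrix_vector_right_distrib)
  qed
  then have Fe: "?F e t = ?F u t - ?F v t" for t by simp
  obtain lam where lam: "lam \<in> l2" "\<And>t. lam t = transpose A *v lam (t + 1) + mat_sqrt Q *v ?F u t"
    using backward_solution[OF hyperbolic_transpose[OF hyperbolic_A] l2_matrix[OF toeplitz_l2[OF uv(1)]]] by metis
  obtain mu where mu: "mu \<in> l2" "\<And>t. mu t = transpose A *v mu (t + 1) + mat_sqrt Q *v ?F v t"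
    using backward_solution[OF hyperbolic_transpose[OF hyperbolic_A] l2_matrix[OF toeplitz_l2[OF uv(2)]]] by metis
  have "e t + (transpose Bu *v lam (t + 1) - transpose Bu *v mu (t + 1)) = 0" for t
    using fun_cong[OF eq, of t]
    by (simp add: toeplitz_adjoint[OF toeplitz_l2[OF uv(1)] lam] toeplitz_adjoint[OF toeplitz_l2[OF uv(2)] mu]
        e_def algebra_simps)
  then have "e t \<bullet> (e t + (transpose Bu *v lam (t + 1) - transpose Bu *v mu (t + 1))) = 0" for t
    by simp
  then have "(\<lambda>t. e t \<bullet> e t) = (\<lambda>t. - (e t \<bullet> (transpose Bu *v lam (t + 1)))
      + e t \<bullet> (transpose Bu *v mu (t + 1)))"
    by (simp add: fun_eq_iff inner_add_right inner_diff_right algebra_simps)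
  then have "infsum (\<lambda>t. e t \<bullet> e t) UNIV = - l2_inner (?F e) (?F u) + l2_inner (?F e) (?F v)"
    using infsum_add[of "\<lambda>t. - (e t \<bullet> (transpose Bu *v lam (t + 1)))" UNIV "\<lambda>t. e t \<bullet> (transpose Bu *v mu (t + 1))"]
    by (simp add: toeplitz_adjoint_inner[OF toeplitz_l2[OF uv(1)] lam e, unfolded l2_inner_def]
        toeplitz_adjoint_inner[OF toeplitz_l2[OF uv(2)] mu e, unfolded l2_inner_def] l2_inner_def summable_on_uminus
        summable_inner l2_intros e lam(1) mu(1) infsum_uminus)
  also have "\<dots> = - l2_inner (?F e) (?F e)"
    using infsum_add[of "\<lambda>t. ?F e t \<bullet> ?F u t" UNIV "\<lambda>t. - (?F e t \<bullet> ?F v t)"]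
    by (simp add: l2_inner_def Fe[of t for t] inner_diff_right summable_on_uminus summable_inner
        l2_intros toeplitz_l2 uv e infsum_uminus)
  also have "\<dots> \<le> 0" by (simp add: l2_inner_def infsum_nonneg)
  finally have "infsum (\<lambda>t. e t \<bullet> e t) UNIV = 0" by (simp add: antisym infsum_nonneg)
  then have "e = (\<lambda>_. 0)" using l2_eq_0_iff[OF e] by simp
  then show "u = v" by (auto simp: e_def fun_eq_iff)
qed

text \<open>The normal equation \<open>u + F\<^sup>* (F u + G w) = 0\<close>, written with state \<open>x\<close> and costate \<open>lam\<close>, is the
  system of optimality conditions assumed here. The operators \<open>F\<close> and \<open>G\<close> are applied separately,
  each producing its own, possibly non-causal, \<open>l2\<close> state; only the sum is \<open>x\<close>.\<close>

lemma clairvoyant_eq: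
  assumes w: "w \<in> l2" and x: "x \<in> l2" "\<And>t. x (t + 1) = A *v x t + Bu *v u t + Bw *v w t"
    and u: "u \<in> l2" "\<And>t. u t = - (transpose Bu *v lam (t + 1))"
    and lam: "lam \<in> l2" "\<And>t. lam t = transpose A *v lam (t + 1) + Q *v x t"
  shows "clairvoyant A Bu Bw Q w = u" "(\<lambda>t. l2_state A Bu u t + l2_state A Bw w t) = x"
proof -
  let ?F = "toeplitz Q A Bu" and ?G = "toeplitz Q A Bw"
  have sum: "l2_state A Bu u t + l2_state A Bw w t = x t" for t
  proof -
    have "l2_state A Bu u t + l2_state A Bw w t - x t = 0"
      by (rule forward_zero[OF hyperbolic_A])
        (auto intro!: l2_intros l2_state hyperbolic_A w u x
          simp: l2_state(2)[OF hyperbolic_A u(1)] l2_state(2)[OF hyperbolic_A w] x(2) mv_simps)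
    then show ?thesis by simp
  qed
  then show "(\<lambda>t. l2_state A Bu u t + l2_state A Bw w t) = x" by (simp add: fun_eq_iff)
  define v where "v t = - u t" for t
  have v: "v \<in> l2" unfolding v_def by (rule l2_minus[OF u(1)])
  have Fv: "?F v t = - ?F u t" for t
  proof -
    have "v = (\<lambda>i. (- 1) *\<^sub>R u i)" by (simp add: v_def fun_eq_iff)
    then have "l2_state A Bu v t = l2_state A Bu (\<lambda>i. (- 1) *\<^sub>R u i) t" by simp
    also have "\<dots> = - l2_state A Bu u t" by (subst l2_state_scaleR[OF hyperbolic_A u(1)]) simp
    finally show ?thesis
      by (simp add: toeplitz_def matrix_vector_mult_minus)
  qed
  obtain mu where mu: "mu \<in> l2" "\<And>t. mu t = transpose A *v mu (t + 1) + mat_sqrt Q *v ?F v t"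
    using backward_solution[OF hyperbolic_transpose[OF hyperbolic_A] l2_matrix[OF toeplitz_l2[OF v]]] by metis
  define nu where "nu t = lam t + mu t" for t
  have nu: "nu \<in> l2" unfolding nu_def by (intro l2_add lam mu)
  have "nu t = transpose A *v nu (t + 1) + mat_sqrt Q *v ?G w t" for t
  proof -
    have "Q *v x t = mat_sqrt Q *v ?F u t + mat_sqrt Q *v ?G w t"
      by (simp add: toeplitz_def mat_sqrt_square[OF Q] flip: sum matrix_vector_right_distrib)
    moreover have "mat_sqrt Q *v ?F v t = - (mat_sqrt Q *v ?F u t)"
      by (simp add: Fv matrix_vector_mult_minus)
    ultimately show ?thesis using lam(2)[of t] mu(2)[of t]
      by (simp add: nu_def matrix_vector_right_distrib)
  qed
  note adjG = toeplitz_adjoint[OF toeplitz_l2[OF w] nu this]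
  note adjF = toeplitz_adjoint[OF toeplitz_l2[OF v] mu]
  have "(\<lambda>t. v t + l2_adjoint ?F (?F v) t) = l2_adjoint ?F (?G w)"
    by (simp add: adjG adjF fun_eq_iff v_def u(2) nu_def matrix_vector_right_distrib)
  then have "inv_into l2 (\<lambda>u t. u t + l2_adjoint ?F (?F u) t) (l2_adjoint ?F (?G w)) = v"
    by (intro inv_into_f_eq normal_operator_injective v)
  then show "clairvoyant A Bu Bw Q w = u" by (simp add: clairvoyant_def v_def)
qed

text \<open>Solves the optimality conditions. The Riccati matrix \<open>P\<close> decouples them in the form
  \<open>lam\<^sub>t = P x\<^sub>t + A\<^sub>K\<^sup>* g\<^sub>t\<close>: first \<open>g\<close> is computed backwards, then \<open>x\<close> forwards. The filter matrix \<open>T\<close>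
  decouples them the other way round, \<open>s\<^sub>t = x\<^sub>t + T lam\<^sub>t\<close> being computed forwards, and this
  expresses the cost by \<open>s\<close>.\<close>

lemma optimal_response:
  assumes d: "d \<in> l2" and g: "g \<in> l2" "\<And>t. g t = P *v d t + transpose AK *v g (t + 1)"
    and s: "s \<in> l2" "\<And>t. s (t + 1) = AT *v s t + d t"
  obtains x u lam where "x \<in> l2" "u \<in> l2" "lam \<in> l2"
    "\<And>t. x (t + 1) = A *v x t + Bu *v u t + d t"
    "\<And>t. S *v (u t + K *v x t) = - (transpose Bu *v g t)"
    "\<And>t. u t = - (transpose Bu *v lam (t + 1))"
    "\<And>t. lam t = transpose A *v lam (t + 1) + Q *v x t"
    "infsum (\<lambda>t. x t \<bullet> (Q *v x t) + u t \<bullet> u t) UNIV = infsum (\<lambda>t. s t \<bullet> (Ri *v s t)) UNIV"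
proof -
  define k where "k t = matrix_inv S *v (transpose Bu *v g t)" for t
  have k: "k \<in> l2" unfolding k_def by (intro l2_intros g)
  have Sk: "S *v k t = transpose Bu *v g t" for t by (simp add: k_def S_inv)
  have dk: "(\<lambda>t. d t - Bu *v k t) \<in> l2" by (intro l2_intros d k)
  obtain x where x: "x \<in> l2" "\<And>t. x (t + 1) = AK *v x t + (d t - Bu *v k t)"
    by (rule forward_solution[OF hyperbolic_AK dk]) (rule that)
  define u where "u t = - (K *v x t) - k t" for t
  define lam where "lam t = P *v x t + transpose AK *v g t" for t
  have u: "u \<in> l2" unfolding u_def by (intro l2_intros x k)
  have lam: "lam \<in> l2" unfolding lam_def by (intro l2_intros x g)
  have xu: "x (t + 1) = A *v x t + Bu *v u t + d t" for t
    by (simp add: x(2) u_def AK_mult mv_simps matrix_vector_mult_minus)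
  have Su: "S *v (u t + K *v x t) = - (transpose Bu *v g t)" for t
    by (simp add: u_def matrix_vector_mult_minus Sk)
  have lam1: "lam (t + 1) = P *v (A *v x t + Bu *v u t) + g t" for t
    by (simp add: lam_def xu mv_simps g(2)[of t])
  have ulam: "u t = - (transpose Bu *v lam (t + 1))" for t
  proof -
    have "S *v u t + S *v (K *v x t) + transpose Bu *v g t = 0"
      using Su[of t] by (simp add: matrix_vector_right_distrib)
    then have "u t + (transpose Bu *v (P *v (A *v x t)) + transpose Bu *v (P *v (Bu *v u t))
        + transpose Bu *v g t) = 0"
      by (simp add: S_mult[of "u t"] SK_mult algebra_simps)
    then have "u t + transpose Bu *v lam (t + 1) = 0" by (simp add: lam1 mv_simps)
    then show ?thesis by (simp add: eq_neg_iff_add_eq_0)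
  qed
  have lamA: "lam t = transpose A *v lam (t + 1) + Q *v x t" for t
  proof -
    have "transpose AK *v g t = transpose A *v g t - transpose A *v (P *v (Bu *v k t))"
    proof -
      have "transpose AK *v g t = transpose A *v g t - transpose K *v (transpose Bu *v g t)"
        by (simp add: A_K_def transpose_diff matrix_transpose_mul mv_simps)
      then show ?thesis by (simp add: transpose_K_mult flip: Sk)
    qed
    moreover have "transpose A *v lam (t + 1) = transpose A *v (P *v (AK *v x t)) 
        - transpose A *v (P *v (Bu *v k t)) + transpose A *v g t"
      by (simp add: lam1 u_def AK_mult mv_simps matrix_vector_mult_minus)
    ultimately show ?thesis using riccati_P[of "x t"] by (simp add: lam_def)
  qed
  have smoother: "Ri *v (x t + T *v lam t) = lam t - transpose AT *v lam (t + 1)" for t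
  proof -
    have "lam t - transpose AT *v lam (t + 1) = Q *v x t + Ri *v (T *v (lam t - Q *v x t))"
      using lamA[of t] by (simp add: transpose_AT_mult)
    then have "Rf *v (lam t - transpose AT *v lam (t + 1))
        = Rf *v (Q *v x t) + T *v (lam t - Q *v x t)"
      by (simp add: matrix_vector_right_distrib Rf_Ri)
    then have "Rf *v (lam t - transpose AT *v lam (t + 1)) = x t + T *v lam t"
      by (simp add: Rf_mult[of "Q *v x t"] Q_Qinv mv_simps)
    then show ?thesis by (metis Rf_Ri(2))
  qed
  have s_eq: "s t = x t + T *v lam t" for t
  proof -
    define r where "r t = x t + T *v lam t" for t
    have r: "r \<in> l2" unfolding r_def by (intro l2_intros x lam)
    have "r (t + 1) = AT *v r t + d t" for t
    proof -
      have "r (t + 1) = A *v x t + d t - Bu *v (transpose Bu *v lam (t + 1)) + T *v lam (t + 1)"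
        by (simp add: r_def xu ulam matrix_vector_mult_minus)
      also have "\<dots> = A *v x t + d t + A *v (T *v (transpose AT *v lam (t + 1)))"
        by (simp add: riccati_T[of "lam (t + 1)"])
      also have "\<dots> = AT *v r t + d t"
        by (simp add: AT_mult r_def smoother) (simp add: mv_simps)
      finally show ?thesis .
    qed
    then have "s t - r t = 0"
      by (intro forward_zero[OF hyperbolic_AT l2_diff[OF s(1) r]]) (simp add: s(2) mv_simps)
    then show ?thesis by (simp add: r_def)
  qed
  \<comment> \<open>two summations by parts, first against the state and then against the filter state\<close>
  have "infsum (\<lambda>t. x t \<bullet> (Q *v x t) + u t \<bullet> u t) UNIV = infsum (\<lambda>t. d t \<bullet> lam (t + 1)) UNIV"
  proof (rule infsum_telescope[where \<phi> = "\<lambda>t. - (x t \<bullet> lam t)"])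
    fix t
    have "x t \<bullet> (Q *v x t) = x t \<bullet> lam t - (A *v x t) \<bullet> lam (t + 1)"
      using lamA[of t] by (simp add: inner_add_right inner_transpose')
    moreover have "u t \<bullet> u t = - ((Bu *v u t) \<bullet> lam (t + 1))"
      by (subst (2) ulam) (simp add: inner_transpose')
    moreover have "x (t + 1) \<bullet> lam (t + 1) = (A *v x t + Bu *v u t + d t) \<bullet> lam (t + 1)" by (simp add: xu)
    ultimately show "x t \<bullet> (Q *v x t) + u t \<bullet> u t
        = d t \<bullet> lam (t + 1) + (- (x (t + 1) \<bullet> lam (t + 1)) - - (x t \<bullet> lam t))"
      by (simp add: inner_add_left)
  qed (intro summable_inner l2_intros d lam, simp add: summable_on_uminus summable_inner lam(1) x(1))
  also have "\<dots> = infsum (\<lambda>t. s t \<bullet> (Ri *v s t)) UNIV"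
  proof (rule infsum_telescope[where \<phi> = "\<lambda>t. s t \<bullet> lam t"])
    fix t
    have Ris: "Ri *v s t = lam t - transpose AT *v lam (t + 1)" by (simp only: s_eq smoother)
    have "d t = s (t + 1) - AT *v s t" by (simp add: s(2))
    then show "d t \<bullet> lam (t + 1) = s t \<bullet> (Ri *v s t) + (s (t + 1) \<bullet> lam (t + 1) - s t \<bullet> lam t)"
      by (simp add: Ris inner_diff inner_transpose')
  qed (intro summable_inner l2_intros s lam)+
  finally show ?thesis using that[OF x(1) u lam xu Su ulam lamA] by blast
qed

text \<open>Deviations \<open>e\<close>, \<open>f\<close> of state and control from the optimal ones obey the recursion without
  disturbance. The cross terms telescope with \<open>e \<bullet> lam\<close>, by optimality, and the quadratic terms
  with \<open>e \<bullet> P e\<close>, by the Riccati equation, leaving the square of \<open>S (f + K e) = v\<close>.\<close>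

lemma cost_identity:
  assumes d: "d \<in> l2" and g: "g \<in> l2" "\<And>t. g t = P *v d t + transpose AK *v g (t + 1)"
    and s: "s \<in> l2" "\<And>t. s (t + 1) = AT *v s t + d t"
    and x: "x \<in> l2" "\<And>t. x (t + 1) = A *v x t + Bu *v u t + d t" and u: "u \<in> l2"
    and v: "\<And>t. v t = S *v (u t + K *v x t) + transpose Bu *v g t"
  shows "infsum (\<lambda>t. x t \<bullet> (Q *v x t) + u t \<bullet> u t) UNIV
    = infsum (\<lambda>t. s t \<bullet> (Ri *v s t)) UNIV + infsum (\<lambda>t. v t \<bullet> (matrix_inv S *v v t)) UNIV"
proof -
  obtain y r lam where y: "y \<in> l2" and r: "r \<in> l2" and lam: "lam \<in> l2"
    and yr: "\<And>t. y (t + 1) = A *v y t + Bu *v r t + d t"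
    and Sr: "\<And>t. S *v (r t + K *v y t) = - (transpose Bu *v g t)"
    and rlam: "\<And>t. r t = - (transpose Bu *v lam (t + 1))"
    and lamA: "\<And>t. lam t = transpose A *v lam (t + 1) + Q *v y t"
    and cost: "infsum (\<lambda>t. y t \<bullet> (Q *v y t) + r t \<bullet> r t) UNIV = infsum (\<lambda>t. s t \<bullet> (Ri *v s t)) UNIV"
    by (rule optimal_response[OF d g s]) (rule that)
  define e where "e t = x t - y t" for t
  define f where "f t = u t - r t" for t
  have e: "e \<in> l2" unfolding e_def by (intro l2_diff x y)
  have vl2: "v \<in> l2" unfolding v by (intro l2_intros u x g)
  have xe: "x t = y t + e t" and uf: "u t = r t + f t" for t by (simp_all add: e_def f_def)
  have ef: "e (t + 1) = A *v e t + Bu *v f t" for t by (simp add: e_def f_def x(2) yr mv_simps)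
  have vf: "v t = S *v (f t + K *v e t)" for t
    using Sr[of t] by (simp add: v e_def f_def mv_simps algebra_simps)
  have "infsum (\<lambda>t. x t \<bullet> (Q *v x t) + u t \<bullet> u t) UNIV
    = infsum (\<lambda>t. (y t \<bullet> (Q *v y t) + r t \<bullet> r t) + v t \<bullet> (matrix_inv S *v v t)) UNIV"
  proof (rule infsum_telescope[where \<phi> = "\<lambda>t. - (2 * (e t \<bullet> lam t) + e t \<bullet> (P *v e t))"])
    fix t
    have cross: "e t \<bullet> (Q *v y t) + f t \<bullet> r t = e t \<bullet> lam t - e (t + 1) \<bullet> lam (t + 1)"
    proof -
      have "e t \<bullet> (Q *v y t) = e t \<bullet> lam t - (A *v e t) \<bullet> lam (t + 1)"
        using lamA[of t] by (simp add: inner_add_right inner_transpose')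
      moreover have "f t \<bullet> r t = - ((Bu *v f t) \<bullet> lam (t + 1))"
        by (simp add: rlam inner_transpose')
      ultimately show ?thesis by (simp add: ef inner_add_left)
    qed
    have square: "e t \<bullet> (Q *v e t) + f t \<bullet> f t
        = v t \<bullet> (matrix_inv S *v v t) + e t \<bullet> (P *v e t) - e (t + 1) \<bullet> (P *v e (t + 1))"
    proof -
      define a where "a = f t + K *v e t"
      have fa: "f t = a - K *v e t" by (simp add: a_def)
      have e1: "e (t + 1) = AK *v e t + Bu *v a" by (simp add: ef fa AK_mult mv_simps)
      have c1: "(Bu *v a) \<bullet> (P *v (AK *v e t)) = a \<bullet> (K *v e t)"
        by (simp add: inner_transpose' BPAK)
      have c2: "(AK *v e t) \<bullet> (P *v (Bu *v a)) = a \<bullet> (K *v e t)"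
        using c1 inner_symmetric[OF sym(2), of "AK *v e t" "Bu *v a"] by (simp add: inner_commute)
      have c3: "(Bu *v a) \<bullet> (P *v (Bu *v a)) = a \<bullet> (S *v a) - a \<bullet> a"
        by (simp add: S_mult inner_add_right inner_transpose')
      have "v t \<bullet> (matrix_inv S *v v t) = a \<bullet> (S *v a)"
      proof -
        have "v t = S *v a" by (simp add: vf a_def)
        then have "v t \<bullet> (matrix_inv S *v v t) = a \<bullet> (S *v (matrix_inv S *v (S *v a)))"
          by (simp add: inner_symmetric[OF S_sym])
        then show ?thesis by (simp only: S_inv)
      qed
      moreover have "e (t + 1) \<bullet> (P *v e (t + 1)) = (AK *v e t) \<bullet> (P *v (AK *v e t))
          + 2 * (a \<bullet> (K *v e t)) + a \<bullet> (S *v a) - a \<bullet> a"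
        by (simp add: e1 mv_simps inner_add c1 c2 c3)
      moreover have "f t \<bullet> f t = a \<bullet> a - 2 * (a \<bullet> (K *v e t)) + (K *v e t) \<bullet> (K *v e t)"
        by (simp add: fa inner_diff inner_commute)
      ultimately show ?thesis using P_pos[of "e t"] by simp
    qed
    have "x t \<bullet> (Q *v x t) + u t \<bullet> u t = y t \<bullet> (Q *v y t) + r t \<bullet> r t
        + 2 * (e t \<bullet> (Q *v y t) + f t \<bullet> r t) + (e t \<bullet> (Q *v e t) + f t \<bullet> f t)"
      using inner_symmetric[OF sym(1), of "y t" "e t"]
      by (simp add: xe uf mv_simps inner_add inner_commute algebra_simps)
    then show "x t \<bullet> (Q *v x t) + u t \<bullet> u t = (y t \<bullet> (Q *v y t) + r t \<bullet> r t) + v t \<bullet> (matrix_inv S *v v t)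
        + (- (2 * (e (t + 1) \<bullet> lam (t + 1)) + e (t + 1) \<bullet> (P *v e (t + 1)))
          - - (2 * (e t \<bullet> lam t) + e t \<bullet> (P *v e t)))"
      unfolding cross square by simp
  next
    show "(\<lambda>t. (y t \<bullet> (Q *v y t) + r t \<bullet> r t) + v t \<bullet> (matrix_inv S *v v t)) summable_on UNIV"
      by (intro summable_on_add summable_inner l2_intros y r vl2)
    show "(\<lambda>t. - (2 * (e t \<bullet> lam t) + e t \<bullet> (P *v e t))) summable_on UNIV"
      unfolding summable_on_uminus
      by (intro summable_on_add summable_on_cmult_right summable_inner l2_intros e lam)
  qed
  also have "\<dots> = infsum (\<lambda>t. y t \<bullet> (Q *v y t) + r t \<bullet> r t) UNIV
      + infsum (\<lambda>t. v t \<bullet> (matrix_inv S *v v t)) UNIV"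
    by (intro infsum_add summable_on_add summable_inner l2_intros y r vl2)
  finally show ?thesis by (simp add: cost)
qed

lemma clairvoyant_cost_eq:
  assumes w: "w \<in> l2" and s: "s \<in> l2" "\<And>t. s (t + 1) = AT *v s t + Bw *v w t"
  shows "clairvoyant_cost A Bu Bw Q w = ennreal (infsum (\<lambda>t. s t \<bullet> (Ri *v s t)) UNIV)"
proof -
  have d: "(\<lambda>t. Bw *v w t) \<in> l2" by (rule l2_matrix[OF w])
  obtain g where g: "g \<in> l2" "\<And>t. g t = transpose AK *v g (t + 1) + P *v (Bw *v w t)"
    using backward_solution[OF hyperbolic_transpose[OF hyperbolic_AK] l2_matrix[OF d]] by metis
  have g': "g t = P *v (Bw *v w t) + transpose AK *v g (t + 1)" for t using g(2)[of t] by simp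
  obtain x u lam where x: "x \<in> l2" and u: "u \<in> l2" and lam: "lam \<in> l2"
    and xu: "\<And>t. x (t + 1) = A *v x t + Bu *v u t + Bw *v w t"
    and "\<And>t. S *v (u t + K *v x t) = - (transpose Bu *v g t)"
    and ulam: "\<And>t. u t = - (transpose Bu *v lam (t + 1))"
    and lamA: "\<And>t. lam t = transpose A *v lam (t + 1) + Q *v x t"
    and cost: "infsum (\<lambda>t. x t \<bullet> (Q *v x t) + u t \<bullet> u t) UNIV = infsum (\<lambda>t. s t \<bullet> (Ri *v s t)) UNIV"
    by (rule optimal_response[OF d g(1) g' s]) (rule that)
  show ?thesis
    unfolding clairvoyant_cost_def Let_def clairvoyant_eq[OF w x xu u ulam lam lamA]
    by (simp add: cost_l2[OF Q x u] cost)
qed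

end

section \<open>Strictly causal stable systems\<close>

text \<open>The inputs fed to the state recursions below may use the present value of \<open>w\<close>; the recursion
  itself then adds the delay that makes the result strictly causal.\<close>

definition causal_map :: "((int \<Rightarrow> 'a::real_normed_vector) \<Rightarrow> int \<Rightarrow> 'b::real_normed_vector) \<Rightarrow> bool" where
  "causal_map Y \<longleftrightarrow>
     (\<forall>w\<in>l2. Y w \<in> l2) \<and>
     (\<forall>v\<in>l2. \<forall>w\<in>l2. \<forall>t. Y (\<lambda>i. v i + w i) t = Y v t + Y w t) \<and>
     (\<forall>w\<in>l2. \<forall>c t. Y (\<lambda>i. c *\<^sub>R w i) t = c *\<^sub>R Y w t) \<and>
     (\<forall>v\<in>l2. \<forall>w\<in>l2. \<forall>t. (\<forall>i\<le>t. v i = w i) \<longrightarrow> Y v t = Y w t)"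

lemma causal_mapI:
  assumes "\<And>w. w \<in> l2 \<Longrightarrow> Y w \<in> l2"
    and "\<And>v w t. v \<in> l2 \<Longrightarrow> w \<in> l2 \<Longrightarrow> Y (\<lambda>i. v i + w i) t = Y v t + Y w t"
    and "\<And>w c t. w \<in> l2 \<Longrightarrow> Y (\<lambda>i. c *\<^sub>R w i) t = c *\<^sub>R Y w t"
    and "\<And>v w t. v \<in> l2 \<Longrightarrow> w \<in> l2 \<Longrightarrow> (\<And>i. i \<le> t \<Longrightarrow> v i = w i) \<Longrightarrow> Y v t = Y w t"
  shows "causal_map Y"
  unfolding causal_map_def using assms by blast

lemma causal_mapD:
  assumes "causal_map Y"
  shows "w \<in> l2 \<Longrightarrow> Y w \<in> l2"
    and "v \<in> l2 \<Longrightarrow> w \<in> l2 \<Longrightarrow> Y (\<lambda>i. v i + w i) t = Y v t + Y w t"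
    and "w \<in> l2 \<Longrightarrow> Y (\<lambda>i. c *\<^sub>R w i) t = c *\<^sub>R Y w t"
    and "v \<in> l2 \<Longrightarrow> w \<in> l2 \<Longrightarrow> (\<And>i. i \<le> t \<Longrightarrow> v i = w i) \<Longrightarrow> Y v t = Y w t"
  using assms unfolding causal_map_def by blast+

lemma strictly_causalI:
  assumes "\<And>v w t. v \<in> l2 \<Longrightarrow> w \<in> l2 \<Longrightarrow> Y (\<lambda>i. v i + w i) t = Y v t + Y w t"
    and "\<And>w c t. w \<in> l2 \<Longrightarrow> Y (\<lambda>i. c *\<^sub>R w i) t = c *\<^sub>R Y w t"
    and "\<And>v w t. v \<in> l2 \<Longrightarrow> w \<in> l2 \<Longrightarrow> (\<And>i. i < t \<Longrightarrow> v i = w i) \<Longrightarrow> Y v t = Y w t"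
  shows "strictly_causal Y"
  unfolding strictly_causal_def using assms by blast

lemma strictly_causalD:
  assumes "strictly_causal Y"
  shows "v \<in> l2 \<Longrightarrow> w \<in> l2 \<Longrightarrow> Y (\<lambda>i. v i + w i) t = Y v t + Y w t"
    and "w \<in> l2 \<Longrightarrow> Y (\<lambda>i. c *\<^sub>R w i) t = c *\<^sub>R Y w t"
    and "v \<in> l2 \<Longrightarrow> w \<in> l2 \<Longrightarrow> (\<And>i. i < t \<Longrightarrow> v i = w i) \<Longrightarrow> Y v t = Y w t"
  using assms unfolding strictly_causal_def by blast+

lemma causal_map_id: "causal_map (\<lambda>w. w)"
  by (rule causal_mapI) simp_all

lemma causal_map_matrix:
  fixes M :: "real^'n^'m" and Y :: "(int \<Rightarrow> 'a::real_normed_vector) \<Rightarrow> int \<Rightarrow> real^'n"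
  assumes "causal_map Y"
  shows "causal_map (\<lambda>w t. M *v Y w t)"
proof (rule causal_mapI)
  fix v w :: "int \<Rightarrow> 'a" and t assume "v \<in> l2" "w \<in> l2" "\<And>i. i \<le> t \<Longrightarrow> v i = w i"
  then show "M *v Y v t = M *v Y w t"
    using causal_mapD(4)[OF assms, of v w t] by simp
qed (simp_all add: l2_matrix causal_mapD(1-3)[OF assms] matrix_vector_right_distrib
      matrix_vector_mult_scaleR)

lemma causal_map_add:
  fixes Y Z :: "(int \<Rightarrow> 'a::real_normed_vector) \<Rightarrow> int \<Rightarrow> 'b::real_normed_vector"
  assumes "causal_map Y" "causal_map Z"
  shows "causal_map (\<lambda>w t. Y w t + Z w t)"
proof (rule causal_mapI)
  fix v w :: "int \<Rightarrow> 'a" and t assume "v \<in> l2" "w \<in> l2" "\<And>i. i \<le> t \<Longrightarrow> v i = w i"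
  then show "Y v t + Z v t = Y w t + Z w t"
    using causal_mapD(4)[OF assms(1), of v w t] causal_mapD(4)[OF assms(2), of v w t] by simp
qed (simp_all add: l2_add causal_mapD(1-3)[OF assms(1)] causal_mapD(1-3)[OF assms(2)] scaleR_add_right)

lemma causal_map_diff:
  fixes Y Z :: "(int \<Rightarrow> 'a::real_normed_vector) \<Rightarrow> int \<Rightarrow> 'b::real_normed_vector"
  assumes "causal_map Y" "causal_map Z"
  shows "causal_map (\<lambda>w t. Y w t - Z w t)"
proof (rule causal_mapI)
  fix v w :: "int \<Rightarrow> 'a" and t assume "v \<in> l2" "w \<in> l2" "\<And>i. i \<le> t \<Longrightarrow> v i = w i"
  then show "Y v t - Z v t = Y w t - Z w t"
    using causal_mapD(4)[OF assms(1), of v w t] causal_mapD(4)[OF assms(2), of v w t] by simp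
qed (simp_all add: l2_diff causal_mapD(1-3)[OF assms(1)] causal_mapD(1-3)[OF assms(2)] scaleR_diff_right)

text \<open>The last statement covers the correction state, which is driven by the filter state one step
  ahead; that is still a function of the disturbances up to the present.\<close>

lemma causal_map_state:
  fixes Y :: "(int \<Rightarrow> 'a::real_normed_vector) \<Rightarrow> int \<Rightarrow> real^'m" and B :: "real^'m^'n"
  assumes M: "schur_stable M" and Y: "causal_map Y"
  shows "strictly_causal (\<lambda>w. l2_state M B (Y w))"
    and "causal_map (\<lambda>w. l2_state M B (Y w))"
    and "causal_map (\<lambda>w t. l2_state M B (Y w) (t + 1))"
proof -
  note h = schur_hyperbolic[OF M]
  have l2: "Y w \<in> l2" if "w \<in> l2" for w using causal_mapD(1)[OF Y that] .
  have add: "l2_state M B (Y (\<lambda>i. v i + w i)) t = l2_state M B (Y v) t + l2_state M B (Y w) t"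
    if "v \<in> l2" "w \<in> l2" for v w t
  proof -
    have "Y (\<lambda>i. v i + w i) = (\<lambda>t. Y v t + Y w t)" using causal_mapD(2)[OF Y that] by (simp add: fun_eq_iff)
    then show ?thesis using l2_state_add[OF h l2[OF that(1)] l2[OF that(2)]] by simp
  qed
  have scale: "l2_state M B (Y (\<lambda>i. c *\<^sub>R w i)) t = c *\<^sub>R l2_state M B (Y w) t"
    if "w \<in> l2" for w c t
  proof -
    have "Y (\<lambda>i. c *\<^sub>R w i) = (\<lambda>t. c *\<^sub>R Y w t)" using causal_mapD(3)[OF Y that] by (simp add: fun_eq_iff)
    then show ?thesis using l2_state_scaleR[OF h l2[OF that]] by simp
  qed
  have past: "l2_state M B (Y v) t = l2_state M B (Y w) t"
    if "v \<in> l2" "w \<in> l2" and eq: "\<And>i. i < t \<Longrightarrow> v i = w i" for v w t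
  proof (rule l2_state_causal[OF M l2 l2])
    fix i assume "i < t"
    then show "Y v i = Y w i" using eq by (intro causal_mapD(4)[OF Y that(1,2)]) simp
  qed (use that in auto)
  show "strictly_causal (\<lambda>w. l2_state M B (Y w))"
    by (rule strictly_causalI) (rule add scale past; assumption)+
  have st: "l2_state M B (Y w) \<in> l2" if "w \<in> l2" for w
    by (rule l2_state(1)[OF h l2[OF that]])
  show "causal_map (\<lambda>w. l2_state M B (Y w))"
  proof (rule causal_mapI)
    fix v w :: "int \<Rightarrow> 'a" and t assume "v \<in> l2" "w \<in> l2" and eq: "\<And>i. i \<le> t \<Longrightarrow> v i = w i"
    then show "l2_state M B (Y v) t = l2_state M B (Y w) t" by (intro past) auto
  qed (use st add scale in auto)
  show "causal_map (\<lambda>w t. l2_state M B (Y w) (t + 1))"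
  proof (rule causal_mapI)
    fix v w :: "int \<Rightarrow> 'a" and t assume "v \<in> l2" "w \<in> l2" and eq: "\<And>i. i \<le> t \<Longrightarrow> v i = w i"
    then show "l2_state M B (Y v) (t + 1) = l2_state M B (Y w) (t + 1)" by (intro past) auto
  qed (use l2_shift[OF st] add scale in auto)
qed

lemma strictly_causal_matrix:
  fixes M :: "real^'n^'m" and Y :: "(int \<Rightarrow> 'a::real_normed_vector) \<Rightarrow> int \<Rightarrow> real^'n"
  assumes "strictly_causal Y"
  shows "strictly_causal (\<lambda>w t. M *v Y w t)"
proof (rule strictly_causalI)
  fix v w :: "int \<Rightarrow> 'a" and t assume "v \<in> l2" "w \<in> l2" "\<And>i. i < t \<Longrightarrow> v i = w i"
  then show "M *v Y v t = M *v Y w t"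
    using strictly_causalD(3)[OF assms, of v w t] by simp
qed (simp_all add: strictly_causalD(1-2)[OF assms] matrix_vector_right_distrib
      matrix_vector_mult_scaleR)

lemma strictly_causal_diff:
  fixes Y Z :: "(int \<Rightarrow> 'a::real_normed_vector) \<Rightarrow> int \<Rightarrow> 'b::real_normed_vector"
  assumes "strictly_causal Y" "strictly_causal Z"
  shows "strictly_causal (\<lambda>w t. Y w t - Z w t)"
proof (rule strictly_causalI)
  fix v w :: "int \<Rightarrow> 'a" and t assume "v \<in> l2" "w \<in> l2" "\<And>i. i < t \<Longrightarrow> v i = w i"
  then show "Y v t - Z v t = Y w t - Z w t"
    using strictly_causalD(3)[OF assms(1), of v w t] strictly_causalD(3)[OF assms(2), of v w t] by simp
qed (simp_all add: strictly_causalD(1-2)[OF assms(1)] strictly_causalD(1-2)[OF assms(2)] scaleR_diff_right)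

section \<open>The Nehari problem\<close>

definition imvec :: "complex^'n \<Rightarrow> real^'n" where
  "imvec v = (\<chi> i. Im (v $ i))"

lemma imvec_mult: "imvec (cmat M *v v) = M *v imvec v"
  by (simp add: imvec_def vec_eq_iff matrix_vector_mult_def map_matrix_def)

text \<open>For a complex eigenvector \<open>a + i b\<close> with eigenvalue \<open>c\<close> the sum of the form at \<open>a\<close> and \<open>b\<close> is
  multiplied by \<open>|c|\<^sup>2\<close>.\<close>

lemma schur_stable_if_decreasing:
  fixes M V :: "real^'n^'n"
  assumes pos: "\<And>x. x \<noteq> 0 \<Longrightarrow> 0 < x \<bullet> (V *v x)"
    and dec: "\<And>x. x \<noteq> 0 \<Longrightarrow> (M *v x) \<bullet> (V *v (M *v x)) < x \<bullet> (V *v x)"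
  shows "schur_stable M"
  unfolding schur_stable_def
proof (intro allI impI)
  fix c assume "eigenvalue (cmat M) c"
  then obtain z where z: "z \<noteq> 0" "cmat M *v z = c *s z" by (auto simp: eigenvalue_def)
  define a where "a = revec z"
  define b where "b = imvec z"
  have Ma: "M *v a = Re c *\<^sub>R a - Im c *\<^sub>R b"
    unfolding a_def b_def revec_mult[symmetric] z(2) by (simp add: revec_def imvec_def vec_eq_iff)
  have Mb: "M *v b = Re c *\<^sub>R b + Im c *\<^sub>R a"
    unfolding a_def b_def imvec_mult[symmetric] z(2) by (simp add: revec_def imvec_def vec_eq_iff)
  have ab: "a \<noteq> 0 \<or> b \<noteq> 0"
    using z(1) by (auto simp: a_def b_def revec_def imvec_def vec_eq_iff complex_eq_iff)
  let ?q = "\<lambda>x. x \<bullet> (V *v x)"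
  have "?q (M *v a) + ?q (M *v b) = (cmod c)\<^sup>2 * (?q a + ?q b)"
    unfolding Ma Mb cmod_power2
    by (simp add: mv_simps matrix_vector_mult_scaleR inner_add inner_diff power2_eq_square algebra_simps)
  moreover have "?q (M *v a) \<le> ?q a" "?q (M *v b) \<le> ?q b"
    using dec[of a] dec[of b] by (cases "a = 0"; cases "b = 0"; simp)+
  moreover have "?q (M *v a) < ?q a \<or> ?q (M *v b) < ?q b" using dec ab by blast
  moreover have "r < 1 * (s + t)" if "p + q = r" "p \<le> s" "q \<le> t" "p < s \<or> q < t" for p q r s t :: real
    using that by auto
  ultimately have "(cmod c)\<^sup>2 * (?q a + ?q b) < 1 * (?q a + ?q b)" by blast
  moreover have "0 \<le> ?q a" "0 \<le> ?q b" using pos[of a] pos[of b] by (cases "a = 0"; cases "b = 0"; simp)+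
  ultimately have "(cmod c)\<^sup>2 < 1" by (meson add_nonneg_nonneg mult_right_less_imp_less)
  then show "cmod c < 1" by (simp add: power_less_one_iff abs_square_less_1)
qed

locale competitive_system = lq_system A Q P T Bu
  for A Q P T :: "real^'n^'n" and Bu :: "real^'p^'n" +
  fixes Bw Z1 \<Pi>b Zs :: "real^'n^'n"
  assumes Bw: "invertible Bw"
    and Z1_eq: "Z1 = A_K A Bu P ** Z1 ** transpose (A_K A Bu P)
              + Bu ** matrix_inv (lqr_S Bu P) ** transpose Bu"
    and \<Pi>b_eq: "\<Pi>b = transpose (A_K A Bu P) ** \<Pi>b ** A_K A Bu P
              + (P - transpose (A_K A Bu P) ** P ** A_T A Q T) ** (matrix_inv Q + T)
                ** (P - transpose (A_T A Q T) ** P ** A_K A Bu P)"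
    and Zs_eq: "Zs = A_K A Bu P ** Zs ** transpose (A_K A Bu P)
              + inverse (lambda_max (Z1 ** \<Pi>b))
                *\<^sub>R (Bu ** matrix_inv (lqr_S Bu P) ** transpose Bu)"
begin

definition "c = lambda_max (Z1 ** \<Pi>b)"
definition "N1 = Bu ** matrix_inv S ** transpose Bu"

lemma N1_mult: "N1 *v x = Bu *v (matrix_inv S *v (transpose Bu *v x))"
  by (simp add: N1_def mv_simps)

lemma posdef_S: "posdef S"
proof -
  have "u \<bullet> (S *v u) = u \<bullet> u + (Bu *v u) \<bullet> (P *v (Bu *v u))" for u
    by (simp add: S_mult inner_add_right inner_transpose')
  then show ?thesis using posdef_nonneg[OF posdef_P]
    by (auto simp: posdef_def S_sym intro: add_pos_nonneg)
qed

lemma Sinv_nonneg: "0 \<le> u \<bullet> (matrix_inv S *v u)"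
  by (rule posdef_nonneg[OF posdef_inv[OF posdef_S]])

lemma N1_form: "x \<bullet> (N1 *v x) = (transpose Bu *v x) \<bullet> (matrix_inv S *v (transpose Bu *v x))"
  by (simp add: N1_mult inner_transpose)

lemma N1_nonneg: "0 \<le> x \<bullet> (N1 *v x)"
  by (simp add: N1_form Sinv_nonneg)

lemma N1_sym: "transpose N1 = N1"
  using matrix_inv_symmetric[OF posdef_invertible[OF posdef_S] S_sym]
  by (simp add: N1_def matrix_transpose_mul matrix_mul_assoc)

lemma Z1_form: "x \<bullet> (Z1 *v y) = (transpose AK *v x) \<bullet> (Z1 *v (transpose AK *v y)) + x \<bullet> (N1 *v y)"
proof -
  have "Z1 *v y = (AK ** Z1 ** transpose AK + N1) *v y" using Z1_eq by (simp add: N1_def)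
  then show ?thesis by (simp add: mv_simps inner_add_right inner_transpose[of x AK])
qed

lemma Z1_sym: "transpose Z1 = Z1"
  by (rule lyapunov_symmetric[OF schur_transpose[OF schur(1)] N1_sym])
    (use Z1_eq in \<open>simp add: N1_def\<close>)

lemma Z1_nonneg: "0 \<le> x \<bullet> (Z1 *v x)"
proof (rule lyapunov_nonneg[OF schur_transpose[OF schur(1)]])
  show "(transpose AK *v x) \<bullet> (Z1 *v (transpose AK *v x)) \<le> x \<bullet> (Z1 *v x)" for x
    using Z1_form[of x x] N1_nonneg[of x] by simp
qed

lemma W_form: "(Rf *v (H *v x)) \<bullet> (Ri *v (Rf *v (H *v x))) = x \<bullet> (W *v x)"
  by (simp add: Rf_Ri W_mult inner_transpose[of x "transpose H"]) (rule inner_commute)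

lemma \<Pi>b_W: "\<Pi>b = transpose AK ** \<Pi>b ** AK + W"
  using \<Pi>b_eq by (simp add: W_def transpose_H Rf_def) (simp add: H_def)

lemma \<Pi>b_mult: "\<Pi>b *v x = transpose AK *v (\<Pi>b *v (AK *v x)) + W *v x"
proof -
  have "\<Pi>b *v x = (transpose AK ** \<Pi>b ** AK + W) *v x" using \<Pi>b_W by simp
  then show ?thesis by (simp add: mv_simps)
qed

lemma \<Pi>b_form: "x \<bullet> (\<Pi>b *v y) = (AK *v x) \<bullet> (\<Pi>b *v (AK *v y)) + x \<bullet> (W *v y)"
  using arg_cong[OF \<Pi>b_mult[of y], of "(\<bullet>) x"]
  by (simp add: inner_add_right inner_transpose[of x "transpose AK"])

lemma posdef_\<Pi>b: "posdef \<Pi>b"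
proof -
  have "transpose \<Pi>b = \<Pi>b"
    by (rule lyapunov_symmetric[OF schur(1) _ \<Pi>b_W]) (use posdef_W in \<open>simp add: posdef_def\<close>)
  moreover have nn: "0 \<le> x \<bullet> (\<Pi>b *v x)" for x
  proof (rule lyapunov_nonneg[OF schur(1)])
    show "(AK *v x) \<bullet> (\<Pi>b *v (AK *v x)) \<le> x \<bullet> (\<Pi>b *v x)" for x
      using \<Pi>b_form[of x x] posdef_nonneg[OF posdef_W, of x] by simp
  qed
  moreover have "0 < x \<bullet> (\<Pi>b *v x)" if "x \<noteq> 0" for x
    using \<Pi>b_form[of x x] nn[of "AK *v x"] posdef_W that by (auto simp: posdef_def intro: add_nonneg_pos)
  ultimately show ?thesis by (simp add: posdef_def)
qed

lemma \<Pi>b_sym: "transpose \<Pi>b = \<Pi>b"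
  using posdef_\<Pi>b by (simp add: posdef_def)

lemma c_eigenvector: obtains p where "p \<noteq> 0" "Z1 *v (\<Pi>b *v p) = c *\<^sub>R p"
  using lambda_max_product(1)[OF Z1_sym Z1_nonneg posdef_\<Pi>b]
  by (auto simp: eigenvalue_def c_def scalar_mult_eq_scaleR matrix_vector_mul_assoc)

lemma c_bound: "(\<Pi>b *v x) \<bullet> (Z1 *v (\<Pi>b *v x)) \<le> c * (x \<bullet> (\<Pi>b *v x))"
  unfolding c_def by (rule lambda_max_product(2)[OF Z1_sym Z1_nonneg posdef_\<Pi>b])

lemma c_nonneg: "0 \<le> c"
  unfolding c_def by (rule lambda_max_product(3)[OF Z1_sym Z1_nonneg posdef_\<Pi>b])

text \<open>Uniqueness of the Lyapunov equation. For \<open>c = 0\<close> both sides are zero, as \<open>inverse 0 = 0\<close>.\<close>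

lemma Zs_scaled: "Zs = inverse c *\<^sub>R Z1"
proof -
  have Zs: "x \<bullet> (Zs *v y) = (transpose AK *v x) \<bullet> (Zs *v (transpose AK *v y)) + inverse c * (x \<bullet> (N1 *v y))" for x y
  proof -
    have "Zs *v y = (AK ** Zs ** transpose AK + inverse c *\<^sub>R N1) *v y" using Zs_eq by (simp add: N1_def c_def)
    then show ?thesis
      by (simp add: mv_simps inner_add_right inner_transpose[of x AK] flip: scaleR_matrix_vector_assoc)
  qed
  have "Zs - inverse c *\<^sub>R Z1 = 0"
  proof (rule lyapunov_unique[OF schur_transpose[OF schur(1)]])
    show "x \<bullet> ((Zs - inverse c *\<^sub>R Z1) *v y) = (transpose AK *v x) \<bullet> ((Zs - inverse c *\<^sub>R Z1) *v (transpose AK *v y))"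
      for x y
      using Zs[of x y] Z1_form[of x y]
      by (simp add: mv_simps inner_diff_right algebra_simps flip: scaleR_matrix_vector_assoc)
  qed
  then show ?thesis by simp
qed

lemma Zs_sym: "transpose Zs = Zs"
  by (simp add: Zs_scaled transpose_scalar Z1_sym)

lemma Zs_nonneg: "0 \<le> x \<bullet> (Zs *v x)"
  using Z1_nonneg[of x] c_nonneg by (simp add: Zs_scaled flip: scaleR_matrix_vector_assoc)

definition "N = inverse c *\<^sub>R N1"

lemma N_nonneg: "0 \<le> x \<bullet> (N *v x)"
  using N1_nonneg[of x] c_nonneg by (simp add: N_def flip: scaleR_matrix_vector_assoc)

lemma Zs_form: "x \<bullet> (Zs *v y) = (transpose AK *v x) \<bullet> (Zs *v (transpose AK *v y)) + x \<bullet> (N *v y)"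
  using Z1_form[of x y] by (simp add: Zs_scaled N_def distrib_left flip: scaleR_matrix_vector_assoc)

text \<open>The level \<open>c\<close> is just large enough for \<open>Z \<le> \<Pi>b\<^sup>-\<^sup>1\<close>.\<close>

lemma Zs_\<Pi>b_bound: "(\<Pi>b *v x) \<bullet> (Zs *v (\<Pi>b *v x)) \<le> x \<bullet> (\<Pi>b *v x)"
proof (cases "c = 0")
  case True
  then show ?thesis using posdef_nonneg[OF posdef_\<Pi>b] by (simp add: Zs_scaled)
next
  case False
  then have "c > 0" using c_nonneg by simp
  then show ?thesis using c_bound[of x]
    by (simp add: Zs_scaled divide_simps mult.commute flip: scaleR_matrix_vector_assoc)
qed

text \<open>For \<open>c = 0\<close> the definition of \<open>N\<close> is degenerate, but then \<open>c_bound\<close> makes \<open>Z1\<close>, and with it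
  \<open>N1\<close>, vanish. So the upper bound covers this case too: the controller then attains the
  clairvoyant cost.\<close>

lemma c_N_form: "c * (x \<bullet> (N *v x)) = x \<bullet> (N1 *v x)"
proof (cases "c = 0")
  case True
  define y where "y = matrix_inv \<Pi>b *v x"
  have "\<Pi>b *v y = x" by (simp add: y_def matrix_inv_cancel[OF posdef_invertible[OF posdef_\<Pi>b]])
  then have "x \<bullet> (Z1 *v x) \<le> 0" using c_bound[of y] True by simp
  then have "x \<bullet> (N1 *v x) = 0"
    using Z1_form[of x x] Z1_nonneg[of "transpose AK *v x"] N1_nonneg[of x] by simp
  then show ?thesis using True by simp
qed (simp add: N_def flip: scaleR_matrix_vector_assoc)

text \<open>The inequality \<open>\<Pi>b Z \<Pi>b \<le> \<Pi>b\<close> in the form \<open>Z \<Pi>b Z \<le> Z\<close>.\<close>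

lemma Zs_residual_nonneg: "(Zs *v y) \<bullet> (\<Pi>b *v (Zs *v y)) \<le> y \<bullet> (Zs *v y)"
proof -
  define x where "x = Zs *v y"
  have "0 \<le> (\<Pi>b *v x - y) \<bullet> (Zs *v (\<Pi>b *v x - y))" by (rule Zs_nonneg)
  also have "\<dots> = (\<Pi>b *v x) \<bullet> (Zs *v (\<Pi>b *v x)) - 2 * (x \<bullet> (\<Pi>b *v x)) + y \<bullet> (Zs *v y)"
    using inner_symmetric[OF Zs_sym, of y "\<Pi>b *v x"]
    by (simp add: mv_simps inner_diff x_def[symmetric] inner_commute)
  also have "\<dots> \<le> y \<bullet> (Zs *v y) - x \<bullet> (\<Pi>b *v x)" using Zs_\<Pi>b_bound[of x] by simp
  finally show ?thesis by (simp add: x_def)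
qed

subsection \<open>Stability of the optimal controller\<close>

definition "J = matrix_inv \<Pi>b"

lemma J: "J *v (\<Pi>b *v x) = x" "\<Pi>b *v (J *v x) = x"
  by (simp_all add: J_def matrix_inv_cancel[OF posdef_invertible[OF posdef_\<Pi>b]])

lemma posdef_J: "posdef J"
  unfolding J_def by (rule posdef_inv[OF posdef_\<Pi>b])

text \<open>\<open>A\<^sub>K\<^sup>* \<Pi>b A\<^sub>K < \<Pi>b\<close> is equivalent to \<open>A\<^sub>K \<Pi>b\<^sup>-\<^sup>1 A\<^sub>K\<^sup>* < \<Pi>b\<^sup>-\<^sup>1\<close>, a contraction and its adjoint.\<close>

lemma J_contraction:
  assumes "y \<noteq> 0"
  shows "(transpose AK *v y) \<bullet> (J *v (transpose AK *v y)) < y \<bullet> (J *v y)"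
proof -
  define m where "m = J *v (transpose AK *v y)"
  define a where "a = m \<bullet> (\<Pi>b *v m)"
  have am: "(transpose AK *v y) \<bullet> (J *v (transpose AK *v y)) = a"
    by (simp add: a_def m_def J inner_commute)
  have ay: "(AK *v m) \<bullet> y = a" by (simp add: a_def inner_transpose' m_def J)
  show ?thesis
  proof (cases "m = 0")
    case True
    then show ?thesis using am posdef_J assms by (simp add: a_def posdef_def)
  next
    case False
    have "0 \<le> (J *v y - AK *v m) \<bullet> (\<Pi>b *v (J *v y - AK *v m))" by (rule posdef_nonneg[OF posdef_\<Pi>b])
    also have "\<dots> = y \<bullet> (J *v y) - 2 * a + (AK *v m) \<bullet> (\<Pi>b *v (AK *v m))"
      using inner_symmetric[OF \<Pi>b_sym, of "J *v y" "AK *v m"] ay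
      by (simp add: mv_simps inner_diff J inner_commute)
    also have "(AK *v m) \<bullet> (\<Pi>b *v (AK *v m)) = a - m \<bullet> (W *v m)"
      using \<Pi>b_form[of m m] by (simp add: a_def)
    finally have "a + m \<bullet> (W *v m) \<le> y \<bullet> (J *v y)" by simp
    moreover have "0 < m \<bullet> (W *v m)" using posdef_W False by (simp add: posdef_def)
    ultimately show ?thesis using am by simp
  qed
qed

lemma Zs_J: "y \<bullet> (Zs *v y) \<le> y \<bullet> (J *v y)"
  using Zs_\<Pi>b_bound[of "J *v y"] by (simp add: J inner_commute)

definition "M = AK ** Zs ** transpose AK"

lemma M_mult: "M *v x = AK *v (Zs *v (transpose AK *v x))"
  by (simp add: M_def mv_simps)

lemma M_form: "x \<bullet> (M *v y) = (transpose AK *v x) \<bullet> (Zs *v (transpose AK *v y))"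
  by (simp add: M_mult inner_transpose[of x AK])

lemma M_less_J: "y \<noteq> 0 \<Longrightarrow> y \<bullet> (M *v y) < y \<bullet> (J *v y)"
  using J_contraction[of y] Zs_J[of "transpose AK *v y"] by (simp add: M_form)

lemma \<Pi>b_nonzero: "x \<noteq> 0 \<Longrightarrow> \<Pi>b *v x \<noteq> 0"
  using J(1)[of x] by auto

text \<open>Although \<open>Z \<le> \<Pi>b\<^sup>-\<^sup>1\<close> need not be strict, \<open>M = A\<^sub>K Z A\<^sub>K\<^sup>* \<le> A\<^sub>K \<Pi>b\<^sup>-\<^sup>1 A\<^sub>K\<^sup>* < \<Pi>b\<^sup>-\<^sup>1\<close> is.\<close>

lemma controller_inverse: "invertible (mat 1 - M ** \<Pi>b)"
proof (rule invertible_if_trivial_kernel, rule ccontr)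
  fix x assume "(mat 1 - M ** \<Pi>b) *v x = 0" and x: "x \<noteq> 0"
  then have "M *v (\<Pi>b *v x) = x" by (simp add: mv_simps)
  then show False using M_less_J[OF \<Pi>b_nonzero[OF x]] by (simp add: J inner_commute)
qed

abbreviation "Kb \<equiv> K_bar A Bu Q P T \<Pi>b Zs"
abbreviation "Fb \<equiv> F_bar A Bu Q P T \<Pi>b Zs"

lemma Kb_eq: "Kb *v y - M *v (\<Pi>b *v (Kb *v y)) = AK *v (Zs *v (transpose H *v y))"
proof -
  have "(mat 1 - M ** \<Pi>b) *v (Kb *v y) = AK *v (Zs *v (transpose H *v y))"
    using matrix_inv_cancel(2)[OF controller_inverse]
    by (simp add: K_bar_def transpose_H M_def flip: matrix_vector_mul_assoc)
  then show ?thesis by (simp add: mv_simps)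
qed

lemma Fb_mult: "Fb *v x = AK *v x - Kb *v (Rf *v (H *v x))"
  by (simp add: F_bar_def matrix_vector_mult_diff_rdistrib inv_sqrt_RT H_def
      flip: matrix_vector_mul_assoc)

text \<open>Together with \<open>Kb_eq\<close> this is all that is used of the controller gains: both are given
  implicitly, after multiplication with \<open>I - M \<Pi>b\<close>.\<close>

lemma Fb_eq: "Fb *v x - M *v (\<Pi>b *v (Fb *v x)) = AK *v (x - Zs *v (\<Pi>b *v x))"
proof -
  have "Fb *v x - M *v (\<Pi>b *v (Fb *v x)) = AK *v x - M *v (\<Pi>b *v (AK *v x))
      - (Kb *v (Rf *v (H *v x)) - M *v (\<Pi>b *v (Kb *v (Rf *v (H *v x)))))"
    by (simp add: Fb_mult mv_simps)
  also have "\<dots> = AK *v x - M *v (\<Pi>b *v (AK *v x)) - AK *v (Zs *v (W *v x))"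
    by (simp add: Kb_eq W_mult)
  also have "W *v x = \<Pi>b *v x - transpose AK *v (\<Pi>b *v (AK *v x))"
    by (subst \<Pi>b_mult) simp
  finally show ?thesis by (simp add: M_mult mv_simps)
qed

text \<open>Lyapunov function \<open>V = \<Pi>b - \<Pi>b M \<Pi>b\<close>, that is \<open>\<Pi>b\<^sup>-\<^sup>1 - M\<close> in the variable \<open>\<Pi>b x\<close>. By
  \<open>Fb_eq\<close>, its value at \<open>y = Fb x\<close> is the product of \<open>a = A\<^sub>K\<^sup>* \<Pi>b y\<close> and \<open>b = \<Pi>b x\<close> in the
  semidefinite form \<open>Y = \<Pi>b\<^sup>-\<^sup>1 - Z\<close>. As \<open>Y a a < V y\<close> and \<open>Y b b \<le> V x\<close>, the inequality
  \<open>2 Y a b \<le> Y a a + Y b b\<close> gives \<open>V y < V x\<close>.\<close>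

lemma schur_Fb: "schur_stable Fb"
proof (rule schur_stable_if_decreasing[where V = "\<Pi>b - \<Pi>b ** M ** \<Pi>b"])
  have V: "x \<bullet> ((\<Pi>b - \<Pi>b ** M ** \<Pi>b) *v x) = x \<bullet> (\<Pi>b *v x) - (\<Pi>b *v x) \<bullet> (M *v (\<Pi>b *v x))" for x
    by (simp add: mv_simps inner_diff_right inner_symmetric[OF \<Pi>b_sym])
  show pos: "0 < x \<bullet> ((\<Pi>b - \<Pi>b ** M ** \<Pi>b) *v x)" if "x \<noteq> 0" for x
    using M_less_J[OF \<Pi>b_nonzero[OF that]] by (simp add: V J inner_commute)
  fix x :: "real^'n" assume x: "x \<noteq> 0"
  define y where "y = Fb *v x"
  show "(Fb *v x) \<bullet> ((\<Pi>b - \<Pi>b ** M ** \<Pi>b) *v (Fb *v x)) < x \<bullet> ((\<Pi>b - \<Pi>b ** M ** \<Pi>b) *v x)"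
  proof (cases "y = 0")
    case True
    then show ?thesis using pos[OF x] by (simp add: y_def)
  next
    case False
    define a where "a = transpose AK *v (\<Pi>b *v y)"
    define b where "b = \<Pi>b *v x"
    let ?V = "\<lambda>x. x \<bullet> (\<Pi>b *v x) - (\<Pi>b *v x) \<bullet> (M *v (\<Pi>b *v x))"
    let ?Y = "\<lambda>a b. a \<bullet> (J *v b) - a \<bullet> (Zs *v b)"
    have Vy: "?V y = ?Y a b"
    proof -
      have "?V y = (\<Pi>b *v y) \<bullet> (y - M *v (\<Pi>b *v y))" by (simp add: inner_diff_right inner_commute)
      also have "\<dots> = (\<Pi>b *v y) \<bullet> (AK *v (x - Zs *v b))" using Fb_eq[of x] by (simp add: y_def b_def)
      also have "\<dots> = a \<bullet> (x - Zs *v b)" by (simp add: a_def inner_transpose)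
      finally show ?thesis by (simp add: inner_diff_right b_def J)
    qed
    have "0 \<le> ?Y (a - b) (a - b)" using Zs_J[of "a - b"] by simp
    also have "\<dots> = ?Y a a - 2 * ?Y a b + ?Y b b"
      using inner_symmetric[OF Zs_sym, of a b] inner_symmetric[of J a b] posdef_J
      by (simp add: mv_simps inner_diff posdef_def inner_commute)
    finally have "2 * ?Y a b \<le> ?Y a a + ?Y b b" by simp
    moreover have "?Y a a < ?V y"
      using J_contraction[OF \<Pi>b_nonzero[OF False]] by (simp add: a_def M_form J inner_commute)
    moreover have "?Y b b \<le> ?V x"
      using Zs_form[of b b] N_nonneg[of b] by (simp add: b_def M_form J inner_commute)
    moreover have "v < u" if "2 * p \<le> q + r" "q < v" "r \<le> u" "v = p" for p q r u v :: real
      using that by linarith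
    ultimately have "?V y < ?V x" using Vy by blast
    then show ?thesis by (simp add: V y_def)
  qed
qed

subsection \<open>Anticausal part\<close>

text \<open>Splits the feedforward signal \<open>g\<close> into the part \<open>- P A\<^sub>T s\<close>, which a strictly causal controller
  knows, and the part \<open>h\<close>, which depends on later values of \<open>s\<close> only.\<close>

lemma feedforward:
  assumes d: "d \<in> l2" and s: "s \<in> l2" "\<And>t. s (t + 1) = AT *v s t + d t"
  obtains g h where "g \<in> l2" "\<And>t. g t = P *v d t + transpose AK *v g (t + 1)"
    "h \<in> l2" "\<And>t. h t = g t + P *v (AT *v s t)"
    "\<And>t. h t = transpose H *v s (t + 1) + transpose AK *v h (t + 1)"
proof -
  obtain g where g: "g \<in> l2" "\<And>t. g t = transpose AK *v g (t + 1) + P *v d t"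
    using backward_solution[OF hyperbolic_transpose[OF hyperbolic_AK] l2_matrix[OF d]] by metis
  define h where "h t = g t + P *v (AT *v s t)" for t
  show ?thesis
  proof (rule that[OF g(1) _ _ h_def])
    show "g t = P *v d t + transpose AK *v g (t + 1)" for t using g(2)[of t] by simp
    show "h \<in> l2" unfolding h_def by (intro l2_intros g(1) s(1))
    show "h t = transpose H *v s (t + 1) + transpose AK *v h (t + 1)" for t
    proof -
      have "d t = s (t + 1) - AT *v s t" by (simp add: s(2))
      then have "h t = transpose AK *v g (t + 1) + P *v s (t + 1)"
        using g(2)[of t] by (simp add: h_def mv_simps)
      also have "g (t + 1) = h (t + 1) - P *v (AT *v s (t + 1))" by (simp add: h_def)
      finally show ?thesis by (simp add: transpose_H mv_simps)
    qed
  qed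
qed

subsection \<open>Lower bound\<close>

text \<open>The filter state \<open>s = (Q\<^sup>-\<^sup>1 + T) H p\<close> with \<open>p\<^sub>t = A\<^sub>K\<^sup>t\<^sup>-\<^sup>1 q\<close> for \<open>t \<ge> 1\<close> is the input of least energy
  that steers the backward recursion to \<open>h\<^sub>0 = \<Pi>b q\<close>; its energy is \<open>q \<bullet> \<Pi>b q\<close>. For \<open>t \<le> 0\<close> the
  controller has not seen anything, so \<open>v\<^sub>t = B\<^sub>u\<^sup>* h\<^sub>t\<close>, where \<open>h\<close> decays freely towards the past, with
  energy \<open>h\<^sub>0 \<bullet> Z\<^sub>1 h\<^sub>0 = c (q \<bullet> \<Pi>b q)\<close>.\<close>

lemma worst_ratio_ge:
  assumes cl: "closed_loop A Bu Bw C X"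
  shows "ennreal (1 + c) \<le> worst_ratio A Bu Bw Q C X"
proof -
  obtain q where q: "q \<noteq> 0" "Z1 *v (\<Pi>b *v q) = c *\<^sub>R q" by (rule c_eigenvector)
  obtain p where p: "p \<in> l2" "\<And>t. t \<le> 0 \<Longrightarrow> p t = 0" "p 1 = q"
    "\<And>t. t \<noteq> 0 \<Longrightarrow> p (t + 1) = AK *v p t" by (rule impulse_response[OF schur(1)]) (rule that)
  define m where "m = q \<bullet> (\<Pi>b *v q)"
  have m: "0 < m" using posdef_\<Pi>b q by (simp add: m_def posdef_def)
  define s where "s t = Rf *v (H *v p t)" for t
  have s: "s \<in> l2" unfolding s_def by (intro l2_intros p(1))
  \<comment> \<open>the disturbance that produces this filter state\<close>
  define w where "w t = matrix_inv Bw *v (s (t + 1) - AT *v s t)" for t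
  have w: "w \<in> l2" unfolding w_def by (intro l2_intros s)
  have d: "(\<lambda>t. Bw *v w t) \<in> l2" by (rule l2_matrix[OF w])
  have srec: "s (t + 1) = AT *v s t + Bw *v w t" for t
    by (simp add: w_def matrix_inv_cancel[OF Bw])
  have s0: "s t = 0" if "t \<le> 0" for t using p(2)[OF that] by (simp add: s_def)
  have w0: "w t = 0" if "t < 0" for t using s0[of t] s0[of "t + 1"] that by (simp add: w_def)
  have "w \<noteq> (\<lambda>_. 0)"
  proof
    assume "w = (\<lambda>_. 0)"
    then have "s 1 = 0" using srec[of 0] s0[of 0] by simp
    then have "(Rf ** H) *v q = 0" by (simp add: s_def p(3) flip: matrix_vector_mul_assoc)
    then show False using matrix_inv_cancel(1)[OF Rf_H_invertible, of q] q by simp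
  qed
  obtain g h where g: "g \<in> l2" "\<And>t. g t = P *v (Bw *v w t) + transpose AK *v g (t + 1)"
    and h: "h \<in> l2" "\<And>t. h t = g t + P *v (AT *v s t)"
    and hrec: "\<And>t. h t = transpose H *v s (t + 1) + transpose AK *v h (t + 1)"
    by (rule feedforward[OF d s srec]) (rule that)
  have cost0: "infsum (\<lambda>t. s t \<bullet> (Ri *v s t)) UNIV = m"
  proof -
    have "infsum (\<lambda>t. s t \<bullet> (Ri *v s t)) UNIV = infsum (\<lambda>t::int. if t = 0 then m else 0) UNIV"
    proof (rule infsum_telescope[where \<phi> = "\<lambda>t. - (p t \<bullet> (\<Pi>b *v p t))"])
      fix t
      have "s t \<bullet> (Ri *v s t) = p t \<bullet> (W *v p t)"
        by (simp add: s_def W_form)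
      also have "\<dots> = (if t = 0 then m else 0) + (- (p (t + 1) \<bullet> (\<Pi>b *v p (t + 1))) - - (p t \<bullet> (\<Pi>b *v p t)))"
      proof (cases "t = 0")
        case True
        then show ?thesis by (simp add: p(2,3) m_def)
      next
        case False
        then show ?thesis using \<Pi>b_form[of "p t" "p t"] by (simp add: p(4))
      qed
      finally show "s t \<bullet> (Ri *v s t)
        = (if t = 0 then m else 0) + (- (p (t + 1) \<bullet> (\<Pi>b *v p (t + 1))) - - (p t \<bullet> (\<Pi>b *v p t)))" .
    next
      show "(\<lambda>t. - (p t \<bullet> (\<Pi>b *v p t))) summable_on UNIV"
        unfolding summable_on_uminus by (intro summable_inner l2_intros p(1))
    qed (rule summable_at)
    then show ?thesis by (simp add: infsum_at)
  qed
  have cc: "clairvoyant_cost A Bu Bw Q w = ennreal m"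
    by (simp add: clairvoyant_cost_eq[OF w s srec] cost0)
  have h0: "h 0 = \<Pi>b *v q"
  proof -
    have l2: "(\<lambda>t. h t - \<Pi>b *v p (t + 1)) \<in> l2" by (intro l2_intros h(1) p(1))
    have "h 0 - \<Pi>b *v p (0 + 1) = 0"
    proof (rule backward_half_line_zero[OF schur_transpose[OF schur(1)] l2, of 0 0])
      fix t :: int assume t: "0 \<le> t"
      have "\<Pi>b *v p (t + 1) = transpose AK *v (\<Pi>b *v p (t + 1 + 1)) + transpose H *v s (t + 1)"
      proof -
        have "p (t + 1 + 1) = AK *v p (t + 1)" using p(4)[of "t + 1"] t by simp
        then show ?thesis by (subst \<Pi>b_mult) (simp only: W_mult s_def)
      qed
      then show "h t - \<Pi>b *v p (t + 1) = transpose AK *v (h (t + 1) - \<Pi>b *v p (t + 1 + 1))"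
        by (subst hrec) (simp add: mv_simps)
    qed simp
    then show ?thesis by (simp add: p(3))
  qed
  define h' where "h' t = (if t \<le> 0 then h t else 0)" for t
  have h': "h' \<in> l2" by (rule l2_dominated[OF h(1), of _ 1]) (simp add: h'_def)
  have past: "infsum (\<lambda>t. h' t \<bullet> (N1 *v h' t)) UNIV = c * m"
  proof -
    have "infsum (\<lambda>t. h' t \<bullet> (N1 *v h' t)) UNIV = infsum (\<lambda>t. h' (t + 1) \<bullet> (N1 *v h' (t + 1))) UNIV"
      by (rule infsum_shift[symmetric])
    also have "\<dots> = infsum (\<lambda>t::int. if t = 0 then c * m else 0) UNIV"
    proof (rule infsum_telescope[where \<phi> = "\<lambda>t. h' t \<bullet> (Z1 *v h' t)"])
      fix t :: int
      consider "t < 0" | "t = 0" | "t > 0" by linarith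
      then show "h' (t + 1) \<bullet> (N1 *v h' (t + 1))
        = (if t = 0 then c * m else 0) + (h' (t + 1) \<bullet> (Z1 *v h' (t + 1)) - h' t \<bullet> (Z1 *v h' t))"
      proof cases
        case 1
        then have "h t = transpose AK *v h (t + 1)" using hrec[of t] s0[of "t + 1"] by simp
        then show ?thesis using 1 Z1_form[of "h (t + 1)" "h (t + 1)"] by (simp add: h'_def)
      next
        case 2
        then show ?thesis by (simp add: h'_def h0 q(2) m_def inner_commute)
      qed (simp add: h'_def)
    qed (rule summable_at, intro summable_inner l2_intros h')
    finally show ?thesis by (simp add: infsum_at)
  qed
  have "ennreal (1 + c) \<le> cost Q (X w) (C w) / clairvoyant_cost A Bu Bw Q w"
  proof (cases "cost Q (X w) (C w) = top")
    case True
    then show ?thesis by (simp add: cc ennreal_top_divide)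
  next
    case False
    note xu = cost_finite_l2[OF Q False]
    have rec: "X w (t + 1) = A *v X w t + Bu *v C w t + Bw *v w t" for t
      using cl w unfolding closed_loop_def by blast
    define v where "v t = S *v (C w t + K *v X w t) + transpose Bu *v g t" for t
    have v: "v \<in> l2" unfolding v_def by (intro l2_intros xu g(1))
    have "C w t = 0" "X w t = 0" if "t \<le> 0" for t
      using strictly_causal_zero[of C w t] strictly_causal_zero[of X w t] cl w w0 that
      by (auto simp: closed_loop_def)
    then have v_past: "v t = transpose Bu *v h' t" if "t \<le> 0" for t
      using that by (simp add: v_def h'_def h(2) s0)
    have "c * m \<le> infsum (\<lambda>t. v t \<bullet> (matrix_inv S *v v t)) UNIV"
      unfolding past[symmetric]
    proof (rule infsum_mono)
      show "h' t \<bullet> (N1 *v h' t) \<le> v t \<bullet> (matrix_inv S *v v t)" for t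
        using Sinv_nonneg[of "v t"]
        by (cases "t \<le> 0") (simp_all add: N1_form v_past, simp add: h'_def)
    qed (intro summable_inner l2_intros h' v)+
    then have "ennreal (m + c * m) \<le> cost Q (X w) (C w)"
      using cost_identity[OF d g s srec xu(1) rec xu(2) v_def]
      by (simp add: cost_l2[OF Q xu] cost0 ennreal_leI)
    then have "ennreal (m + c * m) / ennreal m \<le> cost Q (X w) (C w) / ennreal m"
      by (rule divide_right_mono_ennreal)
    moreover have "ennreal (m + c * m) / ennreal m = ennreal (1 + c)"
    proof -
      have "(m + c * m) / m = 1 + c" using m by (simp add: field_simps)
      then show ?thesis using divide_ennreal[of "m + c * m" m] m c_nonneg by simp
    qed
    ultimately show ?thesis by (simp add: cc)
  qed
  also have "\<dots> \<le> worst_ratio A Bu Bw Q C X"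
    unfolding worst_ratio_def using w \<open>w \<noteq> (\<lambda>_. 0)\<close> by (intro SUP_upper) simp
  finally show ?thesis .
qed

subsection \<open>Upper bound\<close>

text \<open>In terms of \<open>e = h - \<Pi>b \<xi>\<close> and \<open>\<delta>\<^sub>t = e\<^sub>t - A\<^sub>K\<^sup>* e\<^sub>t\<^sub>+\<^sub>1\<close>, the controller equations become
  \<open>\<xi>\<^sub>t\<^sub>+\<^sub>1 = A\<^sub>K (\<xi>\<^sub>t + Z \<delta>\<^sub>t)\<close>. Writing \<open>s = (Q\<^sup>-\<^sup>1 + T) H \<sigma>\<close> and
  \<open>\<tau>\<^sub>t = \<sigma>\<^sub>t\<^sub>+\<^sub>1 - \<xi>\<^sub>t - Z \<delta>\<^sub>t\<close>, one obtains \<open>W \<tau> = (I - \<Pi>b Z) \<delta>\<close> and the energy balance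
  \<open>\<sigma>\<^sub>t\<^sub>+\<^sub>1 \<bullet> W \<sigma>\<^sub>t\<^sub>+\<^sub>1 = e\<^sub>t\<^sub>+\<^sub>1 \<bullet> N e\<^sub>t\<^sub>+\<^sub>1 + \<tau>\<^sub>t \<bullet> W \<tau>\<^sub>t + \<delta>\<^sub>t \<bullet> (Z - Z \<Pi>b Z) \<delta>\<^sub>t + V\<^sub>t - V\<^sub>t\<^sub>+\<^sub>1\<close>
  with \<open>V = \<xi> \<bullet> \<Pi>b \<xi> + 2 \<xi> \<bullet> e + e \<bullet> Z e\<close>. The two middle terms are nonnegative.\<close>

lemma causal_approximation_bound:
  assumes s: "s \<in> l2" and h: "h \<in> l2" "\<And>t. h t = transpose H *v s (t + 1) + transpose AK *v h (t + 1)"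
    and \<xi>: "\<xi> \<in> l2" "\<And>t. \<xi> (t + 1) = Fb *v \<xi> t + Kb *v s (t + 1)"
  shows "infsum (\<lambda>t. (h t - \<Pi>b *v \<xi> t) \<bullet> (N *v (h t - \<Pi>b *v \<xi> t))) UNIV
    \<le> infsum (\<lambda>t. s t \<bullet> (Ri *v s t)) UNIV"
proof -
  define e where "e t = h t - \<Pi>b *v \<xi> t" for t
  define \<delta> where "\<delta> t = e t - transpose AK *v e (t + 1)" for t
  define \<sigma> where "\<sigma> t = matrix_inv (Rf ** H) *v s t" for t
  define \<tau> where "\<tau> t = \<sigma> (t + 1) - (\<xi> t + Zs *v \<delta> t)" for t
  have e: "e \<in> l2" unfolding e_def by (intro l2_intros h(1) \<xi>(1))
  have \<delta>: "\<delta> \<in> l2" unfolding \<delta>_def by (intro l2_intros e)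
  have \<sigma>: "\<sigma> \<in> l2" unfolding \<sigma>_def by (intro l2_intros s)
  have \<tau>: "\<tau> \<in> l2" unfolding \<tau>_def by (intro l2_intros \<sigma> \<xi>(1) \<delta>)
  have s\<sigma>: "s t = Rf *v (H *v \<sigma> t)" for t
    using matrix_inv_cancel(2)[OF Rf_H_invertible, of "s t"]
    by (simp add: \<sigma>_def flip: matrix_vector_mul_assoc)
  have h_e: "h t = e t + \<Pi>b *v \<xi> t" for t by (simp add: e_def)
  have Hs: "transpose H *v s (t + 1) = h t - transpose AK *v h (t + 1)" for t
    by (subst h(2)) simp
  have \<xi>_next: "\<xi> (t + 1) = AK *v (\<xi> t + Zs *v \<delta> t)" for t
  proof -
    have "\<xi> (t + 1) - M *v (\<Pi>b *v \<xi> (t + 1))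
        = (Fb *v \<xi> t - M *v (\<Pi>b *v (Fb *v \<xi> t)))
          + (Kb *v s (t + 1) - M *v (\<Pi>b *v (Kb *v s (t + 1))))"
      by (simp add: \<xi>(2) mv_simps)
    also have "\<dots> = AK *v (\<xi> t - Zs *v (\<Pi>b *v \<xi> t)) + AK *v (Zs *v (h t - transpose AK *v h (t + 1)))"
      by (simp add: Fb_eq Kb_eq Hs)
    finally have "\<xi> (t + 1) = M *v (\<Pi>b *v \<xi> (t + 1)) + AK *v (\<xi> t - Zs *v (\<Pi>b *v \<xi> t))
        + AK *v (Zs *v (h t - transpose AK *v h (t + 1)))" by (simp add: algebra_simps)
    then show ?thesis by (simp add: h_e \<delta>_def M_mult mv_simps)
  qed
  let ?V = "\<lambda>t. \<xi> t \<bullet> (\<Pi>b *v \<xi> t) + 2 * (\<xi> t \<bullet> e t) + e t \<bullet> (Zs *v e t)"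
  let ?r = "\<lambda>t. \<tau> t \<bullet> (W *v \<tau> t) + (\<delta> t \<bullet> (Zs *v \<delta> t) - (Zs *v \<delta> t) \<bullet> (\<Pi>b *v (Zs *v \<delta> t)))"
  have step: "s (t + 1) \<bullet> (Ri *v s (t + 1))
      = (e (t + 1) \<bullet> (N *v e (t + 1)) + ?r t) + (- ?V (t + 1) - - ?V t)" for t
  proof -
    define \<kappa> where "\<kappa> = \<xi> t + Zs *v \<delta> t"
    have s2: "s (t + 1) \<bullet> (Ri *v s (t + 1)) = \<sigma> (t + 1) \<bullet> (W *v \<sigma> (t + 1))"
      by (simp add: s\<sigma> W_form)
    have \<sigma>\<tau>: "\<sigma> (t + 1) = \<tau> t + \<kappa>" by (simp add: \<tau>_def \<kappa>_def)
    have \<xi>\<kappa>: "\<xi> (t + 1) = AK *v \<kappa>" by (simp add: \<xi>_next \<kappa>_def)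
    have W\<tau>: "W *v \<tau> t = \<delta> t - \<Pi>b *v (Zs *v \<delta> t)"
    proof -
      have "W *v \<sigma> (t + 1) = \<delta> t + \<Pi>b *v \<xi> t - transpose AK *v (\<Pi>b *v \<xi> (t + 1))"
        using Hs[of t] by (simp add: W_mult s\<sigma> h_e \<delta>_def mv_simps)
      then have "W *v \<tau> t + W *v \<kappa> = \<delta> t + \<Pi>b *v \<xi> t - transpose AK *v (\<Pi>b *v (AK *v \<kappa>))"
        by (simp add: \<sigma>\<tau> \<xi>\<kappa> matrix_vector_right_distrib)
      moreover have "W *v \<kappa> = \<Pi>b *v \<kappa> - transpose AK *v (\<Pi>b *v (AK *v \<kappa>))"
        using \<Pi>b_mult[of \<kappa>] by simp
      ultimately have "W *v \<tau> t = \<delta> t + \<Pi>b *v \<xi> t - \<Pi>b *v \<kappa>" by (simp add: algebra_simps)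
      then show ?thesis by (simp add: \<kappa>_def matrix_vector_right_distrib)
    qed
    have Wsym: "transpose W = W" using posdef_W by (simp add: posdef_def)
    have a1: "\<sigma> (t + 1) \<bullet> (W *v \<sigma> (t + 1)) = \<tau> t \<bullet> (W *v \<tau> t) + 2 * (\<kappa> \<bullet> (W *v \<tau> t)) + \<kappa> \<bullet> (W *v \<kappa>)"
      using inner_symmetric[OF Wsym, of "\<tau> t" \<kappa>] by (simp add: \<sigma>\<tau> mv_simps inner_add inner_commute)
    have a2: "\<kappa> \<bullet> (W *v \<kappa>) = \<kappa> \<bullet> (\<Pi>b *v \<kappa>) - \<xi> (t + 1) \<bullet> (\<Pi>b *v \<xi> (t + 1))"
      using \<Pi>b_form[of \<kappa> \<kappa>] by (simp add: \<xi>\<kappa>)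
    have a3: "\<kappa> \<bullet> (\<Pi>b *v \<kappa>) = \<xi> t \<bullet> (\<Pi>b *v \<xi> t) + 2 * (\<xi> t \<bullet> (\<Pi>b *v (Zs *v \<delta> t)))
        + (Zs *v \<delta> t) \<bullet> (\<Pi>b *v (Zs *v \<delta> t))"
      using inner_symmetric[OF \<Pi>b_sym, of "\<xi> t" "Zs *v \<delta> t"]
      by (simp add: \<kappa>_def mv_simps inner_add inner_commute)
    have a4: "\<kappa> \<bullet> (W *v \<tau> t) = \<xi> t \<bullet> \<delta> t - \<xi> t \<bullet> (\<Pi>b *v (Zs *v \<delta> t)) + \<delta> t \<bullet> (Zs *v \<delta> t)
        - (Zs *v \<delta> t) \<bullet> (\<Pi>b *v (Zs *v \<delta> t))"
      by (simp add: W\<tau> \<kappa>_def inner_add inner_diff inner_commute)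
    have a5: "\<xi> t \<bullet> \<delta> t = \<xi> t \<bullet> e t - \<xi> (t + 1) \<bullet> e (t + 1) + (Zs *v \<delta> t) \<bullet> (transpose AK *v e (t + 1))"
    proof -
      have "(AK *v \<xi> t) \<bullet> e (t + 1) = \<xi> (t + 1) \<bullet> e (t + 1) - (AK *v (Zs *v \<delta> t)) \<bullet> e (t + 1)"
        by (simp add: \<xi>_next mv_simps inner_add)
      then show ?thesis by (simp add: \<delta>_def[of t] inner_diff_right inner_transpose')
    qed
    have a6: "2 * ((Zs *v \<delta> t) \<bullet> (transpose AK *v e (t + 1))) + \<delta> t \<bullet> (Zs *v \<delta> t)
        = e t \<bullet> (Zs *v e t) - e (t + 1) \<bullet> (Zs *v e (t + 1)) + e (t + 1) \<bullet> (N *v e (t + 1))"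
    proof -
      define f where "f = transpose AK *v e (t + 1)"
      have "\<delta> t = e t - f" by (simp add: \<delta>_def f_def)
      moreover have "e (t + 1) \<bullet> (Zs *v e (t + 1)) = f \<bullet> (Zs *v f) + e (t + 1) \<bullet> (N *v e (t + 1))"
        unfolding f_def by (rule Zs_form)
      ultimately show ?thesis using inner_symmetric[OF Zs_sym, of "e t" f]
        unfolding f_def[symmetric] by (simp add: mv_simps inner_diff inner_commute)
    qed
    show ?thesis unfolding s2 a1 a2 a3 a4 a5 using a6 by simp
  qed
  have sumV: "(\<lambda>t. - ?V t) summable_on UNIV"
    unfolding summable_on_uminus
    by (intro summable_on_add summable_on_cmult_right summable_inner l2_intros e \<xi>(1))
  have sumN: "(\<lambda>t. e (t + 1) \<bullet> (N *v e (t + 1))) summable_on UNIV" by (intro summable_inner l2_intros e)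
  have sumr: "?r summable_on UNIV"
  proof -
    have "(\<lambda>t. \<tau> t \<bullet> (W *v \<tau> t) + (\<delta> t \<bullet> (Zs *v \<delta> t) + - ((Zs *v \<delta> t) \<bullet> (\<Pi>b *v (Zs *v \<delta> t))))) summable_on UNIV"
      by (intro summable_on_add summable_on_uminus[THEN iffD2] summable_inner l2_intros \<tau> \<delta>)
    then show ?thesis by simp
  qed
  have "infsum (\<lambda>t. e t \<bullet> (N *v e t)) UNIV = infsum (\<lambda>t. e (t + 1) \<bullet> (N *v e (t + 1))) UNIV"
    by (rule infsum_shift[symmetric])
  also have "\<dots> \<le> infsum (\<lambda>t. e (t + 1) \<bullet> (N *v e (t + 1)) + ?r t) UNIV"
  proof (rule infsum_mono[OF sumN summable_on_add[OF sumN sumr]])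
    show "e (t + 1) \<bullet> (N *v e (t + 1)) \<le> e (t + 1) \<bullet> (N *v e (t + 1)) + ?r t" for t
      using posdef_nonneg[OF posdef_W, of "\<tau> t"] Zs_residual_nonneg[of "\<delta> t"] by simp
  qed
  also have "\<dots> = infsum (\<lambda>t. s (t + 1) \<bullet> (Ri *v s (t + 1))) UNIV"
    by (rule infsum_telescope[OF step summable_on_add[OF sumN sumr] sumV, symmetric])
  also have "\<dots> = infsum (\<lambda>t. s t \<bullet> (Ri *v s t)) UNIV" by (rule infsum_shift)
  finally show ?thesis by (simp add: e_def)
qed

text \<open>The optimal controller. The correction state is driven by \<open>s\<^sub>t\<^sub>+\<^sub>1 = A\<^sub>T s\<^sub>t + B\<^sub>w w\<^sub>t\<close>, which combines
  the two input terms of \<open>\<xi>2\<close>; the plant state is generated with \<open>A\<^sub>K\<close> in place of \<open>A\<close>, so that it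
  is in \<open>l2\<close>.\<close>

definition "filter_state w = l2_state AT Bw w"
definition "correction_state w = l2_state Fb Kb (\<lambda>t. filter_state w (t + 1))"
definition "correction w t = matrix_inv S *v (transpose Bu *v
  ((P ** AT) *v filter_state w t - \<Pi>b *v correction_state w t))"
definition "plant_state w = l2_state AK (mat 1) (\<lambda>t. Bu *v correction w t + Bw *v w t)"
definition "control w t = - (K *v plant_state w t) + correction w t"

lemmas filter_causal = causal_map_state[OF schur(2) causal_map_id, of Bw, folded filter_state_def]
lemmas correction_state_causal =
  causal_map_state[OF schur_Fb filter_causal(3), of Kb, folded correction_state_def]

lemma correction_causal: "causal_map correction" "strictly_causal correction"
  unfolding correction_def
  by (intro causal_map_matrix causal_map_diff filter_causal correction_state_causal)
    (intro strictly_causal_matrix strictly_causal_diff filter_causal correction_state_causal)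

lemmas plant_causal = causal_map_state[OF schur(1)
  causal_map_add[OF causal_map_matrix[OF correction_causal(1), of Bu]
    causal_map_matrix[OF causal_map_id, of Bw]], of "mat 1", folded plant_state_def]

lemma filter_state_eq:
  "w \<in> l2 \<Longrightarrow> filter_state w (t + 1) = AT *v filter_state w t + Bw *v w t"
  unfolding filter_state_def by (rule l2_state(2)[OF hyperbolic_AT])

lemma correction_state_eq:
  "w \<in> l2 \<Longrightarrow> correction_state w (t + 1) = Fb *v correction_state w t + Kb *v filter_state w (t + 1)"
  unfolding correction_state_def
  by (rule l2_state(2)[OF schur_hyperbolic[OF schur_Fb] causal_mapD(1)[OF filter_causal(3)]])

lemma plant_state_eq:
  assumes w: "w \<in> l2"
  shows "plant_state w (t + 1) = A *v plant_state w t + Bu *v control w t + Bw *v w t"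
proof -
  have "(\<lambda>t. Bu *v correction w t + Bw *v w t) \<in> l2"
    by (intro l2_intros causal_mapD(1)[OF correction_causal(1)] w)
  from l2_state(2)[OF hyperbolic_AK this, of "mat 1", folded plant_state_def] show ?thesis
    by (simp add: AK_mult control_def mv_simps matrix_vector_mult_minus)
qed

lemma control_eq: "control w t = correction w t - K *v plant_state w t"
  by (simp add: control_def)

lemma optimal_closed_loop: "closed_loop A Bu Bw control plant_state"
  unfolding closed_loop_def using plant_state_eq
  by (auto intro!: plant_causal strictly_causal_diff strictly_causal_matrix correction_causal
      simp: control_eq[abs_def])

lemma worst_ratio_le: "worst_ratio A Bu Bw Q control plant_state \<le> ennreal (1 + c)"
  unfolding worst_ratio_def
proof (rule SUP_least)
  fix w assume "w \<in> l2 - {\<lambda>_. 0 :: real^'n}"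
  then have w: "w \<in> l2" by simp
  note s = causal_mapD(1)[OF filter_causal(2) w]
  note \<xi> = causal_mapD(1)[OF correction_state_causal(2) w]
  note x = causal_mapD(1)[OF plant_causal(2) w]
  note r = causal_mapD(1)[OF correction_causal(1) w]
  have u: "control w \<in> l2" unfolding control_eq[abs_def] by (intro l2_intros r x)
  have d: "(\<lambda>t. Bw *v w t) \<in> l2" by (rule l2_matrix[OF w])
  obtain g h where g: "g \<in> l2" "\<And>t. g t = P *v (Bw *v w t) + transpose AK *v g (t + 1)"
    and h: "h \<in> l2" "\<And>t. h t = g t + P *v (AT *v filter_state w t)"
    and hrec: "\<And>t. h t = transpose H *v filter_state w (t + 1) + transpose AK *v h (t + 1)"
    by (rule feedforward[OF d s filter_state_eq[OF w]]) (rule that)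
  define e where "e t = h t - \<Pi>b *v correction_state w t" for t
  define v where "v t = S *v (control w t + K *v plant_state w t) + transpose Bu *v g t" for t
  have ve: "v t = transpose Bu *v e t" for t
    by (simp add: v_def control_eq correction_def S_inv e_def h(2) mv_simps algebra_simps)
  define m where "m = infsum (\<lambda>t. filter_state w t \<bullet> (Ri *v filter_state w t)) UNIV"
  have m: "0 \<le> m" unfolding m_def by (intro infsum_nonneg posdef_nonneg[OF posdef_Ri])
  have "infsum (\<lambda>t. v t \<bullet> (matrix_inv S *v v t)) UNIV = c * infsum (\<lambda>t. e t \<bullet> (N *v e t)) UNIV"
    by (simp add: ve c_N_form flip: N1_form infsum_cmult_right')
  also have "\<dots> \<le> c * m"
    using causal_approximation_bound[OF s h(1) hrec \<xi> correction_state_eq[OF w]] c_nonneg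
    by (intro mult_left_mono) (simp_all add: e_def m_def)
  finally have "cost Q (plant_state w) (control w) \<le> ennreal ((1 + c) * m)"
    using cost_identity[OF d g s filter_state_eq[OF w] x plant_state_eq[OF w] u v_def]
    by (simp add: cost_l2[OF Q x u] m_def ennreal_leI algebra_simps)
  then have "cost Q (plant_state w) (control w) / ennreal m \<le> ennreal ((1 + c) * m) / ennreal m"
    by (rule divide_right_mono_ennreal)
  also have "\<dots> \<le> ennreal (1 + c)"
    using m c_nonneg by (cases "m = 0") (simp_all add: divide_ennreal)
  finally show "cost Q (plant_state w) (control w) / clairvoyant_cost A Bu Bw Q w \<le> ennreal (1 + c)"
    by (simp add: clairvoyant_cost_eq[OF w s filter_state_eq[OF w]] m_def)
qed

lemma optimal_worst_ratio: "worst_ratio A Bu Bw Q control plant_state = ennreal (1 + c)"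
  by (rule antisym[OF worst_ratio_le worst_ratio_ge[OF optimal_closed_loop]])

lemma comp_ratio_eq: "comp_ratio A Bu Bw Q = ennreal (1 + c)"
  unfolding comp_ratio_def
proof (rule antisym)
  show "(INF (C, X)\<in>{(C, X). closed_loop A Bu Bw C X}. worst_ratio A Bu Bw Q C X) \<le> ennreal (1 + c)"
    by (rule INF_lower2[of "(control, plant_state)"])
      (simp_all add: optimal_closed_loop optimal_worst_ratio)
  show "ennreal (1 + c) \<le> (INF (C, X)\<in>{(C, X). closed_loop A Bu Bw C X}. worst_ratio A Bu Bw Q C X)"
    by (rule INF_greatest) (auto intro: worst_ratio_ge)
qed

end

text \<open>The rank condition contains that the transfer function has no pole on the circle.\<close>

lemma hyperbolic_if_full_column_rank:
  assumes "full_column_rank_on_circle C A B"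
  shows "hyperbolic A"
  unfolding hyperbolic_def
proof (intro allI impI notI)
  fix c assume ev: "eigenvalue (cmat A) c" and "cmod c = 1"
  then have "c = cis (Arg c)" by (subst cis_Arg) (auto simp: sgn_div_norm)
  then obtain \<omega> where "c = cis \<omega>" by blast
  then have "invertible (mat c - cmat A)" using assms by (simp add: full_column_rank_on_circle_def)
  moreover obtain z where "z \<noteq> 0" "cmat A *v z = c *s z" using ev by (auto simp: eigenvalue_def)
  moreover have "(mat c - cmat A) *v z = 0"
    using \<open>cmat A *v z = c *s z\<close> by (simp add: mv_simps mat_vector_mult)
  ultimately show False by (metis matrix_inv_cancel(1) matrix_vector_mult_0_right)
qed

theorem theorem2:
  fixes A Bw Q P T Z1 \<Pi>b Zs :: "real^'n^'n" and Bu :: "real^'p^'n"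
  assumes "posdef Q"
    and "stabilizable A Bu"
    and "rank Bw = CARD('n)"
    and "full_column_rank_on_circle (mat_sqrt Q) A Bw"
    and "lqr_stabilizing_solution A Bu Q P"
    and "filter_stabilizing_solution A Bu Q T"
    and "Z1 = A_K A Bu P ** Z1 ** transpose (A_K A Bu P)
              + Bu ** matrix_inv (lqr_S Bu P) ** transpose Bu"
    and "\<Pi>b = transpose (A_K A Bu P) ** \<Pi>b ** A_K A Bu P
              + (P - transpose (A_K A Bu P) ** P ** A_T A Q T) ** (matrix_inv Q + T)
                ** (P - transpose (A_T A Q T) ** P ** A_K A Bu P)"
    and "Zs = A_K A Bu P ** Zs ** transpose (A_K A Bu P)
              + inverse (lambda_max (Z1 ** \<Pi>b))
                *\<^sub>R (Bu ** matrix_inv (lqr_S Bu P) ** transpose Bu)"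
  shows "comp_ratio A Bu Bw Q = ennreal (1 + lambda_max (Z1 ** \<Pi>b)) \<and>
    (\<exists>K X \<xi>1 \<xi>2.
      closed_loop A Bu Bw K X \<and> strictly_causal \<xi>1 \<and> strictly_causal \<xi>2 \<and>
      (\<forall>w\<in>l2. \<forall>t.
         K w t = - (K_lqr A Bu P *v X w t)
                 + matrix_inv (lqr_S Bu P) *v (transpose Bu *v
                     ((P ** A_T A Q T) *v \<xi>1 w t - \<Pi>b *v \<xi>2 w t)) \<and>
         \<xi>1 w (t + 1) = A_T A Q T *v \<xi>1 w t + Bw *v w t \<and>
         \<xi>2 w (t + 1) = (K_bar A Bu Q P T \<Pi>b Zs ** A_T A Q T) *v \<xi>1 w t
                 + F_bar A Bu Q P T \<Pi>b Zs *v \<xi>2 w t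
                 + (K_bar A Bu Q P T \<Pi>b Zs ** Bw) *v w t) \<and>
      worst_ratio A Bu Bw Q K X = ennreal (1 + lambda_max (Z1 ** \<Pi>b)))"
proof -
  have "invertible Bw"
    using assms(3) full_rank_injective[of Bw]
    by (intro invertible_if_trivial_kernel) (metis injD matrix_vector_mult_0_right)
  then interpret competitive_system A Q P T Bu Bw Z1 \<Pi>b Zs
    by unfold_locales (use assms hyperbolic_if_full_column_rank in auto)
  show ?thesis
  proof (rule conjI, goal_cases)
    case 1
    show ?case using comp_ratio_eq by (simp add: c_def)
  next
    case 2
    show ?case
      by (rule exI[of _ control], rule exI[of _ plant_state], rule exI[of _ filter_state],
          rule exI[of _ correction_state])
        (use optimal_worst_ratio in \<open>auto simp: optimal_closed_loop filter_causal correction_state_causal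
          filter_state_eq correction_state_eq control_def correction_def c_def
          matrix_vector_right_distrib simp flip: matrix_vector_mul_assoc\<close>)
  qed
qed

end
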